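(* Consider AdaSVRF with snapshot times $s_k=2^k-1$ ($k\in\mathbb{N}$, $k\geq0$), batch-sizes $b_t=24(K+1+\kappa)(t+2)$ where $\kappa=\lambda_0^+/\lambda_0^-$, learning rates $\eta_t=\lambda_t^-/L$, and step-size bounds $\gamma_t=\frac{2}{t+2}$. Then for all $t\in\{1,\ldots,T\}$, $$\mathsf{E}[f(x_t)]-\min_{\mathcal{C}}f\leq\frac{2LD^2(K+1+\kappa)}{t+2}.$$
   Context: Problem. $\mathcal{C}\subset\mathbb{R}^n$ is a compact convex set, $f_1,\ldots,f_m\colon\mathbb{R}^n\to\mathbb{R}$ are smooth convex functions, and $f=\frac1m\sum_{i=1}^m f_i$. $L$ is the smoothness constant of the $f_i$ on $\mathcal{C}$: $L=\max_{1\leq i\leq m}\sup_{x,y\in\mathcal{C},\,x\neq y}\frac{\|\nabla f_i(y)-\nabla f_i(x)\|_2}{\|y-x\|_2}$. $D=\max_{x,y\in\mathcal{C}}\|y-x\|_2$. For a symmetric positive definite matrix $H$, $\|x\|_H=\sqrt{\langle x,Hx\rangle}$. AdaSVRF. Inputs: a start point $x_0\in\mathcal{C}$, snapshot times $s_k<s_{k+1}$ ($k\geq0$) with $s_0=0$, batch-sizes $b_t\in\mathbb{N}\setminus\{0\}$, bounds $0<\lambda_t^-\leq\lambda_{t+1}^-\leq\lambda_{t+1}^+\leq\lambda_t^+$, a number of inner iterations $K\in\mathbb{N}\setminus\{0\}$, learning rates $\eta_t>0$, step-size bounds $\gamma_t\in[0,1]$. For $t=0,\ldots,T-1$: 1.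 If $t\in\{s_k\mid k\geq0\}$, set $\tilde x_t=x_t$ and $\tilde\nabla f(x_t)=\nabla f(\tilde x_t)$. Otherwise, set $\tilde x_t=\tilde x_{t-1}$, sample $i_1,\ldots,i_{b_t}$ i.i.d. uniformly from $\{1,\ldots,m\}$, and set $\tilde\nabla f(x_t)=\nabla f(\tilde x_t)+\frac{1}{b_t}\sum_{j=1}^{b_t}(\nabla f_{i_j}(x_t)-\nabla f_{i_j}(\tilde x_t))$. 2. Update the diagonal matrix $H_t\in\mathbb{R}^{n\times n}$ (any diagonal matrix with positive diagonal entries is allowed) and clip its diagonal entries to $[\lambda_t^-,\lambda_t^+]$. 3. Let $Q_t(x)=f(x_t)+\langle\tilde\nabla f(x_t),x-x_t\rangle+\frac{1}{2\eta_t}\|x-x_t\|_{H_t}^2$, so $\nabla Q_t(y)=\tilde\nabla f(x_t)+\frac{1}{\eta_t}H_t(y-x_t)$. Set $y_0^{(t)}=x_t$ and, for $k=0,\ldots,K-1$: choose $v_k^{(t)}\in\arg\min_{v\in\mathcal{C}}\langle\nabla Q_t(y_k^{(t)}),v\rangle$; set $\gamma_k^{(t)}=\min\left\{\eta_t\frac{\langle\nabla Q_t(y_k^{(t)}),y_k^{(t)}-v_k^{(t)}\rangle}{\|y_k^{(t)}-v_k^{(t)}\|_{H_t}^2},\gamma_t\right\}$ (if $v_k^{(t)}=y_k^{(t)}$ the value is immaterial); set $y_{k+1}^{(t)}=y_k^{(t)}+\gamma_k^{(t)}(v_k^{(t)}-y_k^{(t)})$. 4. Set $x_{t+1}=y_K^{(t)}$.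 $\mathsf{E}$ is the expectation with respect to all the randomness in the algorithm. *)

theory Defs
  imports "HOL-Probability.Probability"
begin

section \<open>Finite-sum objectives\<close>

definition gradient :: "('a::real_inner \<Rightarrow> real) \<Rightarrow> 'a \<Rightarrow> 'a" where
  "gradient f x = (THE D. GDERIV f x :> D)"

definition finite_sum :: "nat \<Rightarrow> (nat \<Rightarrow> 'a \<Rightarrow> real) \<Rightarrow> 'a \<Rightarrow> real" where
  "finite_sum m f x = (\<Sum>i=1..m. f i x) / real m"

text \<open>
  The suprema below are meaningful when each gradient is Lipschitz on \<open>C\<close> and \<open>C\<close> has at least two
  points; the value is unspecified when \<open>C\<close> is a singleton.
\<close>

definition smoothness_const :: "'a::real_inner set \<Rightarrow> nat \<Rightarrow> (nat \<Rightarrow> 'a \<Rightarrow> real) \<Rightarrow> real" where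
  "smoothness_const C m f =
     (MAX i\<in>{1..m}. SUP (x, y)\<in>{(x, y). x \<in> C \<and> y \<in> C \<and> x \<noteq> y}.
        norm (gradient (f i) y - gradient (f i) x) / norm (y - x))"

section \<open>Diagonal scalings\<close>

definition is_diagonal :: "real^'n^'n \<Rightarrow> bool" where
  "is_diagonal A \<longleftrightarrow> (\<forall>i j. i \<noteq> j \<longrightarrow> A $ i $ j = 0)"

definition clip_diagonal :: "real \<Rightarrow> real \<Rightarrow> real^'n^'n \<Rightarrow> real^'n^'n" where
  "clip_diagonal l u A = (\<chi> i j. if i = j then max l (min u (A $ i $ j)) else A $ i $ j)"

definition norm_wrt :: "real^'n^'n \<Rightarrow> real^'n \<Rightarrow> real" where
  "norm_wrt H x = sqrt (x \<bullet> (H *v x))"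

section \<open>The algorithm\<close>

definition subproblem ::
  "real \<Rightarrow> real^'n \<Rightarrow> real \<Rightarrow> real^'n^'n \<Rightarrow> real^'n \<Rightarrow> real^'n \<Rightarrow> real" where
  "subproblem fx g \<eta> H x z = fx + g \<bullet> (z - x) + 1 / (2 * \<eta>) * (norm_wrt H (z - x))\<^sup>2"

text \<open>
  A run of AdaSVRF on the objective \<open>finite_sum m f\<close> over \<open>C\<close>, for \<open>T\<close> outer iterations.

  Inputs: start point \<open>x0\<close>, snapshot times \<open>s\<close>, batch sizes \<open>b\<close>, bounds \<open>lm\<close> (lower) and \<open>lp\<close>
  (upper) on the diagonal entries, number \<open>K\<close> of inner iterations, learning rates \<open>\<eta>\<close>, step-size
  bounds \<open>\<gamma>\<close>.

  Random variables: \<open>ind t j\<close> is the \<open>j\<close>-th index sampled at iteration \<open>t\<close>, \<open>x t\<close> the iterate,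
  \<open>xs t\<close> the snapshot point, \<open>g t\<close> the gradient estimator, \<open>A t\<close> and \<open>H t\<close> the diagonal matrix
  before and after clipping, \<open>y t k\<close> and \<open>v t k\<close> the inner iterates and the vertices returned by the
  linear minimization.

  The filtration models the randomness: \<open>F t\<close> holds the information available before iteration
  \<open>t\<close>. The indices sampled at iteration \<open>t\<close> are uniform, and independent of each other and of
  \<open>F t\<close>. The matrix \<open>A t\<close> and the choices \<open>v t k\<close> may depend (even with additional randomization) on
  everything up to and including iteration \<open>t\<close>, but not on later samples.
\<close>

locale adasvrf = prob_space M + filtration "space M" F
  for M :: "'w measure" and F :: "nat \<Rightarrow> 'w measure" +
  fixes C :: "(real^'n) set" and m :: nat and f :: "nat \<Rightarrow> real^'n \<Rightarrow> real" and T :: nat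
    and x0 :: "real^'n" and s :: "nat \<Rightarrow> nat" and b :: "nat \<Rightarrow> nat"
    and lm lp :: "nat \<Rightarrow> real" and K :: nat and \<eta> \<gamma> :: "nat \<Rightarrow> real"
    and ind :: "nat \<Rightarrow> nat \<Rightarrow> 'w \<Rightarrow> nat"
    and x xs g :: "nat \<Rightarrow> 'w \<Rightarrow> real^'n"
    and A H :: "nat \<Rightarrow> 'w \<Rightarrow> real^'n^'n"
    and y v :: "nat \<Rightarrow> nat \<Rightarrow> 'w \<Rightarrow> real^'n"
  assumes x0_in: "x0 \<in> C"
    and snapshot_times: "s 0 = 0" "strict_mono s"
    and batch_pos: "\<And>t. 0 < b t"
    and bounds: "\<And>t. 0 < lm t" "\<And>t. lm t \<le> lm (Suc t)" "\<And>t. lm (Suc t) \<le> lp (Suc t)"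
      "\<And>t. lp (Suc t) \<le> lp t"
    and K_pos: "0 < K"
    and eta_pos: "\<And>t. 0 < \<eta> t"
    and gamma_range: "\<And>t. \<gamma> t \<in> {0..1}"
    and F_sub: "\<And>t. subalgebra M (F t)"
    and ind_measurable: "\<And>t j. t < T \<Longrightarrow> t \<notin> range s \<Longrightarrow> j \<in> {1..b t} \<Longrightarrow>
      ind t j \<in> measurable (F (Suc t)) (count_space {1..m})"
    and ind_uniform: "\<And>t j. t < T \<Longrightarrow> t \<notin> range s \<Longrightarrow> j \<in> {1..b t} \<Longrightarrow>
      distr M (count_space {1..m}) (ind t j) = uniform_count_measure {1..m}"
      \<comment> \<open>index \<open>0\<close> stands for the past \<open>F t\<close>, index \<open>j \<ge> 1\<close> for the \<open>j\<close>-th sample\<close>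
    and ind_indep: "\<And>t. t < T \<Longrightarrow> t \<notin> range s \<Longrightarrow>
      indep_sets (\<lambda>j. if j = 0 then sets (F t) else {ind t j -` B \<inter> space M |B. B \<subseteq> {1..m}}) {0..b t}"
    and A_measurable: "\<And>t. t < T \<Longrightarrow> A t \<in> borel_measurable (F (Suc t))"
    and v_measurable: "\<And>t k. t < T \<Longrightarrow> k < K \<Longrightarrow> v t k \<in> borel_measurable (F (Suc t))"
    and x_init: "\<And>\<omega>. \<omega> \<in> space M \<Longrightarrow> x 0 \<omega> = x0"
    and snapshot: "\<And>t \<omega>. \<omega> \<in> space M \<Longrightarrow> t < T \<Longrightarrow>
      xs t \<omega> = (if t \<in> range s then x t \<omega> else xs (t - 1) \<omega>)"
    and estimator: "\<And>t \<omega>. \<omega> \<in> space M \<Longrightarrow> t < T \<Longrightarrow>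
      g t \<omega> = (if t \<in> range s then gradient (finite_sum m f) (xs t \<omega>)
        else gradient (finite_sum m f) (xs t \<omega>) +
          (1 / real (b t)) *\<^sub>R
            (\<Sum>j=1..b t. gradient (f (ind t j \<omega>)) (x t \<omega>) - gradient (f (ind t j \<omega>)) (xs t \<omega>)))"
    and A_diagonal: "\<And>t \<omega>. \<omega> \<in> space M \<Longrightarrow> t < T \<Longrightarrow> is_diagonal (A t \<omega>) \<and> (\<forall>i. 0 < A t \<omega> $ i $ i)"
    and H_clip: "\<And>t \<omega>. \<omega> \<in> space M \<Longrightarrow> t < T \<Longrightarrow> H t \<omega> = clip_diagonal (lm t) (lp t) (A t \<omega>)"
    and y_init: "\<And>t \<omega>. \<omega> \<in> space M \<Longrightarrow> t < T \<Longrightarrow> y t 0 \<omega> = x t \<omega>"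
    and lmo: "\<And>t k \<omega>. \<omega> \<in> space M \<Longrightarrow> t < T \<Longrightarrow> k < K \<Longrightarrow>
      is_arg_min (\<lambda>u. gradient (subproblem (finite_sum m f (x t \<omega>)) (g t \<omega>) (\<eta> t) (H t \<omega>) (x t \<omega>))
        (y t k \<omega>) \<bullet> u) (\<lambda>u. u \<in> C) (v t k \<omega>)"
      \<comment> \<open>if \<open>v t k \<omega> = y t k \<omega>\<close>, the step size (then \<open>0\<close>, by division by zero) is immaterial\<close>
    and inner_step: "\<And>t k \<omega>. \<omega> \<in> space M \<Longrightarrow> t < T \<Longrightarrow> k < K \<Longrightarrow>
      y t (Suc k) \<omega> = y t k \<omega> +
        min (\<eta> t *
              (gradient (subproblem (finite_sum m f (x t \<omega>)) (g t \<omega>) (\<eta> t) (H t \<omega>) (x t \<omega>)) (y t k \<omega>)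
                 \<bullet> (y t k \<omega> - v t k \<omega>) / (norm_wrt (H t \<omega>) (y t k \<omega> - v t k \<omega>))\<^sup>2))
            (\<gamma> t) *\<^sub>R (v t k \<omega> - y t k \<omega>)"
    and outer_step: "\<And>t \<omega>. \<omega> \<in> space M \<Longrightarrow> t < T \<Longrightarrow> x (Suc t) \<omega> = y t K \<omega>"

end

theory Submission
  imports Defs
begin

text \<open>
  Cocoercivity of the gradients on \<open>C\<close>, restricted to directions of the affine hull, bounds the mean
  squared gradient distance \<open>q\<close> between an iterate \<open>x\<close> and the minimizer by \<open>L\<close> times the slope of the
  objective towards the minimizer. The part of the variance of the estimator that comes from the
  current iterate is therefore absorbed by the progress of the first Frank-Wolfe step; the model
  decrease pays for the noise of the later inner steps.

  The part that comes from the snapshot needs a bound of \<open>q\<close> by the primal gap. Since smoothness is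
  only known on \<open>C\<close>, such a bound does not hold pointwise. Instead, the segment from the minimizer to
  the iterate is cut at geometric scales, and each scale costs the decrease of the objective along it.
  At coarse scales this is at most the primal gap; at fine scales it is at most a fraction of the
  Frank-Wolfe gap of a recent iterate, which is of order \<open>K / t\<close> on average because the gap cannot stay
  above its past values. Bounds on the primal gap and on \<open>q\<close> of order \<open>1 / t\<close> are then proved by
  simultaneous induction on \<open>t\<close>.
\<close>

section \<open>Gradients of convex functions\<close>

text \<open>The constant of the bound is prescribed, so the induction must close within a fixed
  budget. In units of L D^2 the claim reads e <= A/(t+2) with A = 2(K+1+\<kappa>), and the
  contraction by the first Frank-Wolfe step leaves A/(t+2)^2 for all errors of iteration t. The
  curvature of that step costs 2\<kappa>, its noise costs 2 and half a unit of variance by Young's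
  inequality; 2K remain for the variance. The batch size divides the variance by 12A(t+2). If
  \<open>q\<close> is at most cA/(t+2), the variance is of order c/(t+2)^2. A recent Frank-Wolfe gap
  is only of order K/t, so about log K scales have to be left to the primal gap, and c grows like
  log K. A step-by-step treatment of the inner iterations multiplies the variance by K/2 and would
  cost K log K, which is too much for large K; the cubic model decrease charges less per unit of
  variance. The dyadic snapshot times make the last snapshot at most twice as old as allowed by t+2,
  a factor 2 in its share of the variance.\<close>

lemma GDERIV_gradient:
  fixes f :: "'a::euclidean_space \<Rightarrow> real"
  assumes "f differentiable (at z)"
  shows "GDERIV f z :> gradient f z"
proof -
  obtain f' where f': "(f has_derivative f') (at z)"
    using assms by (auto simp: differentiable_def)
  have lin: "linear f'"
    using f' by (rule has_derivative_linear)
  have "f' h = h \<bullet> adjoint f' 1" for h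
    using adjoint_works[OF lin, of h 1] by simp
  then have "f' = (\<lambda>h. h \<bullet> adjoint f' 1)"
    by auto
  then have G: "GDERIV f z :> adjoint f' 1"
    using f' by (simp add: gderiv_def)
  have "D = adjoint f' 1" if "GDERIV f z :> D" for D
  proof -
    have "(\<lambda>h. h \<bullet> D) = (\<lambda>h. h \<bullet> adjoint f' 1)"
      using has_derivative_unique that G unfolding gderiv_def by blast
    then have "h \<bullet> D = h \<bullet> adjoint f' 1" for h
      by meson
    then show ?thesis
      by (metis inner_eq_zero_iff inner_diff_right right_minus_eq)
  qed
  then show ?thesis
    unfolding gradient_def using G by (metis the_equality)
qed

lemma gradient_eqI:
  fixes f :: "'a::euclidean_space \<Rightarrow> real"
  assumes "GDERIV f z :> D"
  shows "gradient f z = D"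
proof -
  have "f differentiable (at z)"
    using assms by (auto simp: gderiv_def differentiable_def)
  from GDERIV_gradient[OF this]
  have "(\<lambda>h. h \<bullet> D) = (\<lambda>h. h \<bullet> gradient f z)"
    using has_derivative_unique assms unfolding gderiv_def by blast
  then have "h \<bullet> D = h \<bullet> gradient f z" for h
    by meson
  then show ?thesis
    by (metis inner_eq_zero_iff inner_diff_right right_minus_eq)
qed

lemma has_real_derivative_along_line:
  fixes f :: "'a::euclidean_space \<Rightarrow> real"
  assumes "f differentiable (at (x + t *\<^sub>R d))"
  shows "((\<lambda>t. f (x + t *\<^sub>R d)) has_real_derivative gradient f (x + t *\<^sub>R d) \<bullet> d) (at t)"
proof -
  have "(f has_derivative (\<lambda>h. h \<bullet> gradient f (x + t *\<^sub>R d))) (at (x + t *\<^sub>R d))"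
    using GDERIV_gradient[OF assms] by (simp add: gderiv_def)
  moreover have "((\<lambda>t. x + t *\<^sub>R d) has_derivative (\<lambda>h. h *\<^sub>R d)) (at t)"
    by (auto intro!: derivative_eq_intros)
  ultimately have "((\<lambda>t. f (x + t *\<^sub>R d)) has_derivative
      (\<lambda>h. (h *\<^sub>R d) \<bullet> gradient f (x + t *\<^sub>R d))) (at t)"
    using has_derivative_compose by force
  then show ?thesis
    by (simp add: has_field_derivative_def inner_commute mult.commute mult_commute_abs)
qed

lemma convex_gradient_ineq:
  fixes f :: "'a::euclidean_space \<Rightarrow> real"
  assumes "convex_on UNIV f" "f differentiable (at x)"
  shows "f x + gradient f x \<bullet> (y - x) \<le> f y"
proof -
  let ?p = "\<lambda>t. f (x + t *\<^sub>R (y - x))"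
  have "(?p has_real_derivative gradient f (x + 0 *\<^sub>R (y - x)) \<bullet> (y - x)) (at 0)"
    by (rule has_real_derivative_along_line) (use assms in simp)
  then have "((\<lambda>t. (?p t - ?p 0) / (t - 0)) \<longlongrightarrow> gradient f x \<bullet> (y - x)) (at 0)"
    by (simp add: has_field_derivative_iff)
  then have "((\<lambda>t. (?p t - ?p 0) / (t - 0)) \<longlongrightarrow> gradient f x \<bullet> (y - x)) (at_right 0)"
    by (rule filterlim_mono) (auto simp: at_le)
  moreover have "eventually (\<lambda>t. (?p t - ?p 0) / (t - 0) \<le> f y - f x) (at_right 0)"
  proof -
    have "eventually (\<lambda>t::real. 0 < t \<and> t < 1) (at_right 0)"
      by (metis (mono_tags) eventually_at_right_field zero_less_one)
    then show ?thesis
    proof (rule eventually_mono)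
      fix t :: real assume t: "0 < t \<and> t < 1"
      have "x + t *\<^sub>R (y - x) = (1 - t) *\<^sub>R x + t *\<^sub>R y"
        by (simp add: algebra_simps)
      then have "?p t \<le> (1 - t) * f x + t * f y"
        using convex_onD[OF assms(1), of t x y] t by simp
      then have "?p t - ?p 0 \<le> (f y - f x) * t"
        by (simp add: algebra_simps)
      then show "(?p t - ?p 0) / (t - 0) \<le> f y - f x"
        using t by (simp add: divide_le_eq)
    qed
  qed
  ultimately have "gradient f x \<bullet> (y - x) \<le> f y - f x"
    by (intro tendsto_upperbound) auto
  then show ?thesis by simp
qed

text \<open>The gradient is Lipschitz only on \<open>C\<close>, so the comparison runs along the
  segment, which convexity keeps inside.\<close>

lemma descent_lemma:
  fixes f :: "'a::euclidean_space \<Rightarrow> real"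
  assumes "convex C" "x \<in> C" "y \<in> C"
    and "\<And>z. f differentiable (at z)"
    and lip: "\<And>u v. u \<in> C \<Longrightarrow> v \<in> C \<Longrightarrow> norm (gradient f u - gradient f v) \<le> L * norm (u - v)"
  shows "f y \<le> f x + gradient f x \<bullet> (y - x) + L / 2 * (norm (y - x))\<^sup>2"
proof -
  define d where "d = y - x"
  let ?p = "\<lambda>t. f (x + t *\<^sub>R d) - t * (gradient f x \<bullet> d) - L * t\<^sup>2 / 2 * (norm d)\<^sup>2"
  have "?p 1 \<le> ?p 0"
  proof (rule DERIV_nonpos_imp_nonincreasing[of 0 1 ?p])
    fix t :: real assume t: "0 \<le> t" "t \<le> 1"
    have "(?p has_real_derivative (gradient f (x + t *\<^sub>R d) \<bullet> d - gradient f x \<bullet> d - L * t * (norm d)\<^sup>2)) (at t)"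
      by (rule derivative_eq_intros has_real_derivative_along_line assms refl | simp add: field_simps)+
    moreover have "(gradient f (x + t *\<^sub>R d) - gradient f x) \<bullet> d \<le> L * t * (norm d)\<^sup>2"
    proof -
      have "x + t *\<^sub>R d = (1 - t) *\<^sub>R x + t *\<^sub>R y"
        by (simp add: algebra_simps d_def)
      then have "x + t *\<^sub>R d \<in> C"
        using assms(1-3) t by (simp add: convexD_alt)
      then have "norm (gradient f (x + t *\<^sub>R d) - gradient f x) \<le> L * norm (t *\<^sub>R d)"
        using lip[of "x + t *\<^sub>R d" x] assms(2) by simp
      then have "norm (gradient f (x + t *\<^sub>R d) - gradient f x) * norm d \<le> (L * (t * norm d)) * norm d"
        using t by (intro mult_right_mono) auto
      then show ?thesis
        using norm_cauchy_schwarz[of "gradient f (x + t *\<^sub>R d) - gradient f x" d]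
        by (simp add: power2_eq_square mult.assoc)
    qed
    ultimately show "\<exists>y. (?p has_real_derivative y) (at t) \<and> y \<le> 0"
      by (auto simp: inner_diff_left intro!: exI)
  qed simp
  then show ?thesis by (simp add: d_def)
qed

lemma norm_sum_weighted_Cauchy_Schwarz:
  fixes v :: "'i \<Rightarrow> 'a::real_normed_vector" and w :: "'i \<Rightarrow> real"
  assumes "\<And>k. k \<in> I \<Longrightarrow> 0 < w k"
  shows "(norm (\<Sum>k\<in>I. v k))\<^sup>2 \<le> (\<Sum>k\<in>I. 1 / w k) * (\<Sum>k\<in>I. w k * (norm (v k))\<^sup>2)"
proof -
  have "norm (\<Sum>k\<in>I. v k) \<le> (\<Sum>k\<in>I. norm (v k))"
    by (rule norm_sum)
  also have "\<dots> = (\<Sum>k\<in>I. (1 / sqrt (w k)) * (sqrt (w k) * norm (v k)))"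
  proof (rule sum.cong)
    fix k assume "k \<in> I"
    then have "sqrt (w k) \<noteq> 0" using assms by fastforce
    then show "norm (v k) = (1 / sqrt (w k)) * (sqrt (w k) * norm (v k))" by simp
  qed simp
  finally have "(norm (\<Sum>k\<in>I. v k))\<^sup>2 \<le> (\<Sum>k\<in>I. (1 / sqrt (w k)) * (sqrt (w k) * norm (v k)))\<^sup>2"
    by (intro power_mono) auto
  also have "\<dots> \<le> (\<Sum>k\<in>I. (1 / sqrt (w k))\<^sup>2) * (\<Sum>k\<in>I. (sqrt (w k) * norm (v k))\<^sup>2)"
    by (rule Cauchy_Schwarz_ineq_sum)
  also have "\<dots> = (\<Sum>k\<in>I. 1 / w k) * (\<Sum>k\<in>I. w k * (norm (v k))\<^sup>2)"
    using assms by (intro arg_cong2[where f="(*)"] sum.cong refl)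
      (auto simp: power_divide power_mult_distrib less_imp_le)
  finally show ?thesis .
qed

section \<open>Families of smooth convex functions on a compact convex set\<close>

text \<open>
  \<open>P\<close> plays the role of the orthogonal projection onto the directions of the affine hull of \<open>C\<close>:
  only these components of the gradients matter, and only they are controlled by cocoercivity.
\<close>

locale smooth_family =
  fixes C :: "'a::euclidean_space set" and m :: nat
    and f :: "nat \<Rightarrow> 'a \<Rightarrow> real" and df :: "nat \<Rightarrow> 'a \<Rightarrow> 'a"
    and L D :: real and P :: "'a \<Rightarrow> 'a"
  assumes compact_C: "compact C" and convex_C: "convex C"
    and m_pos: "1 \<le> m" and L_pos: "0 < L"
    and diam: "x \<in> C \<Longrightarrow> y \<in> C \<Longrightarrow> norm (x - y) \<le> D"
    and tangent: "i \<in> {1..m} \<Longrightarrow> x \<in> C \<Longrightarrow> y \<in> C \<Longrightarrow> f i x + df i x \<bullet> (y - x) \<le> f i y"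
    and smooth: "i \<in> {1..m} \<Longrightarrow> x \<in> C \<Longrightarrow> y \<in> C \<Longrightarrow>
      f i y \<le> f i x + df i x \<bullet> (y - x) + L / 2 * (norm (y - x))\<^sup>2"
    and lip: "i \<in> {1..m} \<Longrightarrow> x \<in> C \<Longrightarrow> y \<in> C \<Longrightarrow> norm (df i x - df i y) \<le> L * norm (x - y)"
    and P_linear: "linear P" and P_norm: "norm (P z) \<le> norm z"
    and P_diff: "x \<in> C \<Longrightarrow> y \<in> C \<Longrightarrow> P z \<bullet> (x - y) = z \<bullet> (x - y)"
    and P_interior: "\<exists>c\<in>C. \<exists>\<rho>>0. \<forall>z. norm (P z) \<le> \<rho> \<longrightarrow> c + P z \<in> C"
begin

definition F :: "'a \<Rightarrow> real" where
  "F x = (\<Sum>i=1..m. f i x) / real m"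

definition dF :: "'a \<Rightarrow> 'a" where
  "dF x = (1 / real m) *\<^sub>R (\<Sum>i=1..m. df i x)"

definition q :: "'a \<Rightarrow> 'a \<Rightarrow> real" where
  "q x y = (\<Sum>i=1..m. (norm (P (df i x - df i y)))\<^sup>2) / real m"

lemma convex_comb:
  assumes "x \<in> C" "y \<in> C" "0 \<le> u" "u \<le> 1"
  shows "x + u *\<^sub>R (y - x) \<in> C"
  using convexD_alt[OF convex_C assms(1,2,3,4)] by (simp add: algebra_simps)

lemma C_nonempty: "C \<noteq> {}"
  using P_interior by auto

lemma D_nonneg: "0 \<le> D"
  using C_nonempty diam by (metis all_not_in_conv norm_ge_zero order_trans)

lemma card_nz: "real m > 0"
  using m_pos by simp

lemma F_tangent:
  assumes "x \<in> C" "y \<in> C"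
  shows "F x + dF x \<bullet> (y - x) \<le> F y"
proof -
  have "(\<Sum>i=1..m. f i x + df i x \<bullet> (y - x)) \<le> (\<Sum>i=1..m. f i y)"
    by (intro sum_mono tangent assms)
  then have "((\<Sum>i=1..m. f i x) + (\<Sum>i=1..m. df i x) \<bullet> (y - x)) / real m \<le> F y"
    unfolding F_def using card_nz by (simp add: sum.distrib inner_sum_left divide_right_mono)
  then show ?thesis
    by (simp add: F_def dF_def add_divide_distrib)
qed

lemma F_smooth:
  assumes "x \<in> C" "y \<in> C"
  shows "F y \<le> F x + dF x \<bullet> (y - x) + L / 2 * (norm (y - x))\<^sup>2"
proof -
  have "(\<Sum>i=1..m. f i y) \<le> (\<Sum>i=1..m. f i x + df i x \<bullet> (y - x) + L / 2 * (norm (y - x))\<^sup>2)"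
    by (intro sum_mono smooth assms)
  also have "\<dots> = (\<Sum>i=1..m. f i x) + (\<Sum>i=1..m. df i x) \<bullet> (y - x) + real m * (L / 2 * (norm (y - x))\<^sup>2)"
    by (simp add: sum.distrib inner_sum_left)
  finally have "F y \<le> ((\<Sum>i=1..m. f i x) + (\<Sum>i=1..m. df i x) \<bullet> (y - x) + real m * (L / 2 * (norm (y - x))\<^sup>2)) / real m"
    unfolding F_def using card_nz by (simp add: divide_right_mono)
  then show ?thesis
    using card_nz by (simp add: F_def dF_def add_divide_distrib)
qed

lemma dF_lip:
  assumes "x \<in> C" "y \<in> C"
  shows "norm (dF x - dF y) \<le> L * norm (x - y)"
proof -
  have "norm (\<Sum>i=1..m. df i x - df i y) \<le> (\<Sum>i=1..m. L * norm (x - y))"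
    by (intro order_trans[OF norm_sum] sum_mono lip assms)
  then have "norm (\<Sum>i=1..m. df i x - df i y) / real m \<le> L * norm (x - y)"
    using card_nz by (simp add: divide_le_eq mult.commute)
  moreover have "dF x - dF y = (1 / real m) *\<^sub>R (\<Sum>i=1..m. df i x - df i y)"
    by (simp add: dF_def sum_subtractf scaleR_diff_right)
  ultimately show ?thesis
    by simp
qed

section \<open>Cocoercivity of the gradients in the directions of the affine hull\<close>

lemma P_inner_self:
  assumes "w \<in> C" "w + P z \<in> C"
  shows "u \<bullet> P z = P u \<bullet> P z"
  using P_diff[OF assms(2,1), of u] by simp

text \<open>The usual argument evaluates \<open>f i\<close> after a gradient step from
  \<open>y\<close>, which may leave \<open>C\<close>. The projected step is no longer than
  \<open>norm (x - y)\<close>, so it stays in the relative ball around \<open>y\<close> as soon as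
  \<open>x\<close> is that close.\<close>

lemma bregman_lower_interior:
  assumes i: "i \<in> {1..m}" and xy: "x \<in> C" "y \<in> C"
    and int: "\<And>z. norm (P z) \<le> \<rho> \<Longrightarrow> y + P z \<in> C" and near: "norm (x - y) \<le> \<rho>"
  shows "(norm (P (df i y - df i x)))\<^sup>2 / (2 * L) \<le> f i y - f i x - df i x \<bullet> (y - x)"
proof -
  define d where "d = df i y - df i x"
  define z where "z = (- 1 / L) *\<^sub>R d"
  have Pz: "P z = (- 1 / L) *\<^sub>R P d"
    using P_linear by (simp add: z_def linear_cmul del: scaleR_minus_left)
  have "norm (P z) \<le> norm z"
    by (rule P_norm)
  also have "norm z = norm d / L"
    using L_pos by (simp add: z_def)
  also have "\<dots> \<le> norm (x - y)"
    using lip[OF i xy(2,1)] L_pos by (simp add: d_def divide_le_eq mult.commute norm_minus_commute)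
  finally have in_C: "y + P z \<in> C"
    using near int by simp
  have "f i x + df i x \<bullet> (y + P z - x) \<le> f i (y + P z)"
    by (intro tangent i xy in_C)
  also have "\<dots> \<le> f i y + df i y \<bullet> (y + P z - y) + L / 2 * (norm (y + P z - y))\<^sup>2"
    by (intro smooth i xy in_C)
  finally have "f i x + df i x \<bullet> (y - x) \<le> f i y + d \<bullet> P z + L / 2 * (norm (P z))\<^sup>2"
    by (simp add: d_def algebra_simps)
  moreover have "d \<bullet> P z = - ((norm (P d))\<^sup>2 / L)"
    using P_inner_self[OF xy(2) in_C, of d] Pz by (simp add: power2_norm_eq_inner)
  moreover have "L / 2 * (norm (P z))\<^sup>2 = (norm (P d))\<^sup>2 / (2 * L)"
    using L_pos by (simp add: Pz power2_eq_square field_simps)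
  moreover have "(norm (P d))\<^sup>2 / L = 2 * ((norm (P d))\<^sup>2 / (2 * L))"
    by simp
  ultimately show ?thesis
    by (simp add: d_def)
qed

lemma cocoercive_near:
  assumes i: "i \<in> {1..m}" and xy: "x \<in> C" "y \<in> C"
    and int: "\<And>z. norm (P z) \<le> \<rho> \<Longrightarrow> x + P z \<in> C" "\<And>z. norm (P z) \<le> \<rho> \<Longrightarrow> y + P z \<in> C"
    and near: "norm (x - y) \<le> \<rho>"
  shows "(norm (P (df i y - df i x)))\<^sup>2 \<le> L * ((df i y - df i x) \<bullet> (y - x))"
proof -
  have "(norm (P (df i y - df i x)))\<^sup>2 / (2 * L) \<le> f i y - f i x - df i x \<bullet> (y - x)"
    by (rule bregman_lower_interior[OF i xy int(2) near])
  moreover have "(norm (P (df i x - df i y)))\<^sup>2 / (2 * L) \<le> f i x - f i y - df i y \<bullet> (x - y)"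
    by (rule bregman_lower_interior[OF i xy(2,1) int(1)]) (use near in \<open>auto simp: norm_minus_commute\<close>)
  moreover have "norm (P (df i x - df i y)) = norm (P (df i y - df i x))"
    using P_linear by (metis linear_diff norm_minus_commute)
  ultimately have "(norm (P (df i y - df i x)))\<^sup>2 / (2 * L) * 2 \<le> (df i y - df i x) \<bullet> (y - x)"
    by (simp add: algebra_simps)
  then show ?thesis
    using L_pos by (simp add: field_simps)
qed

text \<open>Local cocoercivity globalizes along a segment with room around it: over \<open>N\<close>
  pieces shorter than \<open>\<rho>\<close>, Cauchy-Schwarz loses a factor \<open>N\<close>, and the
  displacement of each piece carries a factor 1/N.\<close>

lemma cocoercive_interior:
  assumes i: "i \<in> {1..m}" and xy: "x \<in> C" "y \<in> C" and \<rho>: "0 < \<rho>"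
    and int: "\<And>u z. 0 \<le> u \<Longrightarrow> u \<le> 1 \<Longrightarrow> norm (P z) \<le> \<rho> \<Longrightarrow> x + u *\<^sub>R (y - x) + P z \<in> C"
  shows "(norm (P (df i y - df i x)))\<^sup>2 \<le> L * ((df i y - df i x) \<bullet> (y - x))"
proof -
  obtain N :: nat where N: "N > 0" "norm (y - x) / \<rho> < real N"
    by (metis reals_Archimedean2 norm_ge_zero \<rho> divide_nonneg_pos gr0I not_le of_nat_0)
  define p where "p k = x + (real k / real N) *\<^sub>R (y - x)" for k
  define g where "g k = df i (p (Suc k)) - df i (p k)" for k
  have pC: "p k \<in> C" if "k \<le> N" for k
    unfolding p_def using that N by (intro convex_comb xy) auto
  have diff: "p (Suc k) - p k = (1 / real N) *\<^sub>R (y - x)" for k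
    by (simp add: p_def add_divide_distrib scaleR_left_distrib)
  have step: "(norm (P (g k)))\<^sup>2 \<le> L * (g k \<bullet> ((1 / real N) *\<^sub>R (y - x)))" if "k < N" for k
  proof -
    have "norm (p k - p (Suc k)) = norm (y - x) / N"
      using diff[of k] by (metis norm_minus_commute norm_scaleR abs_of_nonneg divide_nonneg_nonneg
          of_nat_0_le_iff zero_le_one mult.commute times_divide_eq_right mult.right_neutral)
    also have "\<dots> \<le> \<rho>"
      using N \<rho> by (simp add: field_simps)
    finally have "norm (p k - p (Suc k)) \<le> \<rho>" .
    moreover have "p k + P z \<in> C" "p (Suc k) + P z \<in> C" if "norm (P z) \<le> \<rho>" for z
      unfolding p_def using that \<open>k < N\<close> N by (auto intro!: int simp del: of_nat_Suc)
    ultimately have "(norm (P (g k)))\<^sup>2 \<le> L * (g k \<bullet> (p (Suc k) - p k))"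
      unfolding g_def using that pC[of k] pC[of "Suc k"]
      by (intro cocoercive_near[where \<rho> = \<rho>] i) auto
    then show ?thesis by (simp only: diff)
  qed
  have tele: "(\<Sum>k<N. g k) = df i y - df i x"
    using sum_lessThan_telescope[of "\<lambda>k. df i (p k)" N] N by (simp add: g_def p_def)
  have "(norm (P (df i y - df i x)))\<^sup>2 = (norm (\<Sum>k<N. P (g k)))\<^sup>2"
    by (simp add: tele[symmetric] linear_sum[OF P_linear])
  also have "\<dots> \<le> (\<Sum>k<N. 1 / 1) * (\<Sum>k<N. 1 * (norm (P (g k)))\<^sup>2)"
    by (rule norm_sum_weighted_Cauchy_Schwarz) simp
  also have "\<dots> \<le> real N * (\<Sum>k<N. L * (g k \<bullet> ((1 / real N) *\<^sub>R (y - x))))"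
    using step by (auto intro!: mult_left_mono sum_mono)
  also have "\<dots> = L * ((\<Sum>k<N. g k) \<bullet> (y - x))"
    using N by (simp add: sum_distrib_left inner_sum_left)
  finally show ?thesis
    by (simp only: tele)
qed

text \<open>Points of \<open>C\<close> may lie on the relative boundary. Moving both by a fraction
  \<open>\<epsilon> n\<close> towards a relative interior point gives the whole segment room
  \<open>\<epsilon> n * \<rho>\<close>; the inequality passes to the limit because the gradients are
  continuous on \<open>C\<close>.\<close>

lemma cocoercive:
  assumes i: "i \<in> {1..m}" and xy: "x \<in> C" "y \<in> C"
  shows "(norm (P (df i y - df i x)))\<^sup>2 \<le> L * ((df i y - df i x) \<bullet> (y - x))"
proof -
  obtain c \<rho> where c: "c \<in> C" "0 < \<rho>" "\<And>z. norm (P z) \<le> \<rho> \<Longrightarrow> c + P z \<in> C"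
    using P_interior by auto
  define \<epsilon> where "\<epsilon> n = inverse (real (Suc n))" for n
  have \<epsilon>: "0 < \<epsilon> n" "\<epsilon> n \<le> 1" for n
    by (auto simp: \<epsilon>_def field_simps)
  have \<epsilon>0: "\<epsilon> \<longlonglongrightarrow> 0"
    unfolding \<epsilon>_def by (rule LIMSEQ_inverse_real_of_nat)
  define X where "X n = x + \<epsilon> n *\<^sub>R (c - x)" for n
  define Y where "Y n = y + \<epsilon> n *\<^sub>R (c - y)" for n
  have XC: "X n \<in> C" and YC: "Y n \<in> C" for n
    unfolding X_def Y_def using xy c \<epsilon>[of n] by (auto intro!: convex_comb)
  have X: "X \<longlonglongrightarrow> x" and Y: "Y \<longlonglongrightarrow> y"
  proof -
    have "(\<lambda>n. x + \<epsilon> n *\<^sub>R (c - x)) \<longlonglongrightarrow> x + 0 *\<^sub>R (c - x)" for x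
      by (intro tendsto_intros \<epsilon>0)
    then show "X \<longlonglongrightarrow> x" "Y \<longlonglongrightarrow> y"
      by (simp_all add: X_def[abs_def] Y_def[abs_def])
  qed
  have lim: "(\<lambda>n. df i (Z n)) \<longlonglongrightarrow> df i z" if "Z \<longlonglongrightarrow> z" "\<And>n. Z n \<in> C" "z \<in> C" for Z z
  proof -
    have "(\<lambda>n. L * norm (Z n - z)) \<longlonglongrightarrow> L * norm (z - z)"
      by (intro tendsto_intros that)
    then have "(\<lambda>n. L * norm (Z n - z)) \<longlonglongrightarrow> 0" by simp
    then have "(\<lambda>n. df i (Z n) - df i z) \<longlonglongrightarrow> 0"
      using lip[OF i that(2,3)] by (intro Lim_null_comparison[OF _ \<open>(\<lambda>n. L * norm (Z n - z)) \<longlonglongrightarrow> 0\<close>]) auto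
    then show ?thesis by (simp add: LIM_zero_iff)
  qed
  have dX: "(\<lambda>n. df i (X n)) \<longlonglongrightarrow> df i x" and dY: "(\<lambda>n. df i (Y n)) \<longlonglongrightarrow> df i y"
    using lim X Y XC YC xy by auto
  have main: "(norm (P (df i (Y n) - df i (X n))))\<^sup>2 \<le> L * ((df i (Y n) - df i (X n)) \<bullet> (Y n - X n))" for n
  proof (rule cocoercive_interior[OF i XC YC, where \<rho> = "\<epsilon> n * \<rho>"])
    show "0 < \<epsilon> n * \<rho>" using \<epsilon> c by simp
    fix u z assume u: "0 \<le> u" "u \<le> (1::real)" and z: "norm (P z) \<le> \<epsilon> n * \<rho>"
    define w where "w = x + u *\<^sub>R (y - x)"
    have w: "w \<in> C" unfolding w_def using xy u by (intro convex_comb)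
    have Pz: "P ((1 / \<epsilon> n) *\<^sub>R z) = (1 / \<epsilon> n) *\<^sub>R P z"
      using P_linear by (rule linear_cmul)
    have "norm (P ((1 / \<epsilon> n) *\<^sub>R z)) \<le> \<rho>"
      using z \<epsilon>[of n] by (simp add: Pz field_simps)
    then have "c + P ((1 / \<epsilon> n) *\<^sub>R z) \<in> C" by (rule c(3))
    then have "w + \<epsilon> n *\<^sub>R (c + P ((1 / \<epsilon> n) *\<^sub>R z) - w) \<in> C"
      using w \<epsilon>[of n] by (intro convex_comb) auto
    also have "w + \<epsilon> n *\<^sub>R (c + P ((1 / \<epsilon> n) *\<^sub>R z) - w) = X n + u *\<^sub>R (Y n - X n) + P z"
      using \<epsilon>[of n] by (simp add: Pz w_def X_def Y_def algebra_simps)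
    finally show "X n + u *\<^sub>R (Y n - X n) + P z \<in> C" .
  qed
  have contP: "(\<lambda>n. P (df i (Y n) - df i (X n))) \<longlonglongrightarrow> P (df i y - df i x)"
  proof -
    have "bounded_linear P"
      using P_linear by (simp add: linear_conv_bounded_linear)
    from bounded_linear.tendsto[OF this tendsto_diff[OF dY dX]] show ?thesis .
  qed
  show ?thesis
  proof (rule LIMSEQ_le)
    show "(\<lambda>n. (norm (P (df i (Y n) - df i (X n))))\<^sup>2) \<longlonglongrightarrow> (norm (P (df i y - df i x)))\<^sup>2"
      by (intro tendsto_intros contP)
    show "(\<lambda>n. L * ((df i (Y n) - df i (X n)) \<bullet> (Y n - X n))) \<longlonglongrightarrow> L * ((df i y - df i x) \<bullet> (y - x))"
      by (intro tendsto_intros dX dY X Y)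
  qed (use main in auto)
qed

end

context smooth_family
begin

section \<open>The mean squared gradient distance\<close>

lemma q_nonneg: "0 \<le> q x y"
  by (simp add: q_def sum_nonneg)

lemma q_commute: "q x y = q y x"
proof -
  have "norm (P (df i x - df i y)) = norm (P (df i y - df i x))" for i
    using P_linear by (metis linear_diff norm_minus_commute)
  then show ?thesis by (simp add: q_def)
qed

lemma q_le_inner:
  assumes "x \<in> C" "y \<in> C"
  shows "q x y \<le> L * ((dF x - dF y) \<bullet> (x - y))"
proof -
  have "(\<Sum>i=1..m. (norm (P (df i x - df i y)))\<^sup>2) \<le> (\<Sum>i=1..m. L * ((df i x - df i y) \<bullet> (x - y)))"
    by (intro sum_mono cocoercive assms)
  then have "q x y \<le> (\<Sum>i=1..m. L * ((df i x - df i y) \<bullet> (x - y))) / real m"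
    unfolding q_def using card_nz by (simp add: divide_right_mono)
  also have "\<dots> = L * ((dF x - dF y) \<bullet> (x - y))"
    by (simp add: dF_def inner_diff_left inner_sum_left sum_subtractf sum_distrib_left
        right_diff_distrib diff_divide_distrib sum_divide_distrib)
  finally show ?thesis .
qed

lemma q_le_dist:
  assumes "x \<in> C" "y \<in> C"
  shows "q x y \<le> L\<^sup>2 * (norm (x - y))\<^sup>2"
proof -
  have "(norm (P (df i x - df i y)))\<^sup>2 \<le> (L * norm (x - y))\<^sup>2" if "i \<in> {1..m}" for i
    using lip[OF that assms] P_norm[of "df i x - df i y"] by (intro power_mono) auto
  then have "(\<Sum>i=1..m. (norm (P (df i x - df i y)))\<^sup>2) \<le> (\<Sum>i=1..m. (L * norm (x - y))\<^sup>2)"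
    by (intro sum_mono)
  then show ?thesis
    unfolding q_def using card_nz by (simp add: divide_le_eq power_mult_distrib mult.commute)
qed

text \<open>With geometrically growing weights the first factor stays bounded however many pieces
  there are; equal weights would cost the number of pieces.\<close>

lemma q_chain:
  assumes w: "\<And>k. k < n \<Longrightarrow> 0 < w k"
  shows "q (z 0) (z n) \<le> (\<Sum>k<n. 1 / w k) * (\<Sum>k<n. w k * q (z k) (z (Suc k)))"
proof -
  have "(norm (P (df i (z 0) - df i (z n))))\<^sup>2 \<le>
      (\<Sum>k<n. 1 / w k) * (\<Sum>k<n. w k * (norm (P (df i (z k) - df i (z (Suc k)))))\<^sup>2)" for i
  proof -
    have "df i (z 0) - df i (z n) = (\<Sum>k<n. df i (z k) - df i (z (Suc k)))"
      by (rule sum_lessThan_telescope'[of "\<lambda>k. df i (z k)" n, symmetric])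
    then have "P (df i (z 0) - df i (z n)) = (\<Sum>k<n. P (df i (z k) - df i (z (Suc k))))"
      by (simp add: linear_sum[OF P_linear])
    then show ?thesis
      using norm_sum_weighted_Cauchy_Schwarz[of "{..<n}" w "\<lambda>k. P (df i (z k) - df i (z (Suc k)))"] w
      by simp
  qed
  then have "q (z 0) (z n) \<le> (\<Sum>i=1..m. (\<Sum>k<n. 1 / w k) *
      (\<Sum>k<n. w k * (norm (P (df i (z k) - df i (z (Suc k)))))\<^sup>2)) / real m"
    unfolding q_def using card_nz by (intro divide_right_mono sum_mono) auto
  also have "\<dots> = (\<Sum>k<n. 1 / w k) *
      (\<Sum>k<n. w k * ((\<Sum>i=1..m. (norm (P (df i (z k) - df i (z (Suc k)))))\<^sup>2) / real m))"
    unfolding sum_distrib_left[symmetric] sum_divide_distrib[symmetric]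
    by (subst sum.swap) (simp add: sum_distrib_left sum_divide_distrib)
  finally show ?thesis by (simp add: q_def)
qed

lemma q_Young:
  assumes "0 < \<theta>"
  shows "q x z \<le> (1 + \<theta>) * q x y + (1 + 1 / \<theta>) * q y z"
proof -
  have *: "(norm (P (df i x - df i z)))\<^sup>2 \<le>
      (1 + \<theta>) * (norm (P (df i x - df i y)))\<^sup>2 + (1 + 1 / \<theta>) * (norm (P (df i y - df i z)))\<^sup>2" for i
  proof -
    let ?a = "norm (P (df i x - df i y))" and ?b = "norm (P (df i y - df i z))"
    have "P (df i x - df i z) = P (df i x - df i y) + P (df i y - df i z)"
      by (simp add: linear_diff[OF P_linear])
    then have "norm (P (df i x - df i z)) \<le> ?a + ?b"
      by (simp add: norm_triangle_ineq)
    then have "(norm (P (df i x - df i z)))\<^sup>2 \<le> (?a + ?b)\<^sup>2"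
      by (intro power_mono) auto
    also have "\<dots> \<le> (1 + \<theta>) * ?a\<^sup>2 + (1 + 1 / \<theta>) * ?b\<^sup>2"
    proof -
      have "0 \<le> (\<theta> * ?a - ?b)\<^sup>2 / \<theta>"
        using assms by simp
      also have "\<dots> = \<theta> * ?a\<^sup>2 - 2 * ?a * ?b + ?b\<^sup>2 / \<theta>"
        using assms by (simp add: power2_eq_square field_simps)
      finally show ?thesis
        by (simp add: power2_eq_square algebra_simps)
    qed
    finally show ?thesis .
  qed
  have "q x z \<le> (\<Sum>i=1..m. (1 + \<theta>) * (norm (P (df i x - df i y)))\<^sup>2 + (1 + 1 / \<theta>) * (norm (P (df i y - df i z)))\<^sup>2) / real m"
    unfolding q_def using card_nz * by (intro divide_right_mono sum_mono) auto
  then show ?thesis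
    by (simp add: q_def sum.distrib sum_distrib_left[symmetric] add_divide_distrib)
qed

section \<open>The Frank-Wolfe gap and first-order optimality\<close>

definition gap :: "'a \<Rightarrow> real" where
  "gap x = (SUP v\<in>C. dF x \<bullet> (x - v))"

lemma gap_attained:
  obtains v where "v \<in> C" "gap x = dF x \<bullet> (x - v)" "\<And>u. u \<in> C \<Longrightarrow> dF x \<bullet> (x - u) \<le> gap x"
proof -
  have "continuous_on C (\<lambda>v. dF x \<bullet> (x - v))"
    by (intro continuous_intros)
  from continuous_attains_sup[OF compact_C C_nonempty this]
  obtain v where v: "v \<in> C" "\<And>u. u \<in> C \<Longrightarrow> dF x \<bullet> (x - u) \<le> dF x \<bullet> (x - v)" by auto
  have "gap x = dF x \<bullet> (x - v)"
    unfolding gap_def by (rule cSup_eq_maximum) (use v in auto)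
  with v show ?thesis by (intro that) auto
qed

lemma gap_upper: "v \<in> C \<Longrightarrow> dF x \<bullet> (x - v) \<le> gap x"
  by (metis gap_attained)

lemma gap_nonneg: "x \<in> C \<Longrightarrow> 0 \<le> gap x"
  using gap_upper[of x x] by simp

lemma continuous_on_dF: "continuous_on C dF"
proof -
  have "L-lipschitz_on C dF"
    using L_pos dF_lip by (auto simp: lipschitz_on_def dist_norm)
  then show ?thesis by (rule lipschitz_on_continuous_on)
qed

lemma dF_bounded: obtains B where "0 \<le> B" "\<And>x. x \<in> C \<Longrightarrow> norm (dF x) \<le> B"
proof -
  obtain c where c: "c \<in> C" using C_nonempty by auto
  have "norm (dF x) \<le> norm (dF c) + L * D" if "x \<in> C" for x
  proof -
    have "norm (dF x) \<le> norm (dF c) + norm (dF x - dF c)"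
      by (metis add.commute diff_add_cancel norm_triangle_ineq)
    also have "norm (dF x - dF c) \<le> L * D"
      using dF_lip[OF that c] diam[OF that c] L_pos by (meson mult_left_mono less_imp_le order_trans)
    finally show ?thesis by simp
  qed
  moreover have "0 \<le> norm (dF c) + L * D"
    using L_pos D_nonneg by simp
  ultimately show ?thesis by (rule that[rotated])
qed

lemma gap_lipschitz: obtains B where "0 \<le> B" "\<And>x y. x \<in> C \<Longrightarrow> y \<in> C \<Longrightarrow> \<bar>gap x - gap y\<bar> \<le> B * norm (x - y)"
proof -
  obtain B where B: "0 \<le> B" "\<And>x. x \<in> C \<Longrightarrow> norm (dF x) \<le> B"
    using dF_bounded by blast
  have *: "gap x - gap y \<le> (L * D + B) * norm (x - y)" if xy: "x \<in> C" "y \<in> C" for x y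
  proof -
    obtain v where v: "v \<in> C" "gap x = dF x \<bullet> (x - v)"
      using gap_attained by metis
    have "gap x - gap y \<le> dF x \<bullet> (x - v) - dF y \<bullet> (y - v)"
      using gap_upper[OF v(1), of y] v(2) by simp
    also have "\<dots> = (dF x - dF y) \<bullet> (x - v) + dF y \<bullet> (x - y)"
      by (simp add: algebra_simps)
    also have "\<dots> \<le> norm (dF x - dF y) * norm (x - v) + norm (dF y) * norm (x - y)"
      by (intro add_mono norm_cauchy_schwarz)
    also have "\<dots> \<le> (L * norm (x - y)) * D + B * norm (x - y)"
      using xy v L_pos by (intro add_mono mult_mono dF_lip diam B mult_right_mono) auto
    finally show ?thesis by (simp add: algebra_simps)
  qed
  show ?thesis
  proof (rule that)
    show "0 \<le> L * D + B" using L_pos D_nonneg B by simp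
    show "\<bar>gap x - gap y\<bar> \<le> (L * D + B) * norm (x - y)" if "x \<in> C" "y \<in> C" for x y
      using *[OF that] *[OF that(2,1)] by (simp add: norm_minus_commute abs_le_iff)
  qed
qed

lemma continuous_on_gap: "continuous_on C gap"
proof -
  obtain B where B: "0 \<le> B" "\<And>x y. x \<in> C \<Longrightarrow> y \<in> C \<Longrightarrow> \<bar>gap x - gap y\<bar> \<le> B * norm (x - y)"
    using gap_lipschitz by blast
  then have "B-lipschitz_on C gap"
    by (auto simp: lipschitz_on_def dist_norm)
  then show ?thesis by (rule lipschitz_on_continuous_on)
qed

lemma optimality:
  assumes "xo \<in> C" "\<And>x. x \<in> C \<Longrightarrow> F xo \<le> F x" "x \<in> C"
  shows "0 \<le> dF xo \<bullet> (x - xo)"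
proof (rule ccontr)
  assume neg: "\<not> 0 \<le> dF xo \<bullet> (x - xo)"
  define a where "a = - (dF xo \<bullet> (x - xo))"
  define b where "b = L / 2 * (norm (x - xo))\<^sup>2"
  have a: "a > 0" using neg by (simp add: a_def)
  have b: "b \<ge> 0" using L_pos by (simp add: b_def)
  \<comment> \<open>A step of relative length \<open>u\<close> changes \<open>F\<close> by at most
    u^2 b - u a, so u b < a contradicts minimality. The summand 1 keeps the denominator positive
    when \<open>b\<close> is 0.\<close>
  define u where "u = min 1 (a / (2 * (b + 1)))"
  have u: "0 < u" "u \<le> 1" "u \<le> a / (2 * (b + 1))"
    using a b by (auto simp: u_def)
  have "F xo \<le> F (xo + u *\<^sub>R (x - xo))"
    using u by (intro assms convex_comb) auto
  also have "\<dots> \<le> F xo + dF xo \<bullet> (xo + u *\<^sub>R (x - xo) - xo) + L / 2 * (norm (xo + u *\<^sub>R (x - xo) - xo))\<^sup>2"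
    using u by (intro F_smooth assms convex_comb) auto
  also have "\<dots> = F xo - u * a + u\<^sup>2 * b"
    by (simp add: a_def b_def power_mult_distrib)
  finally have "u * a \<le> u * (u * b)"
    by (simp add: power2_eq_square algebra_simps)
  then have "a \<le> u * b" using u by simp
  also have "\<dots> \<le> a / (2 * (b + 1)) * b" using u b by (intro mult_right_mono)
  also have "\<dots> < a"
    using a b mult_nonneg_nonneg[of a b] by (simp add: field_simps add_nonneg_pos)
  finally show False by simp
qed

text \<open>
  Cocoercivity in terms of function values would need smoothness outside \<open>C\<close>. Its substitute: the
  gradient change between \<open>x\<close> and the minimizer is split over a geometric sequence of scales, each
  scale being controlled by the decrease of \<open>F\<close>.
\<close>

definition geo :: "'a \<Rightarrow> 'a \<Rightarrow> nat \<Rightarrow> 'a" where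
  "geo xo x k = x + (2 / 3) ^ k *\<^sub>R (xo - x)"

lemma geo_0: "geo xo x 0 = xo"
  by (simp add: geo_def)

lemma geo_in: "x \<in> C \<Longrightarrow> xo \<in> C \<Longrightarrow> geo xo x k \<in> C"
  unfolding geo_def by (intro convex_comb) (auto intro: power_le_one)

context
  fixes xo x
  assumes xo: "xo \<in> C" "\<And>x. x \<in> C \<Longrightarrow> F xo \<le> F x" and x: "x \<in> C"
begin

private lemma geo_step: "geo xo x (Suc k) - geo xo x k = (1 / 3 * (2 / 3) ^ k) *\<^sub>R (x - xo)"
proof -
  have "geo xo x (Suc k) - geo xo x k = ((2 / 3) ^ Suc k - (2 / 3) ^ k) *\<^sub>R (xo - x)"
    by (simp only: geo_def scaleR_left_diff_distrib) simp
  also have "(2 / 3 :: real) ^ Suc k - (2 / 3) ^ k = - (1 / 3 * (2 / 3) ^ k)"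
    by simp
  also have "\<dots> *\<^sub>R (xo - x) = (1 / 3 * (2 / 3) ^ k) *\<^sub>R (x - xo)"
    by (metis minus_diff_eq scaleR_minus_left scaleR_minus_right)
  finally show ?thesis .
qed

text \<open>The direction is the full difference \<open>x - xo\<close> at every scale, so that these
  directional derivatives are comparable and increase with \<open>k\<close> by cocoercivity.\<close>

private definition "slope k = dF (geo xo x k) \<bullet> (x - xo)"

private lemma q_scale_slope:
  "q (geo xo x k) (geo xo x (Suc k)) \<le> L * (1 / 3 * (2 / 3) ^ k * (slope (Suc k) - slope k))"
proof -
  have "q (geo xo x (Suc k)) (geo xo x k) \<le>
      L * ((dF (geo xo x (Suc k)) - dF (geo xo x k)) \<bullet> (geo xo x (Suc k) - geo xo x k))"
    by (intro q_le_inner geo_in x xo)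
  then show ?thesis
    unfolding geo_step by (simp add: slope_def inner_diff_left q_commute)
qed

private lemma slope_mono: "slope k \<le> slope (Suc k)"
proof -
  have "0 \<le> (L * (1 / 3 * (2 / 3) ^ k)) * (slope (Suc k) - slope k)"
    using order_trans[OF q_nonneg q_scale_slope] by (simp add: mult.assoc)
  moreover have "0 < L * (1 / 3 * (2 / 3) ^ k)" using L_pos by simp
  ultimately show ?thesis
    using zero_le_mult_iff[of "L * (1 / 3 * (2 / 3) ^ k)" "slope (Suc k) - slope k"] by linarith
qed

private lemma slope_nonneg: "0 \<le> slope k"
proof (induction k)
  case 0
  then show ?case using optimality[OF xo x] by (simp add: slope_def geo_0)
next
  case (Suc k)
  then show ?case using slope_mono[of k] by simp
qed

private lemma slope_F: "(2 / 3) ^ k * slope k \<le> F x - F (geo xo x k)"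
proof -
  have "F (geo xo x k) + dF (geo xo x k) \<bullet> (x - geo xo x k) \<le> F x"
    by (intro F_tangent geo_in x xo)
  moreover have "x - geo xo x k = (2 / 3) ^ k *\<^sub>R (x - xo)"
    by (simp add: geo_def algebra_simps)
  ultimately show ?thesis by (simp add: slope_def)
qed

text \<open>The piece from scale \<open>k\<close> to the next is half as long as what then remains
  up to \<open>x\<close>. Dropping the nonnegative slope at the far end, the tangent inequality over
  that remainder yields the decrease of \<open>F\<close>.\<close>

lemma q_scale_tail: "q (geo xo x k) (geo xo x (Suc k)) \<le> L / 2 * (F x - F (geo xo x (Suc k)))"
proof -
  have "1 / 3 * (2 / 3) ^ k * (slope (Suc k) - slope k) \<le> 1 / 3 * (2 / 3) ^ k * slope (Suc k)"
    using slope_nonneg by (intro mult_left_mono) auto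
  also have "\<dots> = 1 / 2 * ((2 / 3) ^ Suc k * slope (Suc k))" by simp
  also have "\<dots> \<le> 1 / 2 * (F x - F (geo xo x (Suc k)))"
    using slope_F[of "Suc k"] by simp
  finally have "L * (1 / 3 * (2 / 3) ^ k * (slope (Suc k) - slope k)) \<le> L * (1 / 2 * (F x - F (geo xo x (Suc k))))"
    using L_pos by (intro mult_left_mono) auto
  with q_scale_slope[of k] show ?thesis by simp
qed

text \<open>Applying \<open>q_scale_tail\<close> to each scale would cost one primal gap per scale.
  Summation by parts pays for all of them with a single one.\<close>

lemma sum_q_scale: "(\<Sum>k<n. q (geo xo x k) (geo xo x (Suc k))) \<le> L / 2 * (F x - F xo)"
proof -
  \<comment> \<open>The invariant is half the rise of \<open>F\<close> so far plus a boundary term.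
    In the induction step the boundary terms leave a sixth of (2/3)^n \<open>slope n\<close>, which
    is at most half the rise of \<open>F\<close> over the next piece.\<close>
  have "(\<Sum>k<n. 1 / 3 * (2 / 3) ^ k * (slope (Suc k) - slope k))
      \<le> 1 / 2 * (F (geo xo x n) - F xo) + 1 / 2 * ((2 / 3) ^ n * slope n)"
  proof (induction n)
    case 0
    show ?case using slope_nonneg[of 0] by (simp add: geo_0)
  next
    case (Suc n)
    have "F (geo xo x n) + dF (geo xo x n) \<bullet> (geo xo x (Suc n) - geo xo x n) \<le> F (geo xo x (Suc n))"
      by (intro F_tangent geo_in x xo)
    then have "1 / 3 * (2 / 3) ^ n * slope n \<le> F (geo xo x (Suc n)) - F (geo xo x n)"
      unfolding geo_step by (simp add: slope_def)
    with Suc show ?case by (simp add: algebra_simps)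
  qed
  also have "\<dots> \<le> 1 / 2 * (F x - F xo)"
    using slope_F[of n] by argo
  finally have "L * (\<Sum>k<n. 1 / 3 * (2 / 3) ^ k * (slope (Suc k) - slope k)) \<le> L * (1 / 2 * (F x - F xo))"
    using L_pos by (intro mult_left_mono) auto
  moreover have "(\<Sum>k<n. q (geo xo x k) (geo xo x (Suc k)))
      \<le> (\<Sum>k<n. L * (1 / 3 * (2 / 3) ^ k * (slope (Suc k) - slope k)))"
    by (intro sum_mono q_scale_slope)
  ultimately show ?thesis by (simp add: sum_distrib_left)
qed

lemma q_scale_head: "q xo (geo xo x n) \<le> real n * (L / 2 * (F x - F xo))"
proof -
  have "q (geo xo x 0) (geo xo x n) \<le> (\<Sum>k<n. 1 / 1) * (\<Sum>k<n. 1 * q (geo xo x k) (geo xo x (Suc k)))"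
    by (rule q_chain) simp
  also have "\<dots> \<le> real n * (L / 2 * (F x - F xo))"
    using mult_left_mono[OF sum_q_scale[of n], of "real n"] by simp
  finally show ?thesis by (simp add: geo_0)
qed

lemma q_scale_end: "q (geo xo x n) x \<le> L\<^sup>2 * D\<^sup>2 * (4 / 9) ^ n"
proof -
  have "q (geo xo x n) x \<le> L\<^sup>2 * (norm (geo xo x n - x))\<^sup>2"
    by (intro q_le_dist geo_in x xo)
  also have "\<dots> \<le> L\<^sup>2 * ((2 / 3) ^ n * D)\<^sup>2"
    using diam[OF xo(1) x] by (intro mult_left_mono power_mono) (auto simp: geo_def)
  also have "((2 / 3) ^ n * D)\<^sup>2 = D\<^sup>2 * (4 / 9) ^ n"
    by (simp add: power_mult_distrib power2_eq_square flip: power_mult_distrib)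
  finally show ?thesis by simp
qed

lemma q_scale_mid:
  assumes w: "\<And>i. i < N \<Longrightarrow> 0 < w i"
  shows "q (geo xo x n) (geo xo x (n + N)) \<le>
    (\<Sum>i<N. 1 / w i) * (\<Sum>i<N. w i * (L / 2 * (F x - F (geo xo x (n + Suc i)))))"
proof -
  have "q (geo xo x (n + 0)) (geo xo x (n + N)) \<le>
    (\<Sum>i<N. 1 / w i) * (\<Sum>i<N. w i * q (geo xo x (n + i)) (geo xo x (n + Suc i)))"
    by (rule q_chain[where z="\<lambda>i. geo xo x (n + i)"]) (rule w)
  also have "\<dots> \<le> (\<Sum>i<N. 1 / w i) * (\<Sum>i<N. w i * (L / 2 * (F x - F (geo xo x (n + Suc i)))))"
  proof (intro mult_left_mono sum_mono sum_nonneg)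
    show "q (geo xo x (n + i)) (geo xo x (n + Suc i)) \<le> L / 2 * (F x - F (geo xo x (n + Suc i)))" for i
      using q_scale_tail[of "n + i"] by simp
  qed (use w in \<open>auto simp: less_imp_le\<close>)
  finally show ?thesis by simp
qed

end

end

section \<open>One outer iteration\<close>

context smooth_family
begin

section \<open>Merging consecutive Frank-Wolfe steps\<close>

lemma combine:
  assumes "c \<in> C" "v \<in> C" "0 \<le> w" "w \<le> 1" "0 \<le> u" "u \<le> 1"
  shows "\<exists>w' c'. 0 \<le> w' \<and> w' \<le> 1 \<and> w' \<le> w + u \<and> c' \<in> C \<and>
    (x + w *\<^sub>R (c - x)) + u *\<^sub>R (v - (x + w *\<^sub>R (c - x))) = x + w' *\<^sub>R (c' - x)"
proof -
  \<comment> \<open>Chosen so that 1 - w' = (1 - w)(1 - u).\<close>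
  define w' where "w' = (1 - u) * w + u"
  have "0 \<le> (1 - u) * (1 - w)" "0 \<le> u * w" using assms by auto
  then have w': "w' \<le> 1" "w' \<le> w + u" by (auto simp: w'_def algebra_simps)
  have w'0: "0 \<le> w'" using assms by (simp add: w'_def)
  have y: "(x + w *\<^sub>R (c - x)) + u *\<^sub>R (v - (x + w *\<^sub>R (c - x))) = x + (((1 - u) * w) *\<^sub>R (c - x) + u *\<^sub>R (v - x))"
    by (simp add: algebra_simps)
  show ?thesis
  proof (cases "w' = 0")
    case True
    then have "(1 - u) * w = 0" "u = 0"
      using assms mult_nonneg_nonneg[of "1 - u" w] by (auto simp: w'_def add_nonneg_eq_0_iff)
    then show ?thesis unfolding y using assms by (intro exI[of _ 0] exI[of _ c]) auto
  next
    case False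
    with w'0 have pos: "w' > 0" by simp
    define c' where "c' = c + (u / w') *\<^sub>R (v - c)"
    have "c' \<in> C"
      unfolding c'_def using assms pos by (intro convex_comb) (auto simp: w'_def)
    moreover have "w' *\<^sub>R (c' - x) = ((1 - u) * w) *\<^sub>R (c - x) + u *\<^sub>R (v - x)"
    proof -
      have "w' *\<^sub>R (c' - x) = w' *\<^sub>R (c - x) + u *\<^sub>R (v - c)"
        using pos by (simp add: c'_def algebra_simps)
      then show ?thesis by (simp add: w'_def algebra_simps)
    qed
    ultimately show ?thesis unfolding y using w'0 w' by (intro exI[of _ w'] exI[of _ c']) auto
  qed
qed

text \<open>A block of steps towards varying vertices becomes one step towards a single point of
  \<open>C\<close>. It can then be tested against the linear minimization at the start of the block,
  with a length bounded by the sum of the step bounds.\<close>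

lemma combination_of_steps:
  assumes "i \<le> s" "X i \<in> C"
    and "\<And>n. i \<le> n \<Longrightarrow> n < s \<Longrightarrow>
      \<exists>u v. 0 \<le> u \<and> u \<le> 1 \<and> u \<le> B n \<and> v \<in> C \<and> X (Suc n) = X n + u *\<^sub>R (v - X n)"
  shows "\<exists>w c. 0 \<le> w \<and> w \<le> 1 \<and> w \<le> (\<Sum>n=i..<s. B n) \<and> c \<in> C \<and> X s = X i + w *\<^sub>R (c - X i)"
  using assms
proof (induction s rule: dec_induct)
  case base
  then show ?case by (intro exI[of _ 0] exI[of _ "X i"]) auto
next
  case (step n)
  then obtain w c where w: "0 \<le> w" "w \<le> 1" "w \<le> (\<Sum>n=i..<n. B n)" "c \<in> C" "X n = X i + w *\<^sub>R (c - X i)"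
    by auto
  obtain u v where u: "0 \<le> u" "u \<le> 1" "u \<le> B n" "v \<in> C" "X (Suc n) = X n + u *\<^sub>R (v - X n)"
    using step.prems(2)[of n] step.hyps by auto
  obtain w' c' where w': "0 \<le> w'" "w' \<le> 1" "w' \<le> w + u" "c' \<in> C"
    "(X i + w *\<^sub>R (c - X i)) + u *\<^sub>R (v - (X i + w *\<^sub>R (c - X i))) = X i + w' *\<^sub>R (c' - X i)"
    using combine[OF w(4) u(4) w(1,2) u(1,2)] by blast
  have "w' \<le> (\<Sum>n=i..<Suc n. B n)"
    using w'(3) w(3) u(3) step.hyps by (simp add: sum.atLeastLessThan_Suc)
  then show ?case using w' u(5) w(5) by (intro exI[of _ w'] exI[of _ c']) simp
qed

end

text \<open>\<open>T\<close> stands for the scaling matrix divided by the learning rate, which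
  removes the learning rate from the step size rule. Its spectrum lies between L and \<kappa>L; the
  lower bound makes the quadratic model majorize the smoothness bound of \<open>F\<close>.\<close>

locale outer_step = smooth_family C m f df L D P
  for C :: "'a::euclidean_space set" and m f df L D P +
  fixes x g :: 'a and T :: "'a \<Rightarrow> 'a" and \<kappa> \<gamma> :: real and K :: nat and y v :: "nat \<Rightarrow> 'a"
  assumes x_in: "x \<in> C"
    and T_linear: "linear T" and T_sym: "u \<bullet> T w = T u \<bullet> w"
    and T_lower: "L * (norm w)\<^sup>2 \<le> w \<bullet> T w" and T_norm: "norm (T w) \<le> \<kappa> * L * norm w"
    and \<gamma>_pos: "0 < \<gamma>" and \<gamma>_le: "\<gamma> \<le> 1" and K_pos: "1 \<le> K" and \<kappa>_ge: "1 \<le> \<kappa>"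
    and y_0: "y 0 = x"
    and v_in: "k < K \<Longrightarrow> v k \<in> C"
    and v_min: "k < K \<Longrightarrow> u \<in> C \<Longrightarrow> (g + T (y k - x)) \<bullet> v k \<le> (g + T (y k - x)) \<bullet> u"
    and y_step: "k < K \<Longrightarrow> y (Suc k) = y k +
      min (((g + T (y k - x)) \<bullet> (y k - v k)) / ((v k - y k) \<bullet> T (v k - y k))) \<gamma> *\<^sub>R (v k - y k)"
begin

section \<open>Inner steps on the quadratic model\<close>

definition "dQ k = g + T (y k - x)"
definition "G k = dQ k \<bullet> (y k - v k)"
definition "N k = (v k - y k) \<bullet> T (v k - y k)"
definition "\<delta> k = min (G k / N k) \<gamma>"
definition "\<xi> = g - dF x"
definition "\<zeta> = norm (P \<xi>)"
text \<open>The model without its constant \<open>F x\<close>, so that it vanishes at the start;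
  \<open>dQ k\<close> is its gradient at \<open>y k\<close> and \<open>G k\<close> its Frank-Wolfe
  gap.\<close>

definition "Q k = g \<bullet> (y k - x) + (y k - x) \<bullet> T (y k - x) / 2"

lemma step: "k < K \<Longrightarrow> y (Suc k) = y k + \<delta> k *\<^sub>R (v k - y k)"
  using y_step by (simp add: \<delta>_def G_def N_def dQ_def)

lemma \<zeta>_nonneg: "0 \<le> \<zeta>"
  by (simp add: \<zeta>_def)

lemma noise_bound:
  assumes "u \<in> C" "w \<in> C"
  shows "\<bar>\<xi> \<bullet> (u - w)\<bar> \<le> \<zeta> * norm (u - w)"
  using Cauchy_Schwarz_ineq2[of "P \<xi>" "u - w"] P_diff[OF assms, of \<xi>] by (simp add: \<zeta>_def)

lemma noise_bound_D:
  assumes "u \<in> C" "w \<in> C"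
  shows "\<bar>\<xi> \<bullet> (u - w)\<bar> \<le> \<zeta> * D"
  using noise_bound[OF assms] mult_left_mono[OF diam[OF assms] \<zeta>_nonneg] by simp

lemma N_lower: "L * (norm (v k - y k))\<^sup>2 \<le> N k"
  unfolding N_def by (rule T_lower)

lemma N_nonneg: "0 \<le> N k"
  using N_lower[of k] L_pos by (meson less_imp_le mult_nonneg_nonneg order_trans zero_le_power2)

lemma N_zero: "N k = 0 \<Longrightarrow> v k = y k"
  using N_lower[of k] L_pos by (simp add: mult_le_0_iff)

lemma T_inner: "\<bar>T u \<bullet> w\<bar> \<le> \<kappa> * L * norm u * norm w"
  using Cauchy_Schwarz_ineq2[of "T u" w] mult_right_mono[OF T_norm[of u], of "norm w"] by simp

lemma G_max:
  assumes "k < K" "u \<in> C"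
  shows "dQ k \<bullet> (y k - u) \<le> G k"
  using v_min[OF assms] by (simp add: G_def dQ_def inner_diff_right)

lemma G_nonneg: "k < K \<Longrightarrow> y k \<in> C \<Longrightarrow> 0 \<le> G k"
  using G_max[of k "y k"] by simp

lemma \<delta>_nonneg: "k < K \<Longrightarrow> y k \<in> C \<Longrightarrow> 0 \<le> \<delta> k"
  unfolding \<delta>_def using G_nonneg N_nonneg \<gamma>_pos by (simp add: divide_nonneg_nonneg)

lemma \<delta>_le: "\<delta> k \<le> \<gamma>"
  by (simp add: \<delta>_def)

lemma \<delta>_N: "k < K \<Longrightarrow> y k \<in> C \<Longrightarrow> \<delta> k * N k \<le> G k"
proof (cases "N k = 0")
  case False
  then have "\<delta> k * N k \<le> G k / N k * N k"
    using N_nonneg by (intro mult_right_mono) (auto simp: \<delta>_def)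
  with False show ?thesis by simp
qed (simp add: G_nonneg)

text \<open>Below the cap \<open>\<gamma>\<close> the step is an exact line search on the model. If
  \<open>N k = 0\<close>, then \<open>v k = y k\<close> by the lower bound on \<open>T\<close>, and
  both sides vanish.\<close>

lemma \<delta>_short: "\<delta> k < \<gamma> \<Longrightarrow> G k = \<delta> k * N k"
proof (cases "N k = 0")
  case True
  then show ?thesis using N_zero[OF True] by (simp add: G_def)
qed (auto simp: \<delta>_def min_def split: if_splits)

lemma y_in: "k \<le> K \<Longrightarrow> y k \<in> C"
proof (induction k)
  case 0
  then show ?case by (simp add: y_0 x_in)
next
  case (Suc k)
  then have "y k \<in> C" "k < K" by auto
  then show ?case
    unfolding step[OF \<open>k < K\<close>] using \<delta>_nonneg[of k] \<delta>_le[of k] \<gamma>_le v_in[of k] by (intro convex_comb) auto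
qed

lemma \<delta>_ge0: "k < K \<Longrightarrow> 0 \<le> \<delta> k"
  using \<delta>_nonneg y_in by simp

lemma y_move: "k < K \<Longrightarrow> norm (y (Suc k) - y k) \<le> \<delta> k * D"
  using diam[OF v_in y_in, of k k] \<delta>_ge0[of k] by (simp add: step mult_left_mono)

lemma y_dist: "k \<le> K \<Longrightarrow> norm (y k - x) \<le> real k * \<gamma> * D"
proof (induction k)
  case 0
  then show ?case by (simp add: y_0)
next
  case (Suc k)
  have "norm (y (Suc k) - x) \<le> norm (y (Suc k) - y k) + norm (y k - x)"
    by (metis add_diff_eq diff_add_cancel norm_triangle_ineq)
  also have "norm (y (Suc k) - y k) \<le> \<gamma> * D"
    using y_move[of k] \<delta>_le[of k] mult_right_mono[OF \<delta>_le D_nonneg, of k] Suc.prems by simp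
  finally show ?case using Suc by (simp add: algebra_simps)
qed

lemma y_combination:
  assumes "j \<le> K" "k \<le> j"
  shows "\<exists>w c. 0 \<le> w \<and> w \<le> 1 \<and> w \<le> real (j - k) * \<gamma> \<and> c \<in> C \<and> y j = y k + w *\<^sub>R (c - y k)"
proof -
  have "\<exists>w c. 0 \<le> w \<and> w \<le> 1 \<and> w \<le> (\<Sum>n=k..<j. \<gamma>) \<and> c \<in> C \<and> y j = y k + w *\<^sub>R (c - y k)"
  proof (rule combination_of_steps)
    fix n assume "k \<le> n" "n < j"
    then have n: "n < K" using assms by simp
    show "\<exists>u u'. 0 \<le> u \<and> u \<le> 1 \<and> u \<le> \<gamma> \<and> u' \<in> C \<and> y (Suc n) = y n + u *\<^sub>R (u' - y n)"
      using \<delta>_ge0[OF n] \<delta>_le[of n] \<gamma>_le v_in[OF n] step[OF n] by (intro exI[of _ "\<delta> n"] exI[of _ "v n"]) auto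
  qed (use assms y_in in auto)
  then show ?thesis by simp
qed

lemma Q_0: "Q 0 = 0"
  using linear_0[OF T_linear] by (simp add: Q_def y_0)

lemma Q_diff: "Q j = Q k + dQ k \<bullet> (y j - y k) + (y j - y k) \<bullet> T (y j - y k) / 2"
proof -
  define a where "a = y k - x"
  define d where "d = y j - y k"
  have j: "y j - x = a + d" by (simp add: a_def d_def)
  have "d \<bullet> T a = T a \<bullet> d" "a \<bullet> T d = T a \<bullet> d"
    using T_sym[of a d] by (auto simp: inner_commute)
  then have "(a + d) \<bullet> T (a + d) = a \<bullet> T a + 2 * (T a \<bullet> d) + d \<bullet> T d"
    using linear_add[OF T_linear] by (simp add: inner_add_left inner_add_right)
  then show ?thesis
    unfolding Q_def dQ_def j a_def[symmetric] d_def[symmetric]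
    by (simp add: inner_add_left inner_add_right)
qed

lemma Q_step:
  assumes "k < K"
  shows "Q (Suc k) = Q k - \<delta> k * G k + (\<delta> k)\<^sup>2 * N k / 2"
proof -
  have "y (Suc k) - y k = \<delta> k *\<^sub>R (v k - y k)"
    using step[OF assms] by simp
  moreover have "dQ k \<bullet> (v k - y k) = - G k"
    by (simp add: G_def inner_diff_right)
  ultimately show ?thesis
    unfolding Q_diff[of "Suc k" k] using linear_cmul[OF T_linear]
    by (simp add: N_def power2_eq_square)
qed

lemma Q_decrease:
  assumes "k < K"
  shows "Q (Suc k) \<le> Q k - \<delta> k * G k / 2"
proof -
  have "\<delta> k * (\<delta> k * N k) \<le> \<delta> k * G k"
    using \<delta>_N[OF assms y_in] \<delta>_ge0[OF assms] assms by (intro mult_left_mono) auto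
  then show ?thesis
    using Q_step[OF assms] by (simp add: power2_eq_square mult.assoc)
qed

lemma Q_decrease_norm:
  assumes "k < K"
  shows "Q (Suc k) \<le> Q k - L / 2 * (norm (y (Suc k) - y k))\<^sup>2"
proof -
  have "\<delta> k * (\<delta> k * N k) \<le> \<delta> k * G k"
    using \<delta>_N[OF assms y_in] \<delta>_ge0[OF assms] assms by (intro mult_left_mono) auto
  moreover have "(\<delta> k)\<^sup>2 * (L * (norm (v k - y k))\<^sup>2) \<le> (\<delta> k)\<^sup>2 * N k"
    using N_lower by (intro mult_left_mono) auto
  moreover have "(norm (y (Suc k) - y k))\<^sup>2 = (\<delta> k)\<^sup>2 * (norm (v k - y k))\<^sup>2"
    using step[OF assms] by (simp add: power_mult_distrib)
  ultimately show ?thesis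
    using Q_step[OF assms] by (simp add: power2_eq_square mult.assoc mult.left_commute)
qed

lemma Q_antimono: "k \<le> j \<Longrightarrow> j \<le> K \<Longrightarrow> Q j \<le> Q k"
proof (induction j)
  case (Suc j)
  show ?case
  proof (cases "k = Suc j")
    case False
    then have "Q j \<le> Q k" using Suc by simp
    moreover have "0 \<le> \<delta> j * G j"
      using \<delta>_ge0[of j] G_nonneg[of j] y_in[of j] Suc.prems by simp
    ultimately show ?thesis using Q_decrease[of j] Suc.prems by simp
  qed simp
qed simp

lemma F_le_Q:
  assumes "k \<le> K"
  shows "F (y k) \<le> F x + Q k - \<xi> \<bullet> (y k - x)"
proof -
  have "F (y k) \<le> F x + dF x \<bullet> (y k - x) + L / 2 * (norm (y k - x))\<^sup>2"
    by (intro F_smooth x_in y_in assms)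
  moreover have "L / 2 * (norm (y k - x))\<^sup>2 \<le> (y k - x) \<bullet> T (y k - x) / 2"
    using T_lower[of "y k - x"] by linarith
  ultimately show ?thesis
    unfolding Q_def \<xi>_def inner_diff_left[of g "dF x" "y k - x"] by linarith
qed

lemma F_increase:
  assumes "k \<le> K"
  shows "F (y k) \<le> F x + real k * \<gamma> * D * \<zeta>"
proof -
  have "- (\<xi> \<bullet> (y k - x)) \<le> \<zeta> * norm (y k - x)"
    using noise_bound[OF y_in[OF assms] x_in] by simp
  also have "\<dots> \<le> \<zeta> * (real k * \<gamma> * D)"
    using y_dist[OF assms] \<zeta>_nonneg by (intro mult_left_mono)
  finally show ?thesis
    using F_le_Q[OF assms] Q_antimono[of 0 k] assms Q_0 by (simp add: algebra_simps)
qed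

text \<open>The clipped line search does at least as well on the model as the full step
  \<open>\<gamma>\<close>, and the linear minimizer at least as well as \<open>xo\<close>.\<close>

lemma Q_first:
  assumes "xo \<in> C"
  shows "Q 1 \<le> - \<gamma> * (g \<bullet> (x - xo)) + \<gamma>\<^sup>2 * \<kappa> * (L * D\<^sup>2) / 2"
proof -
  have K: "0 < K" using K_pos by simp
  have "- \<delta> 0 * G 0 + (\<delta> 0)\<^sup>2 * N 0 / 2 \<le> - \<gamma> * G 0 + \<gamma>\<^sup>2 * N 0 / 2"
  proof (cases "\<delta> 0 < \<gamma>")
    case True
    have "0 \<le> N 0 * (\<gamma> - \<delta> 0)\<^sup>2 / 2" using N_nonneg by simp
    then show ?thesis using \<delta>_short[OF True] by (simp add: power2_eq_square algebra_simps)
  next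
    case False
    then have "\<delta> 0 = \<gamma>" using \<delta>_le[of 0] by simp
    then show ?thesis by simp
  qed
  moreover have "\<gamma> * (g \<bullet> (x - xo)) \<le> \<gamma> * G 0"
    using G_max[OF K assms] \<gamma>_pos linear_0[OF T_linear] by (simp add: dQ_def y_0)
  moreover have "N 0 \<le> \<kappa> * (L * D\<^sup>2)"
  proof -
    have "N 0 \<le> \<kappa> * L * norm (v 0 - y 0) * norm (v 0 - y 0)"
      using T_inner[of "v 0 - y 0" "v 0 - y 0"] by (simp add: N_def inner_commute)
    also have "\<dots> \<le> \<kappa> * L * D * D"
      using diam[OF v_in y_in, of 0 0] K \<kappa>_ge L_pos D_nonneg by (intro mult_mono) auto
    finally show ?thesis by (simp add: power2_eq_square mult.assoc)
  qed
  then have "\<gamma>\<^sup>2 * N 0 / 2 \<le> \<gamma>\<^sup>2 * \<kappa> * (L * D\<^sup>2) / 2"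
    by (simp add: mult.assoc mult_left_mono)
  ultimately show ?thesis using Q_step[OF K] Q_0 by simp
qed

text \<open>\<open>I\<close> is left open because the noise after the first inner step is bounded in
  two ways. The noise paired with \<open>x - xo\<close> is kept apart since it vanishes in
  expectation.\<close>

lemma main_step:
  assumes "xo \<in> C" and I: "Q K - \<xi> \<bullet> (y K - y 1) \<le> Q 1 + I"
  shows "F (y K) \<le> F x - \<gamma> * (dF x \<bullet> (x - xo)) - \<gamma> * (\<xi> \<bullet> (x - xo)) + \<gamma>\<^sup>2 * \<kappa> * (L * D\<^sup>2) / 2 + \<gamma> * D * \<zeta> + I"
proof -
  have "- (\<xi> \<bullet> (y 1 - x)) \<le> \<zeta> * norm (y 1 - x)"
    using noise_bound[OF y_in[of 1] x_in] K_pos by simp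
  also have "\<dots> \<le> \<zeta> * (\<gamma> * D)"
    using y_dist[of 1] K_pos \<zeta>_nonneg by (intro mult_left_mono) auto
  finally have "- (\<xi> \<bullet> (y 1 - x)) \<le> \<gamma> * D * \<zeta>" by (simp add: algebra_simps)
  moreover have "\<xi> \<bullet> (y K - x) = \<xi> \<bullet> (y K - y 1) + \<xi> \<bullet> (y 1 - x)"
    by (simp add: inner_diff_right)
  moreover have "g \<bullet> (x - xo) = dF x \<bullet> (x - xo) + \<xi> \<bullet> (x - xo)"
    by (simp add: \<xi>_def inner_diff_left)
  then have "\<gamma> * (g \<bullet> (x - xo)) = \<gamma> * (dF x \<bullet> (x - xo)) + \<gamma> * (\<xi> \<bullet> (x - xo))"
    by (simp add: distrib_left)
  ultimately show ?thesis
    using F_le_Q[of K] Q_first[OF assms(1)] I by simp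
qed

text \<open>An inner step of length d gains at most \<zeta>d from the noise but lowers the model by
  L d^2/2; the best trade-off is \<zeta>^2/(2L).\<close>

lemma inner_noise_small:
  "Q K - \<xi> \<bullet> (y K - y 1) \<le> Q 1 + (real K - 1) * (\<zeta>\<^sup>2 / (2 * L))"
proof -
  have "Q j - \<xi> \<bullet> (y j - y 1) \<le> Q 1 + (real j - 1) * (\<zeta>\<^sup>2 / (2 * L))" if "1 \<le> j" "j \<le> K" for j
    using that
  proof (induction j rule: dec_induct)
    case base
    then show ?case by simp
  next
    case (step k)
    let ?d = "norm (y (Suc k) - y k)"
    have "- (\<xi> \<bullet> (y (Suc k) - y k)) \<le> \<zeta> * ?d"
      using noise_bound[OF y_in[of "Suc k"] y_in[of k]] step by simp
    moreover have "0 \<le> (L * ?d - \<zeta>)\<^sup>2 / (2 * L)" using L_pos by simp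
    then have "\<zeta> * ?d - L / 2 * ?d\<^sup>2 \<le> \<zeta>\<^sup>2 / (2 * L)"
      using L_pos by (simp add: power2_eq_square field_simps)
    moreover have "\<xi> \<bullet> (y (Suc k) - y 1) = \<xi> \<bullet> (y k - y 1) + \<xi> \<bullet> (y (Suc k) - y k)"
      by (simp add: inner_diff_right)
    ultimately have "Q (Suc k) - \<xi> \<bullet> (y (Suc k) - y 1) \<le> Q 1 + (real k - 1) * (\<zeta>\<^sup>2 / (2 * L)) + \<zeta>\<^sup>2 / (2 * L)"
      using Q_decrease_norm[of k] step by simp
    also have "\<dots> = Q 1 + (real (Suc k) - 1) * (\<zeta>\<^sup>2 / (2 * L))"
    proof -
      have "(real k - 1) * a + a = (real (Suc k) - 1) * a" for a
        by (simp add: algebra_simps)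
      then show ?thesis by (simp only: add.assoc)
    qed
    finally show ?case .
  qed
  then show ?thesis using K_pos by simp
qed

text \<open>
  Late inner steps can be driven by the noise, but moving far that way forces Frank-Wolfe gaps that
  are large on average, and hence a cubic decrease of the model.
\<close>

lemma model_decrease_cubic:
  "L * norm (y K - y 1) ^ 3 \<le> 12 * (D * (real K * \<gamma>)) * (Q 1 - Q K)"
proof -
  define W where "W = real K * \<gamma>"
  define r where "r k = norm (y K - y k)" for k
  have W: "W > 0" using K_pos \<gamma>_pos by (simp add: W_def)
  \<comment> \<open>The model is not larger at \<open>y K\<close> than at \<open>y k\<close>, so its
    quadratic term over that displacement is paid for by the linear term. As the displacement is one
    merged step of length \<open>w\<close>, the linear term is at most
    \<open>w * G k\<close>.\<close>
  have G_lower: "L * (r k)\<^sup>2 \<le> 2 * W * G k" if k: "k < K" for k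
  proof -
    obtain w c where w: "0 \<le> w" "w \<le> real (K - k) * \<gamma>" "c \<in> C" "y K = y k + w *\<^sub>R (c - y k)"
      using y_combination[of K k] k by auto
    have Gk: "0 \<le> G k" using G_nonneg[OF k y_in] k by simp
    have "L * (r k)\<^sup>2 \<le> (y K - y k) \<bullet> T (y K - y k)"
      unfolding r_def by (rule T_lower)
    also have "\<dots> \<le> - 2 * (dQ k \<bullet> (y K - y k))"
      using Q_diff[of K k] Q_antimono[of k K] k by simp
    also have "\<dots> = 2 * w * (dQ k \<bullet> (y k - c))"
    proof -
      have e: "y K - y k = w *\<^sub>R (c - y k)" using w(4) by simp
      show ?thesis unfolding e by (simp add: inner_diff_right algebra_simps)
    qed
    also have "\<dots> \<le> 2 * w * G k"
      using w G_max[OF k w(3)] by (intro mult_left_mono) auto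
    also have "\<dots> \<le> 2 * W * G k"
    proof -
      have "real (K - k) * \<gamma> \<le> W"
        unfolding W_def using \<gamma>_pos by (intro mult_right_mono) auto
      then show ?thesis using w Gk by (intro mult_right_mono) auto
    qed
    finally show ?thesis .
  qed
  \<comment> \<open>The distance \<open>r\<close> shrinks by at most \<open>\<delta> k * D\<close>,
    so its cube loses at most 3 r^2 \<delta> D, and \<open>G_lower\<close> turns r^2 \<delta> into a
    multiple of the model decrease. The cubes then telescope.\<close>
  have cube: "(r k) ^ 3 - (r (Suc k)) ^ 3 \<le> 12 * (D * W) / L * (Q k - Q (Suc k))" if k: "k < K" for k
  proof -
    define a b where "a = r k" and "b = r (Suc k)"
    have ab: "0 \<le> a" "0 \<le> b" by (auto simp: a_def b_def r_def)
    have "a \<le> b + \<delta> k * D"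
    proof -
      have "a \<le> norm (y K - y (Suc k)) + norm (y (Suc k) - y k)"
        unfolding a_def r_def by (metis add_diff_eq diff_add_cancel norm_triangle_ineq)
      then show ?thesis using y_move[OF k] by (simp add: b_def r_def)
    qed
    have "a ^ 3 - b ^ 3 \<le> 3 * a\<^sup>2 * (a - b)"
    proof -
      have "0 \<le> (a - b)\<^sup>2 * (2 * a + b)" using ab by simp
      also have "\<dots> = 3 * a\<^sup>2 * (a - b) - (a ^ 3 - b ^ 3)"
        by (simp add: power2_eq_square power3_eq_cube algebra_simps)
      finally show ?thesis by simp
    qed
    also have "\<dots> \<le> 3 * a\<^sup>2 * (\<delta> k * D)"
      using \<open>a \<le> b + \<delta> k * D\<close> by (intro mult_left_mono) auto
    also have "\<dots> = 3 * D * \<delta> k * a\<^sup>2" by simp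
    also have "\<dots> \<le> 3 * D * \<delta> k * (2 * W * G k / L)"
      using G_lower[OF k] L_pos \<delta>_ge0[OF k] D_nonneg
      by (intro mult_left_mono) (auto simp: a_def pos_le_divide_eq mult.commute)
    also have "\<dots> = 12 * (D * W) / L * (\<delta> k * G k / 2)" by simp
    also have "\<dots> \<le> 12 * (D * W) / L * (Q k - Q (Suc k))"
      using Q_decrease[OF k] D_nonneg W L_pos by (intro mult_left_mono) auto
    finally show ?thesis by (simp add: a_def b_def)
  qed
  have "(\<Sum>k=1..<K. (r k) ^ 3 - (r (Suc k)) ^ 3) \<le> (\<Sum>k=1..<K. 12 * (D * W) / L * (Q k - Q (Suc k)))"
    by (intro sum_mono cube) simp
  moreover have "(\<Sum>k=1..<K. (r k) ^ 3 - (r (Suc k)) ^ 3) = r 1 ^ 3"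
    using sum_Suc_diff'[OF K_pos, of "\<lambda>k. - (r k ^ 3)"] by (simp add: r_def)
  moreover have "(\<Sum>k=1..<K. Q k - Q (Suc k)) = Q 1 - Q K"
    using sum_Suc_diff'[OF K_pos, of "\<lambda>k. - Q k"] by simp
  ultimately have "r 1 ^ 3 \<le> 12 * (D * W) / L * (Q 1 - Q K)"
    by (simp only: sum_distrib_left[symmetric])
  then have "L * r 1 ^ 3 \<le> L * (12 * (D * W) / L * (Q 1 - Q K))"
    using L_pos by (intro mult_left_mono) auto
  then show ?thesis using L_pos by (simp add: r_def W_def)
qed

lemma inner_noise_large:
  assumes \<nu>: "0 < \<nu>"
  shows "Q K - \<xi> \<bullet> (y K - y 1) \<le> Q 1 + (\<nu> * (\<zeta>\<^sup>2 / L) + (real K)\<^sup>2 * \<gamma>\<^sup>2 * (L * D\<^sup>2) / (3 * \<nu> ^ 3))"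
proof -
  define X where "X = D * (real K * \<gamma>)"
  define s where "s = norm (y K - y 1)"
  have X0: "0 \<le> X" and s0: "0 \<le> s" using D_nonneg \<gamma>_pos by (auto simp: X_def s_def)
  have noise: "- (\<xi> \<bullet> (y K - y 1)) \<le> \<zeta> * s"
    using noise_bound[OF y_in[of K] y_in[of 1]] K_pos by (simp add: s_def)
  have cubic: "L * s ^ 3 \<le> 12 * X * (Q 1 - Q K)"
    using model_decrease_cubic by (simp add: X_def s_def)
  have young: "\<zeta> * s \<le> \<nu> * (\<zeta>\<^sup>2 / L) + L * s\<^sup>2 / (4 * \<nu>)"
  proof -
    have "0 \<le> (2 * \<nu> * \<zeta> - L * s)\<^sup>2 / (4 * \<nu> * L)" using L_pos \<nu> by simp
    also have "\<dots> = \<nu> * (\<zeta>\<^sup>2 / L) + L * s\<^sup>2 / (4 * \<nu>) - \<zeta> * s"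
      using L_pos \<nu> by (simp add: power2_eq_square field_simps)
    finally show ?thesis by simp
  qed
  have "L * s\<^sup>2 / (4 * \<nu>) - (Q 1 - Q K) \<le> L * X\<^sup>2 / (3 * \<nu> ^ 3)"
  proof (cases "X = 0")
    case True
    then have "s ^ 3 \<le> 0" using cubic L_pos by (simp add: mult_le_0_iff)
    then have "s = 0" using s0 by (metis antisym zero_le_power power_eq_0_iff)
    then show ?thesis using True Q_antimono[of 1 K] K_pos by simp
  next
    case False
    with X0 have X: "X > 0" by simp
    have "L * s ^ 3 / (12 * X) \<le> Q 1 - Q K"
      using cubic X by (simp add: divide_le_eq mult.commute)
    \<comment> \<open>The cubic in \<open>s\<close> has its double root at s = 2X/\<nu>, the length
      at which the noise left by Young's inequality most exceeds the guaranteed model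
      decrease.\<close>
    moreover have "0 \<le> L * ((2 * X - \<nu> * s)\<^sup>2 * (X + \<nu> * s)) / (12 * X * \<nu> ^ 3)"
      using L_pos X \<nu> s0 by simp
    moreover have "L * ((2 * X - \<nu> * s)\<^sup>2 * (X + \<nu> * s)) / (12 * X * \<nu> ^ 3)
        = L * X\<^sup>2 / (3 * \<nu> ^ 3) - L * s\<^sup>2 / (4 * \<nu>) + L * s ^ 3 / (12 * X)"
      using X \<nu> by (simp add: power2_eq_square power3_eq_cube field_simps)
    ultimately show ?thesis by linarith
  qed
  moreover have "L * X\<^sup>2 / (3 * \<nu> ^ 3) = (real K)\<^sup>2 * \<gamma>\<^sup>2 * (L * D\<^sup>2) / (3 * \<nu> ^ 3)"
    by (simp add: X_def power_mult_distrib)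
  ultimately show ?thesis using noise young by simp
qed

section \<open>Model gaps of the inner iterates against the true Frank-Wolfe gap\<close>

lemma y_dist_inner:
  assumes "k < K"
  shows "norm (y k - x) \<le> (real K - 1) * \<gamma> * D"
proof -
  have "real k * \<gamma> * D \<le> (real K - 1) * \<gamma> * D"
    using assms \<gamma>_pos D_nonneg by (intro mult_right_mono) auto
  then show ?thesis using y_dist[of k] assms by simp
qed

lemma scaling_error:
  assumes "k < K" "w \<in> C"
  shows "\<bar>T (y k - x) \<bullet> (y k - w)\<bar> \<le> \<kappa> * ((real K - 1) * \<gamma> * (L * D\<^sup>2))"
proof -
  have "\<bar>T (y k - x) \<bullet> (y k - w)\<bar> \<le> \<kappa> * L * norm (y k - x) * norm (y k - w)"
    by (rule T_inner)
  also have "\<dots> \<le> \<kappa> * L * ((real K - 1) * \<gamma> * D) * D"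
    using assms \<kappa>_ge L_pos K_pos \<gamma>_pos D_nonneg
    by (intro mult_mono y_dist_inner diam y_in) auto
  finally show ?thesis by (simp add: power2_eq_square algebra_simps)
qed

text \<open>The vertex that attains the gap at \<open>x\<close> is tested in the model at
  \<open>y k\<close>. Three terms are lost: the noise, the displacement seen through
  \<open>T\<close>, and \<open>dF x\<close> along \<open>y k - x\<close>, which smoothness replaces
  by a difference of \<open>F\<close>.\<close>

lemma G_ge_gap:
  assumes k: "k < K"
  shows "gap x - D * \<zeta> - (\<kappa> + 1 / 2) * ((real K - 1) * \<gamma> * (L * D\<^sup>2)) - (F x - F (y k)) \<le> G k"
proof -
  have yk: "y k \<in> C" using y_in k by simp
  obtain w where w: "w \<in> C" "gap x = dF x \<bullet> (x - w)" using gap_attained by metis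
  have "dQ k \<bullet> (y k - w) = dF x \<bullet> (x - w) + dF x \<bullet> (y k - x) + \<xi> \<bullet> (y k - w) + T (y k - x) \<bullet> (y k - w)"
    by (simp add: dQ_def \<xi>_def algebra_simps)
  moreover have "- (\<zeta> * D) \<le> \<xi> \<bullet> (y k - w)"
    using noise_bound_D[OF yk w(1)] by linarith
  moreover have "- (\<kappa> * ((real K - 1) * \<gamma> * (L * D\<^sup>2))) \<le> T (y k - x) \<bullet> (y k - w)"
    using scaling_error[OF k w(1)] by linarith
  moreover have "F (y k) - F x - 1 / 2 * ((real K - 1) * \<gamma> * (L * D\<^sup>2)) \<le> dF x \<bullet> (y k - x)"
  proof -
    have "L / 2 * (norm (y k - x))\<^sup>2 \<le> L / 2 * (((real K - 1) * \<gamma> * D) * D)"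
      unfolding power2_eq_square using L_pos K_pos \<gamma>_pos D_nonneg
      by (intro mult_left_mono mult_mono y_dist_inner[OF k] diam[OF yk x_in]) auto
    then have "L / 2 * (norm (y k - x))\<^sup>2 \<le> 1 / 2 * ((real K - 1) * \<gamma> * (L * D\<^sup>2))"
      by (simp add: power2_eq_square algebra_simps)
    with F_smooth[OF x_in yk] show ?thesis by linarith
  qed
  moreover note G_max[OF k w(1)]
  ultimately show ?thesis using w(2) by (simp add: algebra_simps)
qed

lemma G_le_true:
  assumes k: "k < K"
  shows "G k - D * \<zeta> - (\<kappa> + 1) * ((real K - 1) * \<gamma> * (L * D\<^sup>2)) \<le> dF (y k) \<bullet> (y k - v k)"
proof -
  have yk: "y k \<in> C" "v k \<in> C" using y_in v_in k by auto
  have "G k = dF (y k) \<bullet> (y k - v k) + \<xi> \<bullet> (y k - v k) + T (y k - x) \<bullet> (y k - v k) - (dF (y k) - dF x) \<bullet> (y k - v k)"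
    by (simp add: G_def dQ_def \<xi>_def algebra_simps)
  moreover have "\<xi> \<bullet> (y k - v k) \<le> \<zeta> * D"
    using noise_bound_D[OF yk] by linarith
  moreover have "T (y k - x) \<bullet> (y k - v k) \<le> \<kappa> * ((real K - 1) * \<gamma> * (L * D\<^sup>2))"
    using scaling_error[OF k yk(2)] by linarith
  moreover have "- ((dF (y k) - dF x) \<bullet> (y k - v k)) \<le> (real K - 1) * \<gamma> * (L * D\<^sup>2)"
  proof -
    have "- ((dF (y k) - dF x) \<bullet> (y k - v k)) \<le> norm (dF (y k) - dF x) * norm (y k - v k)"
      using Cauchy_Schwarz_ineq2[of "dF (y k) - dF x" "y k - v k"] by linarith
    also have "\<dots> \<le> (L * ((real K - 1) * \<gamma> * D)) * D"
    proof (rule mult_mono)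
      show "norm (dF (y k) - dF x) \<le> L * ((real K - 1) * \<gamma> * D)"
        by (rule order_trans[OF dF_lip[OF yk(1) x_in] mult_left_mono[OF y_dist_inner[OF k] less_imp_le[OF L_pos]]])
    qed (use diam yk L_pos K_pos \<gamma>_pos D_nonneg in auto)
    finally show ?thesis by (simp add: power2_eq_square algebra_simps)
  qed
  ultimately show ?thesis by (simp add: algebra_simps)
qed

text \<open>The losses of \<open>G_ge_gap\<close> and \<open>G_le_true\<close> added up, with
  \<open>F x - Fo\<close> covering the differences of \<open>F\<close>. In the factor of
  \<gamma>LD^2, \<kappa> is the largest model gap compatible with a shortened step and 1/2 is the
  curvature of \<open>F\<close> over one inner step.\<close>

definition slack :: "real \<Rightarrow> real" where
  "slack Fo = 2 * (D * \<zeta>) + (2 * \<kappa> + 3 / 2) * ((real K - 1) * \<gamma> * (L * D\<^sup>2))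
     + (\<kappa> + 1 / 2) * (\<gamma> * (L * D\<^sup>2)) + (F x - Fo)"

lemma MK_nonneg: "0 \<le> (real K - 1) * \<gamma> * (L * D\<^sup>2)" "0 \<le> \<gamma> * (L * D\<^sup>2)"
  using K_pos \<gamma>_pos L_pos by auto

text \<open>A shortened step is an exact line search, so its model gap is at most
  \<kappa>\<gamma>LD^2, whereas a gap above the slack keeps every model gap of this outer iteration
  larger.\<close>

lemma full_step:
  assumes k: "k < K" and Fo: "\<And>u. u \<in> C \<Longrightarrow> Fo \<le> F u" and large: "slack Fo < gap x"
  shows "\<delta> k = \<gamma>"
proof (rule ccontr)
  assume "\<delta> k \<noteq> \<gamma>"
  then have short: "\<delta> k < \<gamma>" using \<delta>_le[of k] by simp
  have yk: "y k \<in> C" "v k \<in> C" using y_in v_in k by auto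
  have "N k \<le> \<kappa> * L * D * D"
  proof -
    have "N k \<le> \<kappa> * L * norm (v k - y k) * norm (v k - y k)"
      using T_inner[of "v k - y k" "v k - y k"] by (simp add: N_def inner_commute)
    also have "\<dots> \<le> \<kappa> * L * D * D"
      using diam[OF yk(2,1)] \<kappa>_ge L_pos D_nonneg by (intro mult_mono) auto
    finally show ?thesis .
  qed
  then have "G k \<le> \<gamma> * (\<kappa> * L * D * D)"
    unfolding \<delta>_short[OF short] using short \<delta>_ge0[OF k] N_nonneg \<gamma>_pos by (intro mult_mono) auto
  then have "G k \<le> \<kappa> * (\<gamma> * (L * D\<^sup>2))" by (simp add: power2_eq_square algebra_simps)
  moreover have "0 \<le> (\<kappa> + 1) * ((real K - 1) * \<gamma> * (L * D\<^sup>2))" "0 \<le> D * \<zeta>"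
    using MK_nonneg \<kappa>_ge D_nonneg \<zeta>_nonneg by auto
  moreover note G_ge_gap[OF k] Fo[OF yk(1)] large MK_nonneg
  ultimately show False by (simp add: slack_def algebra_simps)
qed

lemma F_decrease_gap:
  assumes Fo: "\<And>u. u \<in> C \<Longrightarrow> Fo \<le> F u"
  shows "F (y K) \<le> F x - \<gamma> * (gap x - slack Fo) / 2 + real K * \<gamma> * D * \<zeta>"
proof -
  have K: "0 < K" using K_pos by simp
  have "\<gamma> * (gap x - slack Fo) \<le> \<delta> 0 * G 0"
  proof (cases "slack Fo < gap x")
    case True
    have "gap x - slack Fo \<le> G 0"
    proof -
      have "dF x \<bullet> (x - w) - \<zeta> * D \<le> G 0" if "w \<in> C" for w
        using G_max[OF K that] noise_bound_D[OF x_in that] linear_0[OF T_linear]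
        by (simp add: dQ_def y_0 \<xi>_def inner_diff_left abs_le_iff)
      then have "gap x - \<zeta> * D \<le> G 0" using gap_attained by metis
      moreover have "0 \<le> (2 * \<kappa> + 3 / 2) * ((real K - 1) * \<gamma> * (L * D\<^sup>2))" "0 \<le> D * \<zeta>"
        "0 \<le> (\<kappa> + 1 / 2) * (\<gamma> * (L * D\<^sup>2))"
        using MK_nonneg \<kappa>_ge D_nonneg \<zeta>_nonneg by auto
      ultimately show ?thesis using Fo[OF x_in] by (simp add: slack_def algebra_simps)
    qed
    then show ?thesis using full_step[OF K Fo True] \<gamma>_pos by simp
  next
    case False
    then have "\<gamma> * (gap x - slack Fo) \<le> 0" using \<gamma>_pos by (simp add: mult_le_0_iff)
    also have "0 \<le> \<delta> 0 * G 0" using \<delta>_ge0[OF K] G_nonneg[OF K y_in] by simp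
    finally show ?thesis .
  qed
  then have "Q K \<le> - \<gamma> * (gap x - slack Fo) / 2"
    using Q_antimono[of 1 K] Q_decrease[OF K] Q_0 K_pos by simp
  moreover have "- (\<xi> \<bullet> (y K - x)) \<le> real K * \<gamma> * D * \<zeta>"
  proof -
    have "- (\<xi> \<bullet> (y K - x)) \<le> \<zeta> * norm (y K - x)"
      using noise_bound[OF y_in[of K] x_in] by simp
    also have "\<dots> \<le> \<zeta> * (real K * \<gamma> * D)"
      using y_dist[of K] \<zeta>_nonneg by (intro mult_left_mono) auto
    finally show ?thesis by (simp add: algebra_simps)
  qed
  ultimately show ?thesis using F_le_Q[of K] by simp
qed

text \<open>
  Tilting \<open>F\<close> by its linearization at an earlier point \<open>u\<close> gives a convex function that decreases
  whenever the gap exceeds the gap at \<open>u\<close>: the gap cannot stay above its past values for long.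
\<close>

lemma tilted_decrease:
  assumes u: "u \<in> C" and Fo: "\<And>w. w \<in> C \<Longrightarrow> Fo \<le> F w"
  shows "F (y K) - dF u \<bullet> y K \<le> F x - dF u \<bullet> x - real K * (\<gamma> * (gap x - gap u - slack Fo))"
proof -
  let ?t = "gap x - gap u - slack Fo"
  have "F (y k) - dF u \<bullet> y k \<le> F x - dF u \<bullet> x - real k * (\<gamma> * ?t)" if "k \<le> K" for k
    using that
  proof (induction k)
    case 0
    then show ?case by (simp add: y_0)
  next
    case (Suc k)
    then have k: "k < K" by simp
    have yk: "y k \<in> C" "y (Suc k) \<in> C" "v k \<in> C" using y_in v_in k by auto
    have d0: "0 \<le> \<delta> k" using \<delta>_ge0[OF k] .
    have "dF u \<bullet> (y k - v k) \<le> F (y k) - F u + gap u"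
      using F_tangent[OF u yk(1)] gap_upper[OF yk(3), of u] by (simp add: inner_diff_right)
    \<comment> \<open>\<open>F (y k)\<close> cancels between the tangent inequality at
      \<open>u\<close> and \<open>G_ge_gap\<close>; what is left, \<open>F x - F u\<close>, is part
      of the slack.\<close>
    with G_ge_gap[OF k] G_le_true[OF k] Fo[OF u]
    have t: "?t + \<gamma> * (L * D\<^sup>2) / 2 \<le> (dF (y k) - dF u) \<bullet> (y k - v k)"
      using MK_nonneg mult_nonneg_nonneg[OF _ MK_nonneg(2), of \<kappa>] \<kappa>_ge
      by (simp add: slack_def inner_diff_left algebra_simps)
    have "F (y (Suc k)) \<le> F (y k) + dF (y k) \<bullet> (y (Suc k) - y k) + L / 2 * (norm (y (Suc k) - y k))\<^sup>2"
      by (rule F_smooth[OF yk(1,2)])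
    also have "L / 2 * (norm (y (Suc k) - y k))\<^sup>2 \<le> \<delta> k * (\<gamma> * (L * D\<^sup>2) / 2)"
    proof -
      have "(norm (y (Suc k) - y k))\<^sup>2 \<le> (\<delta> k * D)\<^sup>2"
        using y_move[OF k] by (intro power_mono) auto
      also have "\<dots> = \<delta> k * \<delta> k * D\<^sup>2"
        by (simp add: power2_eq_square algebra_simps)
      also have "\<dots> \<le> \<delta> k * \<gamma> * D\<^sup>2"
        by (intro mult_right_mono mult_left_mono \<delta>_le d0) auto
      finally have "L / 2 * (norm (y (Suc k) - y k))\<^sup>2 \<le> L / 2 * (\<delta> k * \<gamma> * D\<^sup>2)"
        using L_pos by (intro mult_left_mono) auto
      then show ?thesis by (simp add: algebra_simps)
    qed
    also have "dF (y k) \<bullet> (y (Suc k) - y k) = - \<delta> k * (dF (y k) \<bullet> (y k - v k))"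
      unfolding step[OF k] by (simp add: inner_diff_right algebra_simps)
    finally have "F (y (Suc k)) \<le> F (y k) - \<delta> k * (dF (y k) \<bullet> (y k - v k)) + \<delta> k * (\<gamma> * (L * D\<^sup>2) / 2)"
      by simp
    moreover have "dF u \<bullet> y (Suc k) = dF u \<bullet> y k - \<delta> k * (dF u \<bullet> (y k - v k))"
      unfolding step[OF k] by (simp add: inner_diff_right inner_add_right algebra_simps)
    ultimately have "F (y (Suc k)) - dF u \<bullet> y (Suc k) \<le> F (y k) - dF u \<bullet> y k
        - \<delta> k * ((dF (y k) - dF u) \<bullet> (y k - v k) - \<gamma> * (L * D\<^sup>2) / 2)"
      by (simp add: inner_diff_left algebra_simps)
    moreover have "\<delta> k * ?t \<le> \<delta> k * ((dF (y k) - dF u) \<bullet> (y k - v k) - \<gamma> * (L * D\<^sup>2) / 2)"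
      using t d0 by (intro mult_left_mono) auto
    \<comment> \<open>A positive excess forces the full step, because the gap at \<open>u\<close> is
      nonnegative; for a negative excess the cap on the step size has the right sign.\<close>
    moreover have "\<gamma> * ?t \<le> \<delta> k * ?t"
    proof (cases "0 \<le> ?t")
      case True
      show ?thesis
      proof (cases "slack Fo < gap x")
        case large: True
        show ?thesis using full_step[OF k Fo large] by simp
      next
        case False
        then have "?t \<le> 0" using gap_nonneg[OF u] by simp
        with True have "?t = 0" by simp
        then show ?thesis by simp
      qed
    next
      case False
      then show ?thesis using \<delta>_le[of k] by (intro mult_right_mono_neg) auto
    qed
    ultimately show ?case using Suc by (simp add: algebra_simps)
  qed
  then show ?thesis by simp
qed

lemma outer_combination:
  "\<exists>w c. 0 \<le> w \<and> w \<le> 1 \<and> w \<le> real K * \<gamma> \<and> c \<in> C \<and> y K = x + w *\<^sub>R (c - x)"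
  using y_combination[of K 0] by (simp add: y_0)

end

section \<open>Real sequences\<close>

lemma sum_inverse_le_ln:
  assumes "1 \<le> j" "j \<le> J"
  shows "(\<Sum>i=j..<J. 1 / real i) \<le> 1 + ln (real J / real j)"
proof -
  have *: "(\<Sum>i=j..<Suc n. 1 / real i) \<le> 1 / real j + ln (real n / real j)" if "j \<le> n" for n
    using that
  proof (induction n rule: dec_induct)
    case base
    then show ?case using assms by simp
  next
    case (step n)
    have n: "real n > 0" using step assms by simp
    have "ln (real n / real (Suc n)) \<le> real n / real (Suc n) - 1"
      using n by (intro ln_le_minus_one) auto
    also have "\<dots> = - (1 / real (Suc n))" by (simp add: field_simps)
    finally have "1 / real (Suc n) \<le> ln (real (Suc n)) - ln (real n)"
      using n by (simp add: ln_div)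
    moreover have "(\<Sum>i=j..<Suc (Suc n). 1 / real i) = (\<Sum>i=j..<Suc n. 1 / real i) + 1 / real (Suc n)"
      using step by simp
    ultimately show ?case
      using step assms n by (simp add: ln_div)
  qed
  show ?thesis
  proof (cases "j = J")
    case False
    then obtain n where n: "J = Suc n" "j \<le> n" using assms by (cases J) auto
    have "ln (real n / real j) \<le> ln (real J / real j)"
      using n assms by (intro ln_mono divide_right_mono) auto
    moreover have "1 / real j \<le> 1" using assms by simp
    ultimately show ?thesis using *[OF n(2)] n(1) by simp
  qed (use assms in simp)
qed

lemma Taylor_le_exp:
  assumes "0 \<le> (x::real)"
  shows "(\<Sum>k<n. x ^ k / fact k) \<le> exp x"
proof -
  have "(\<Sum>k<n. x ^ k /\<^sub>R fact k) \<le> (\<Sum>k. x ^ k /\<^sub>R fact k)"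
    using assms summable_exp_generic[of x] by (intro sum_le_suminf) auto
  then show ?thesis by (simp add: exp_def field_simps)
qed

text \<open>Reduces a bound on a logarithm to rational arithmetic with a partial sum of the
  exponential series.\<close>

lemma ln_le_rational:
  assumes "0 < x" "0 \<le> (y::real)" "x \<le> (\<Sum>k<n. y ^ k / fact k)"
  shows "ln x \<le> y"
  using assms Taylor_le_exp[of y n] by (metis exp_le_cancel_iff exp_ln order_trans)

lemma ln_bounds:
  "ln (3 / 2) \<le> (41 / 100 :: real)" "ln 2 \<le> (7 / 10 :: real)" "ln (89 / 20) \<le> (3 / 2 :: real)"
  "ln (9 / 8) \<le> (1 / 8 :: real)"
proof -
  show "ln (3 / 2) \<le> (41 / 100 :: real)" "ln 2 \<le> (7 / 10 :: real)"
    by (rule ln_le_rational[where n=5]; simp add: eval_nat_numeral)+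
  show "ln (89 / 20) \<le> (3 / 2 :: real)"
    by (rule ln_le_rational[where n=8]; simp add: eval_nat_numeral)
  show "ln (9 / 8) \<le> (1 / 8 :: real)"
    using ln_le_minus_one[of "9/8 :: real"] by simp
qed

text \<open>By \<open>window\<close>, the first entry of a window is at most \<open>b\<close> below
  the average, so dropping it raises the average by at most \<open>b\<close> times its relative
  weight. Shrinking a window to its end therefore costs \<open>b\<close> times a harmonic-like sum
  instead of the ratio of the lengths.\<close>

lemma averages_backward:
  fixes w \<nu> \<rho> :: "nat \<Rightarrow> real"
  defines "S \<equiv> \<lambda>i s. \<Sum>\<tau>=i..<s. w \<tau> * \<nu> \<tau>" and "W \<equiv> \<lambda>i s. \<Sum>\<tau>=i..<s. w \<tau>"
  assumes w: "\<And>\<tau>. 0 < w \<tau>" and b: "0 \<le> b"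
    and window: "\<And>i. t \<le> i \<Longrightarrow> i < s \<Longrightarrow> S i s \<le> (\<nu> i + b) * W i s"
    and ratio: "\<And>i. t \<le> i \<Longrightarrow> i < u \<Longrightarrow> w i / W (Suc i) s \<le> \<rho> i"
    and "t \<le> u" "u < s"
  shows "S u s / W u s \<le> S t s / W t s + b * (\<Sum>i=t..<u. \<rho> i)"
  using \<open>t \<le> u\<close> \<open>u < s\<close> ratio
proof (induction u rule: dec_induct)
  case base
  then show ?case by simp
next
  case (step n)
  have Wpos: "0 < W i s" if "i < s" for i
    unfolding W_def using that w by (intro sum_pos) auto
  have n: "n < s" "Suc n < s" using step by auto
  define a where "a = S n s / W n s"
  have Sn: "S n s = w n * \<nu> n + S (Suc n) s" and Wn: "W n s = w n + W (Suc n) s"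
    using n by (simp_all add: S_def W_def sum.atLeast_Suc_lessThan)
  have Sa: "S n s = a * W n s"
    using Wpos[OF n(1)] by (simp add: a_def)
  have "a \<le> \<nu> n + b"
    using window[of n] step n Wpos[OF n(1)] by (simp add: a_def divide_le_eq)
  then have "w n * (a - b) \<le> w n * \<nu> n"
    using w[of n] by (intro mult_left_mono) auto
  then have "S (Suc n) s \<le> a * W (Suc n) s + b * w n"
    using Sn Sa Wn by (simp add: algebra_simps)
  then have "S (Suc n) s / W (Suc n) s \<le> (a * W (Suc n) s + b * w n) / W (Suc n) s"
    using Wpos[OF n(2)] by (intro divide_right_mono) auto
  also have "\<dots> = a + b * (w n / W (Suc n) s)"
    using Wpos[OF n(2)] by (simp add: field_simps)
  also have "\<dots> \<le> a + b * \<rho> n"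
    using step b by (intro add_left_mono mult_left_mono) auto
  also have "a \<le> S t s / W t s + b * (\<Sum>i=t..<n. \<rho> i)"
    unfolding a_def using step n by auto
  finally show ?case
    using step by (simp add: algebra_simps)
qed

lemma exists_le_average:
  fixes w \<nu> :: "nat \<Rightarrow> real"
  assumes w: "\<And>\<tau>. 0 < w \<tau>" and "u < s"
  shows "\<exists>\<tau>\<in>{u..<s}. \<nu> \<tau> \<le> (\<Sum>\<tau>=u..<s. w \<tau> * \<nu> \<tau>) / (\<Sum>\<tau>=u..<s. w \<tau>)"
proof (rule ccontr)
  let ?W = "\<Sum>\<tau>=u..<s. w \<tau>" and ?S = "\<Sum>\<tau>=u..<s. w \<tau> * \<nu> \<tau>"
  assume "\<not> (\<exists>\<tau>\<in>{u..<s}. \<nu> \<tau> \<le> ?S / ?W)"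
  then have less: "?S / ?W < \<nu> \<tau>" if "\<tau> \<in> {u..<s}" for \<tau>
    using that by (meson linorder_not_le)
  have "?W > 0" using w \<open>u < s\<close> by (intro sum_pos) auto
  have "(\<Sum>\<tau>=u..<s. w \<tau> * (?S / ?W)) < ?S"
    using less w \<open>u < s\<close> by (intro sum_strict_mono mult_strict_left_mono) auto
  moreover have "(\<Sum>\<tau>=u..<s. w \<tau> * (?S / ?W)) = ?S"
    using \<open>?W > 0\<close> sum_distrib_right[of w "{u..<s}" "?S / ?W"] by simp
  ultimately show False by simp
qed

lemma sum_geometric_weighted:
  fixes a b :: real
  assumes "0 \<le> a" "0 \<le> b"
  shows "(\<Sum>i<N. (5 / 6) ^ i * (a + b * real i)) \<le> 6 * a + 30 * b"
proof -
  have "(\<Sum>i<N. (5 / 6) ^ i * (a + b * real i)) = 6 * a + 30 * b - (5 / 6) ^ N * (6 * a + b * (6 * real N + 30))"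
  proof (induction N)
    case (Suc N)
    have "z - p * (6 * a + b * (6 * n + 30)) + p * (a + b * n) = z - 5 / 6 * p * (6 * a + b * (6 * (n + 1) + 30))"
      for z p n :: real by (simp add: algebra_simps)
    from this[of "6 * a + 30 * b" "(5 / 6) ^ N" "real N"] show ?case
      by (simp only: sum.lessThan_Suc Suc power_Suc of_nat_Suc add.commute)
  qed simp
  then show ?thesis using assms by simp
qed

section \<open>Convergence rates from scalar recursions\<close>

text \<open>
  All quantities are normalized by powers of \<open>L\<close> and \<open>D\<close>. The sequences stand for the expected primal
  gap \<open>e\<close>, the slope \<open>d\<close> towards the minimizer, the first two moments \<open>z1\<close>, \<open>z2\<close> of the tangential noise,
  the Frank-Wolfe gap \<open>\<nu>\<close>, the mean squared gradient distance \<open>r\<close> to the minimizer, and the decrease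
  \<open>\<phi> s k\<close> of the objective at distance \<open>(2/3)^k\<close> from the iterate \<open>s\<close> towards the minimizer.
\<close>

locale svrf_rates =
  fixes K T :: nat and \<kappa> :: real and e d z1 z2 \<nu> r b :: "nat \<Rightarrow> real"
    and \<phi> :: "nat \<Rightarrow> nat \<Rightarrow> real" and \<sigma> :: "nat \<Rightarrow> nat" and S :: "nat set"
    and \<gamma> \<beta> :: "nat \<Rightarrow> real" and A :: real
  defines "\<gamma> \<equiv> \<lambda>t. 2 / (real t + 2)" and "A \<equiv> 2 * (real K + 1 + \<kappa>)"
    and "\<beta> \<equiv> \<lambda>t. 2 * z1 t + (2 * \<kappa> + 3 / 2) * ((real K - 1) * \<gamma> t) + (\<kappa> + 1 / 2) * \<gamma> t + e t"
  assumes K_pos: "1 \<le> K" and \<kappa>_ge: "1 \<le> \<kappa>"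
    and e_nonneg: "t \<le> T \<Longrightarrow> 0 \<le> e t" and d_ge: "t \<le> T \<Longrightarrow> e t \<le> d t"
    and z1_le: "t < T \<Longrightarrow> 0 < \<alpha> \<Longrightarrow> z1 t \<le> z2 t / (2 * \<alpha>) + \<alpha> / 2"
    and main_small: "t < T \<Longrightarrow>
      e (Suc t) \<le> e t - \<gamma> t * d t + (\<gamma> t)\<^sup>2 * \<kappa> / 2 + \<gamma> t * z1 t + (real K - 1) * z2 t / 2"
    and main_large: "t < T \<Longrightarrow> 0 < \<mu> \<Longrightarrow>
      e (Suc t) \<le> e t - \<gamma> t * d t + (\<gamma> t)\<^sup>2 * \<kappa> / 2 + \<gamma> t * z1 t
        + (\<mu> * z2 t + (real K)\<^sup>2 * (\<gamma> t)\<^sup>2 / (3 * \<mu> ^ 3))"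
    and increase: "t < T \<Longrightarrow> e (Suc t) \<le> e t + real K * \<gamma> t * z1 t"
    and decrease: "t < T \<Longrightarrow> e (Suc t) \<le> e t - \<gamma> t * (\<nu> t - \<beta> t) / 2 + real K * \<gamma> t * z1 t"
    and window: "i \<le> s \<Longrightarrow> s \<le> T \<Longrightarrow> (\<Sum>t=i..<s. \<gamma> t * (\<nu> t - \<nu> i - \<beta> t)) \<le> 0"
    and \<nu>_nonneg: "t \<le> T \<Longrightarrow> 0 \<le> \<nu> t"
    and r_small: "t \<le> T \<Longrightarrow> r t \<le> 11 / 10 * (real n / 2 * e t) + 11 * (4 / 9) ^ n"
    and r_large: "t \<le> T \<Longrightarrow> r t \<le> 11 / 10 * (real n / 2 * e t)
      + 11 * (101 / 100 * (5 * (\<Sum>i<N. (5 / 4) ^ i * (\<phi> t (n + Suc i) / 2))) + 101 * (4 / 9) ^ (n + N))"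
    and \<phi>_le: "t \<le> s \<Longrightarrow> s \<le> T \<Longrightarrow>
      \<phi> s k \<le> (e s - e t) + ((\<Sum>i=t..<s. real K * \<gamma> i) + (2 / 3) ^ k) * \<nu> t"
    and noise: "t < T \<Longrightarrow> t \<notin> S \<Longrightarrow> z2 t \<le> (5 * d t + 5 / 4 * r (\<sigma> t)) / b t"
    and noise': "t < T \<Longrightarrow> t \<notin> S \<Longrightarrow> z2 t \<le> (5 * r t + 5 / 4 * r (\<sigma> t)) / b t"
    and no_noise: "t < T \<Longrightarrow> t \<in> S \<Longrightarrow> z2 t \<le> 0"
    and snapshot: "t \<notin> S \<Longrightarrow> 1 \<le> \<sigma> t" "t \<notin> S \<Longrightarrow> \<sigma> t \<le> t" "t \<notin> S \<Longrightarrow> t + 2 \<le> 2 * (\<sigma> t + 2)"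
      "0 \<in> S"
    and b_ge: "12 * A * (real t + 2) \<le> b t"
begin

lemma \<gamma>_pos: "0 < \<gamma> t"
  by (simp add: \<gamma>_def)

lemma A_bounds: "2 * (real K + 2) \<le> A" "6 \<le> A" "0 < A"
  using K_pos \<kappa>_ge by (auto simp: A_def)

text \<open>
  Of the scales \<open>(2/3)^k\<close>, the first \<open>20 + 2 * level\<close> are paid for by the primal gap alone: this costs
  \<open>11 + 11/10 * level\<close> in \<open>c\<close>, and \<open>5/2\<close> is left for all finer scales. They decay fast enough to
  beat their linear growth in \<open>K\<close> because \<open>K\<close> is at most of order \<open>2 ^ level\<close>.
\<close>

definition level :: nat where
  "level = (LEAST l. real K \<le> 9 / 8 * 2 ^ l)"

definition c :: real where
  "c = 27 / 2 + 11 / 10 * real level"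

lemma level_upper: "real K \<le> 9 / 8 * 2 ^ level"
proof -
  have "real K \<le> 2 ^ K"
    using of_nat_mono[OF less_imp_le[OF less_exp[of K]], where 'a=real] by simp
  moreover have "(0::real) \<le> 2 ^ K" by simp
  ultimately have "real K \<le> 9 / 8 * 2 ^ K" by linarith
  then show ?thesis unfolding level_def by (rule LeastI)
qed

lemma level_lower: "level = 0 \<or> 9 / 16 * 2 ^ level < real K"
proof (cases level)
  case (Suc l)
  then have "\<not> real K \<le> 9 / 8 * 2 ^ l"
    using not_less_Least[of l "\<lambda>l. real K \<le> 9 / 8 * 2 ^ l"] by (simp add: level_def)
  then show ?thesis using Suc by simp
qed simp

lemma c_pos: "0 < c"
  by (simp add: c_def)

lemma two_power_ge: "real n + 1 \<le> 2 ^ n"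
proof -
  have "n + 1 \<le> 2 ^ n" using less_exp[of n] by linarith
  then show ?thesis using of_nat_mono[of "n + 1" "2 ^ n", where 'a=real] by simp
qed

text \<open>Calibrated for \<open>z1_bound\<close>: the variance (5/8)c/(t+2)^2 is then at most the
  square of 3K/(t+2).\<close>

lemma c_le: "5 / 8 * c \<le> 9 * (real K)\<^sup>2"
proof (cases "level = 0")
  case True
  have "1 * 1 \<le> real K * real K" using K_pos by (intro mult_mono) auto
  then show ?thesis using True by (simp add: c_def power2_eq_square)
next
  case False
  have "9 / 16 * (2::real) ^ 1 \<le> 9 / 16 * 2 ^ level" using False by (intro mult_left_mono power_increasing) auto
  then have "K \<noteq> 1" using level_lower False by auto
  then have K: "2 \<le> real K" using K_pos by simp
  have "9 / 16 * 2 ^ level < real K" using level_lower False by simp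
  moreover have "9 / 16 * (real level + 1) \<le> 9 / 16 * 2 ^ level"
    by (intro mult_left_mono two_power_ge) simp
  ultimately have "9 / 16 * (real level + 1) < real K" by (rule le_less_trans[rotated])
  then have "18 * (9 / 16 * (real level + 1)) \<le> 9 * (2 * real K)" by simp
  also have "\<dots> \<le> 9 * (real K)\<^sup>2" using K by (simp add: power2_eq_square)
  finally have "81 / 8 * (real level + 1) \<le> 9 * (real K)\<^sup>2" by simp
  moreover have "1 \<le> real level" using False by simp
  ultimately show ?thesis by (simp add: c_def)
qed

section \<open>Noise and slack under the induction hypothesis\<close>

lemma z1_bound:
  assumes t: "t < T" and r: "t \<notin> S \<Longrightarrow> r t \<le> c * A / (real t + 2)"
    "t \<notin> S \<Longrightarrow> r (\<sigma> t) \<le> c * A / (real (\<sigma> t) + 2)"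
  shows "z1 t \<le> 3 / 2 * real K * \<gamma> t"
proof -
  define a where "a = real t + 2"
  have a: "a > 0" by (simp add: a_def)
  have z2: "z2 t \<le> 9 * (real K)\<^sup>2 / a\<^sup>2"
  proof (cases "t \<in> S")
    case True
    then have "z2 t \<le> 0" using no_noise t by simp
    also have "0 \<le> 9 * (real K)\<^sup>2 / a\<^sup>2" by simp
    finally show ?thesis .
  next
    case False
    have s: "a / 2 \<le> real (\<sigma> t) + 2" using snapshot(3)[OF False] by (simp add: a_def)
    have cA: "0 < c * A" using c_pos A_bounds by simp
    have "c * A / (real (\<sigma> t) + 2) \<le> c * A / (a / 2)"
      using s a cA by (intro divide_left_mono) auto
    \<comment> \<open>15/2 = 5 + 2 * 5/4: the bound at the snapshot is worse by a factor of at most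
      2.\<close>
    with r False have "5 * r t + 5 / 4 * r (\<sigma> t) \<le> 15 / 2 * (c * A / a)"
      unfolding a_def[symmetric] by fastforce
    moreover have b: "0 < 12 * A * a" "12 * A * a \<le> b t"
      using b_ge[of t] a A_bounds by (auto simp: a_def)
    moreover have b_pos: "0 < b t" using b by linarith
    ultimately have "z2 t \<le> 15 / 2 * (c * A / a) / b t"
      using noise'[OF t False] divide_right_mono[of "5 * r t + 5 / 4 * r (\<sigma> t)" "15 / 2 * (c * A / a)" "b t"]
      by linarith
    also have "\<dots> \<le> 15 / 2 * (c * A / a) / (12 * A * a)"
      using a b b_pos cA A_bounds by (intro divide_left_mono mult_pos_pos) auto
    also have "\<dots> = (5 / 8 * c) / a\<^sup>2"
      using a A_bounds by (simp add: power2_eq_square field_simps)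
    also have "\<dots> \<le> 9 * (real K)\<^sup>2 / a\<^sup>2"
      using c_le by (intro divide_right_mono) auto
    finally show ?thesis .
  qed
  \<comment> \<open>The second moment is at most \<alpha>^2, so this choice balances the two terms
    of Young's inequality.\<close>
  define \<alpha> where "\<alpha> = 3 * real K / a"
  have \<alpha>: "\<alpha> > 0" using K_pos a by (simp add: \<alpha>_def)
  have "z1 t \<le> z2 t / (2 * \<alpha>) + \<alpha> / 2" by (rule z1_le[OF t \<alpha>])
  also have "z2 t / (2 * \<alpha>) \<le> (9 * (real K)\<^sup>2 / a\<^sup>2) / (2 * \<alpha>)"
    using z2 \<alpha> by (intro divide_right_mono) auto
  also have "(9 * (real K)\<^sup>2 / a\<^sup>2) / (2 * \<alpha>) = \<alpha> / 2"
    using a K_pos by (simp add: \<alpha>_def power2_eq_square field_simps)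
  finally have "z1 t \<le> \<alpha>" by simp
  also have "\<alpha> = 3 / 2 * real K * \<gamma> t" by (simp add: \<alpha>_def \<gamma>_def a_def)
  finally show ?thesis .
qed

lemma \<beta>_bound:
  assumes "z1 t \<le> 3 / 2 * real K * \<gamma> t" "e t \<le> A / (real t + 2)"
  shows "\<beta> t \<le> (2 * real K + 1 / 2) * (A / (real t + 2))"
proof -
  have e: "e t \<le> (real K + 1 + \<kappa>) * \<gamma> t"
    using assms(2) by (simp add: A_def \<gamma>_def mult.commute)
  have "\<beta> t \<le> 3 * real K * \<gamma> t + (2 * \<kappa> + 3 / 2) * ((real K - 1) * \<gamma> t) + (\<kappa> + 1 / 2) * \<gamma> t + (real K + 1 + \<kappa>) * \<gamma> t"
    using assms(1) e by (simp add: \<beta>_def)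
  also have "\<dots> = (2 * \<kappa> * real K + 11 / 2 * real K) * \<gamma> t"
    by (simp add: algebra_simps)
  \<comment> \<open>The mixed term in K\<kappa> dictates the leading factor 2K, and the extra 1/2 is
    exact at K = \<kappa> = 1.\<close>
  also have "\<dots> \<le> ((2 * real K + 1 / 2) * (real K + 1 + \<kappa>)) * \<gamma> t"
  proof (rule mult_right_mono)
    have "0 \<le> (2 * real K - 1) * (real K - 1)" using K_pos by (intro mult_nonneg_nonneg) auto
    then have "3 * real K \<le> 1 + 2 * (real K * real K)" by (simp add: algebra_simps)
    moreover have "(2 * real K + 1 / 2) * (real K + 1 + \<kappa>)
        = 2 * (real K * real K) + 2 * \<kappa> * real K + 5 / 2 * real K + 1 / 2 + 1 / 2 * \<kappa>"
      by (simp add: algebra_simps add_divide_distrib)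
    ultimately show "2 * \<kappa> * real K + 11 / 2 * real K \<le> (2 * real K + 1 / 2) * (real K + 1 + \<kappa>)"
      using \<kappa>_ge by linarith
  qed (simp add: \<gamma>_def)
  also have "\<dots> = (2 * real K + 1 / 2) * (A / (real t + 2))"
  proof -
    have "A / (real t + 2) = (real K + 1 + \<kappa>) * \<gamma> t"
      by (simp add: A_def \<gamma>_def mult.commute)
    then show ?thesis by (simp only: mult.assoc)
  qed
  finally show ?thesis .
qed

section \<open>Recent Frank-Wolfe gaps and the decrease at fine scales\<close>

lemma gap_window:
  assumes s: "s \<le> T" "22000 \<le> s" and j: "1 \<le> j" "j \<le> s div 10"
    and e: "\<And>t. 1 \<le> t \<Longrightarrow> t \<le> s \<Longrightarrow> e t \<le> A / (real t + 2)"
    and z: "\<And>t. 1 \<le> t \<Longrightarrow> t < s \<Longrightarrow> z1 t \<le> 3 / 2 * real K * \<gamma> t"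
  shows "\<exists>t\<in>{s - j..<s}. \<nu> t \<le> A / (real s + 2) *
    (19 / 2 + 139 / 25 * real K + (247 / 100 * real K + 31 / 50) * (1 + ln ((real s + 2) / 10 / real j)))"
proof -
  define S2 where "S2 = real s + 2"
  define U where "U = A / S2"
  \<comment> \<open>Within the last tenth of the iterations all bounds in 1/(t+2) agree up to the
    factor 10/9. The decrease recursion controls the average gap there; restricting to the last
    \<open>j\<close> iterations then costs only a logarithm.\<close>
  define t0 where "t0 = s - s div 10"
  define b0 where "b0 = (2 * real K + 1 / 2) * U * (10 / 9)"
  define W where "W i = (\<Sum>\<tau>=i..<s. \<gamma> \<tau>)" for i
  define V where "V i = (\<Sum>\<tau>=i..<s. \<gamma> \<tau> * \<nu> \<tau>)" for i
  have S2: "22002 \<le> S2" using s by (simp add: S2_def)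
  have U: "0 < U" using A_bounds S2 by (simp add: U_def)
  have div: "real (s div 10) \<le> real s / 10" "real s - 9 \<le> 10 * real (s div 10)"
    by (simp_all add: real_of_nat_div)
  have t0: "1 \<le> t0" "t0 \<le> s - j" "s - j < s" "t0 < s" "s - t0 = s div 10"
    using s j by (auto simp: t0_def)
  have late: "9 / 10 * S2 \<le> real \<tau> + 2" if "t0 \<le> \<tau>" for \<tau>
  proof -
    have "real s - real (s div 10) \<le> real \<tau>"
      using that by (simp add: t0_def)
    then show ?thesis using div by (simp add: S2_def)
  qed
  have A_late: "A / (real \<tau> + 2) \<le> U * (10 / 9)" if "t0 \<le> \<tau>" for \<tau>
  proof -
    have "A / (real \<tau> + 2) \<le> A / (9 / 10 * S2)"
      using late[OF that] A_bounds S2 by (intro divide_left_mono) auto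
    then show ?thesis by (simp add: U_def field_simps)
  qed
  have \<beta>: "\<beta> \<tau> \<le> (2 * real K + 1 / 2) * (A / (real \<tau> + 2))" if "t0 \<le> \<tau>" "\<tau> < s" for \<tau>
    using that t0 by (intro \<beta>_bound z e) auto
  have \<beta>_b0: "\<beta> \<tau> \<le> b0" if "t0 \<le> \<tau>" "\<tau> < s" for \<tau>
  proof -
    have "(2 * real K + 1 / 2) * (A / (real \<tau> + 2)) \<le> (2 * real K + 1 / 2) * (U * (10 / 9))"
      using A_late[OF that(1)] by (intro mult_left_mono) auto
    from order_trans[OF \<beta>[OF that] this] show ?thesis by (simp only: b0_def mult.assoc)
  qed
  have b0: "0 \<le> b0" using U by (simp add: b0_def)
  have W_lower: "(real s - real i) * (2 / S2) \<le> W i" if "i \<le> s" for i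
  proof -
    have "(\<Sum>\<tau>=i..<s. 2 / S2) \<le> W i"
      unfolding W_def by (intro sum_mono) (auto simp: \<gamma>_def S2_def intro!: divide_left_mono)
    then show ?thesis using that by (simp add: of_nat_diff)
  qed
  have W_pos: "0 < W i" if "i < s" for i
    unfolding W_def using that by (intro sum_pos) (auto simp: \<gamma>_def)
  have win: "V i \<le> (\<nu> i + b0) * W i" if "t0 \<le> i" "i < s" for i
  proof -
    have "V i - \<nu> i * W i - b0 * W i = (\<Sum>\<tau>=i..<s. \<gamma> \<tau> * (\<nu> \<tau> - \<nu> i - b0))"
      by (simp add: V_def W_def sum_distrib_left sum_subtractf[symmetric] algebra_simps)
    also have "\<dots> \<le> (\<Sum>\<tau>=i..<s. \<gamma> \<tau> * (\<nu> \<tau> - \<nu> i - \<beta> \<tau>))"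
      using \<beta>_b0 that \<gamma>_pos by (intro sum_mono mult_left_mono) (auto simp: less_imp_le)
    also have "\<dots> \<le> 0" using that s by (intro window) auto
    finally show ?thesis by (simp add: algebra_simps)
  qed
  have ratio: "\<gamma> i / W (Suc i) \<le> 10 / 9 * (1 / real (s - Suc i))" if "t0 \<le> i" "i < s - j" for i
  proof -
    have i: "0 < real s - real (Suc i)" "Suc i < s" using that j by auto
    have "\<gamma> i \<le> 2 / (9 / 10 * S2)"
      unfolding \<gamma>_def using late[OF that(1)] S2 by (intro divide_left_mono) auto
    then have "\<gamma> i / W (Suc i) \<le> (2 / (9 / 10 * S2)) / W (Suc i)"
      using W_pos[OF i(2)] by (intro divide_right_mono) auto
    also have "\<dots> \<le> (2 / (9 / 10 * S2)) / ((real s - real (Suc i)) * (2 / S2))"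
      using W_lower[of "Suc i"] W_pos[OF i(2)] i S2 by (intro divide_left_mono mult_pos_pos) auto
    also have "\<dots> = 10 / 9 * (1 / (real s - real (Suc i)))"
      using i S2 by (simp add: field_simps)
    finally show ?thesis using i by (simp add: of_nat_diff)
  qed
  have harmonic: "(\<Sum>i=t0..<s - j. 10 / 9 * (1 / real (s - Suc i))) \<le> 10 / 9 * (1 + ln (S2 / 10 / real j))"
  proof -
    have "(\<Sum>i=t0..<s - j. 1 / real (s - Suc i)) = (\<Sum>i=j..<s - t0. 1 / real i)"
      using t0 by (intro sum.reindex_bij_witness[where i="\<lambda>i. s - Suc i" and j="\<lambda>i. s - Suc i"]) auto
    also have "\<dots> \<le> 1 + ln (real (s - t0) / real j)"
      using j t0 by (intro sum_inverse_le_ln) auto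
    also have "\<dots> \<le> 1 + ln (S2 / 10 / real j)"
      using j t0 div by (intro add_left_mono ln_mono divide_right_mono) (auto simp: S2_def)
    finally show ?thesis
      unfolding sum_distrib_left[symmetric] by simp
  qed
  have avg: "V t0 / W t0 \<le> U * (19 / 2 + 139 / 25 * real K)"
  proof -
    have step: "\<gamma> \<tau> * \<nu> \<tau> \<le> 2 * (e \<tau> - e (Suc \<tau>)) + \<gamma> \<tau> * ((5 * real K - 3 / 2) * (U * (10 / 9)))"
      if "\<tau> \<in> {t0..<s}" for \<tau>
    proof -
      have \<tau>: "t0 \<le> \<tau>" "\<tau> < s" "1 \<le> \<tau>" "\<tau> < T" using that t0 s by auto
      have "2 * real K * z1 \<tau> \<le> 2 * real K * (3 / 2 * real K * \<gamma> \<tau>)"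
        using z \<tau> by (intro mult_left_mono) auto
      also have "\<dots> = 6 * (real K * real K) / (real \<tau> + 2)"
        by (simp add: \<gamma>_def)
      also have "\<dots> \<le> (3 * real K - 2) * A / (real \<tau> + 2)"
      proof (rule divide_right_mono)
        have "6 * (real K * real K) \<le> (3 * real K - 2) * (2 * (real K + 2))"
          using K_pos by (simp add: algebra_simps)
        also have "\<dots> \<le> (3 * real K - 2) * A"
          using A_bounds K_pos by (intro mult_left_mono) auto
        finally show "6 * (real K * real K) \<le> (3 * real K - 2) * A" .
      qed simp
      finally have z1_part: "2 * real K * z1 \<tau> \<le> (3 * real K - 2) * A / (real \<tau> + 2)" .
      have "\<beta> \<tau> + 2 * real K * z1 \<tau> \<le> (5 * real K - 3 / 2) * (A / (real \<tau> + 2))"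
      proof -
        define x where "x = A / (real \<tau> + 2)"
        have "2 * real K * z1 \<tau> \<le> (3 * real K - 2) * x" using z1_part by (simp add: x_def)
        moreover have "\<beta> \<tau> \<le> (2 * real K + 1 / 2) * x" using \<beta>[OF \<tau>(1,2)] by (simp only: x_def)
        moreover have "(2 * real K + 1 / 2) * x + (3 * real K - 2) * x = (5 * real K - 3 / 2) * x"
          by (simp add: algebra_simps)
        ultimately show ?thesis unfolding x_def by linarith
      qed
      also have "\<dots> \<le> (5 * real K - 3 / 2) * (U * (10 / 9))"
        using A_late[OF \<tau>(1)] K_pos by (intro mult_left_mono) auto
      finally have "\<gamma> \<tau> * (\<beta> \<tau> + 2 * real K * z1 \<tau>) \<le> \<gamma> \<tau> * ((5 * real K - 3 / 2) * (U * (10 / 9)))"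
        using \<gamma>_pos[of \<tau>] by (intro mult_left_mono) auto
      moreover have "\<gamma> \<tau> * \<nu> \<tau> \<le> 2 * (e \<tau> - e (Suc \<tau>)) + \<gamma> \<tau> * (\<beta> \<tau> + 2 * real K * z1 \<tau>)"
        using decrease[OF \<tau>(4)] by (simp add: field_simps)
      ultimately show ?thesis by linarith
    qed
    have "V t0 \<le> (\<Sum>\<tau>=t0..<s. 2 * (e \<tau> - e (Suc \<tau>)) + \<gamma> \<tau> * ((5 * real K - 3 / 2) * (U * (10 / 9))))"
      unfolding V_def by (intro sum_mono step)
    also have "\<dots> = 2 * (e t0 - e s) + W t0 * ((5 * real K - 3 / 2) * (U * (10 / 9)))"
    proof -
      have "(\<Sum>\<tau>=t0..<s. e \<tau> - e (Suc \<tau>)) = e t0 - e s"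
        using sum_Suc_diff'[of t0 s "\<lambda>\<tau>. - e \<tau>"] t0 by simp
      then show ?thesis
        by (simp only: sum.distrib sum_distrib_left[symmetric] sum_distrib_right[symmetric] W_def)
    qed
    also have "\<dots> \<le> 2 * (U * (10 / 9)) + W t0 * ((5 * real K - 3 / 2) * (U * (10 / 9)))"
      using e[of t0] A_late[of t0] e_nonneg[OF s(1)] t0 by simp
    finally have "V t0 / W t0 \<le> 2 * (U * (10 / 9)) / W t0 + (5 * real K - 3 / 2) * (U * (10 / 9))"
      using W_pos[of t0] t0 by (simp add: field_simps)
    \<comment> \<open>The steps \<open>\<gamma>\<close> over the last tenth add up to about 1/5. The
      rounding in \<open>s div 10\<close> is absorbed because \<open>s\<close> is at least
      22000.\<close>
    also have "2 * (U * (10 / 9)) / W t0 \<le> 2 * (U * (10 / 9)) / (1999 / 10000)"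
    proof -
      have "1999 / 10000 * S2 \<le> (real s - real t0) * 2"
        using div S2 t0 by (simp add: S2_def t0_def of_nat_diff)
      then have "1999 / 10000 \<le> (real s - real t0) * (2 / S2)"
        using S2 by (simp add: field_simps)
      also have "\<dots> \<le> W t0" using t0 by (intro W_lower) auto
      finally show ?thesis using U by (intro divide_left_mono) auto
    qed
    also have "2 * (U * (10 / 9)) / (1999 / 10000) + (5 * real K - 3 / 2) * (U * (10 / 9))
       = U * (200000 / 17991 - 5 / 3 + 50 / 9 * real K)"
      by (simp add: field_simps)
    also have "\<dots> \<le> U * (19 / 2 + 139 / 25 * real K)"
      using U by (intro mult_left_mono) auto
    finally show ?thesis by simp
  qed
  have "V (s - j) / W (s - j) \<le> V t0 / W t0 + b0 * (\<Sum>i=t0..<s - j. 10 / 9 * (1 / real (s - Suc i)))"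
    unfolding V_def W_def
    by (rule averages_backward[OF \<gamma>_pos b0]) (use win ratio t0 in \<open>auto simp: V_def W_def\<close>)
  also have "\<dots> \<le> U * (19 / 2 + 139 / 25 * real K) + b0 * (10 / 9 * (1 + ln (S2 / 10 / real j)))"
    using avg harmonic b0 by (intro add_mono mult_left_mono) auto
  also have "b0 * (10 / 9 * (1 + ln (S2 / 10 / real j)))
      = U * ((200 / 81 * real K + 50 / 81) * (1 + ln (S2 / 10 / real j)))"
    by (simp add: b0_def algebra_simps add_divide_distrib)
  also have "\<dots> \<le> U * ((247 / 100 * real K + 31 / 50) * (1 + ln (S2 / 10 / real j)))"
  proof -
    have "real j \<le> S2 / 10" using j div by (simp add: S2_def)
    then have "0 \<le> ln (S2 / 10 / real j)" using j by (intro ln_ge_zero) auto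
    then show ?thesis using U by (intro mult_left_mono mult_right_mono) auto
  qed
  finally have "V (s - j) / W (s - j) \<le> U * (19 / 2 + 139 / 25 * real K + (247 / 100 * real K + 31 / 50) * (1 + ln (S2 / 10 / real j)))"
    by (simp add: algebra_simps)
  moreover have "\<exists>\<tau>\<in>{s - j..<s}. \<nu> \<tau> \<le> V (s - j) / W (s - j)"
    unfolding V_def W_def using t0 by (intro exists_le_average \<gamma>_pos) auto
  ultimately show ?thesis
    unfolding U_def S2_def by (meson order_trans)
qed

text \<open>The decrease at scale (2/3)^k is read off at an earlier iterate with small gap. It must
  be recent enough for the travel since then not to exceed the scale, and the window must be long
  enough to contain such an iterate.\<close>

lemma \<phi>_bound:
  assumes s: "s \<le> T" "22000 \<le> s"
    and e: "\<And>t. 1 \<le> t \<Longrightarrow> t \<le> s \<Longrightarrow> e t \<le> A / (real t + 2)"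
    and z: "\<And>t. 1 \<le> t \<Longrightarrow> t < s \<Longrightarrow> z1 t \<le> 3 / 2 * real K * \<gamma> t"
    and k: "20 \<le> k" "real K \<le> 9 / 200 * ((2 / 3) ^ k * (real s + 2))"
  shows "\<phi> s k \<le> A / (real s + 2) * ((2 / 3) ^ k * (11 / 10 *
    (97 / 10 + 139 / 25 * real K + (247 / 100 * real K + 31 / 50) * (5 / 2 + ln (real K) + 41 / 100 * real k))))"
proof -
  define S2 where "S2 = real s + 2"
  define U where "U = A / S2"
  define q where "q = (2 / 3 :: real) ^ k"
  \<comment> \<open>With this window length the step bounds since its start add up to at most
    \<open>q / 10\<close>, a tenth of the scale.\<close>
  define x where "x = 9 / 200 * (q * S2) / real K"
  define j where "j = nat \<lfloor>x\<rfloor>"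
  have S2: "22002 \<le> S2" using s by (simp add: S2_def)
  have U: "0 < U" using A_bounds S2 by (simp add: U_def)
  have q: "0 < q" by (simp add: q_def)
  have q_le: "q \<le> 1 / 1000"
  proof -
    have "q \<le> (2 / 3) ^ 20" unfolding q_def using k by (intro power_decreasing) auto
    also have "\<dots> \<le> 1 / 1000" by (simp add: eval_nat_numeral)
    finally show ?thesis .
  qed
  have K: "0 < real K" using K_pos by simp
  have x1: "1 \<le> x" using k(2) K by (simp add: x_def q_def S2_def field_simps)
  have "real j \<le> x" "x < real j + 1" using x1 by (auto simp: j_def)
  moreover have "1 \<le> j" using x1 by (simp add: j_def le_nat_iff)
  ultimately have j: "1 \<le> j" "real j \<le> x" "x / 2 \<le> real j" by auto
  have "x \<le> 9 / 200 * (q * S2)"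
    using K_pos q S2 by (simp add: x_def divide_le_eq mult_le_cancel_left1)
  also have "\<dots> \<le> 9 / 200 * (1 / 1000 * S2)"
    using q_le S2 by (intro mult_left_mono mult_right_mono) auto
  finally have "10 * real j \<le> real s" using j S2 by (simp add: S2_def)
  then have j10: "j \<le> s div 10" by linarith
  obtain t where t: "t \<in> {s - j..<s}" "\<nu> t \<le> U * (19 / 2 + 139 / 25 * real K
      + (247 / 100 * real K + 31 / 50) * (1 + ln (S2 / 10 / real j)))"
    using gap_window[OF s j(1) j10 e z] unfolding U_def S2_def by blast
  have ts: "t < s" "1 \<le> t" "s - j \<le> t" using t(1) j10 s by auto
  have late: "9 / 10 * S2 \<le> real \<tau> + 2" if "t \<le> \<tau>" for \<tau>
  proof -
    have "real s \<le> real \<tau> + real j" using that ts by linarith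
    then show ?thesis using \<open>10 * real j \<le> real s\<close> by (simp add: S2_def)
  qed
  define W where "W = (\<Sum>i=t..<s. real K * \<gamma> i)"
  have W: "W \<le> q / 10"
  proof -
    have "W \<le> (\<Sum>i=t..<s. real K * (2 / (9 / 10 * S2)))"
      unfolding W_def \<gamma>_def using late S2 by (intro sum_mono mult_left_mono divide_left_mono) auto
    also have "\<dots> = real (s - t) * (real K * (2 / (9 / 10 * S2)))" by simp
    also have "\<dots> \<le> x * (real K * (2 / (9 / 10 * S2)))"
      using j ts S2 by (intro mult_right_mono) auto
    also have "\<dots> = q / 10" using K S2 by (simp add: x_def)
    finally show ?thesis .
  qed
  have W0: "0 \<le> W" unfolding W_def by (intro sum_nonneg) (auto simp: \<gamma>_def)
  \<comment> \<open>In expectation the objective rises only through noise. The rise is small enough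
    to be covered by rounding 19/2 up to 97/10.\<close>
  have drop: "e s - e t \<le> q * (U * (1 / 6))"
  proof -
    have "e s - e t = (\<Sum>i=t..<s. e (Suc i) - e i)"
      using sum_Suc_diff'[of t s e] ts by simp
    also have "\<dots> \<le> (\<Sum>i=t..<s. real K * \<gamma> i * (U * (5 / 3)))"
    proof (rule sum_mono)
      fix i assume i: "i \<in> {t..<s}"
      have "z1 i \<le> 3 / 2 * real K * \<gamma> i" using i ts by (intro z) auto
      also have "\<dots> = 3 * real K / (real i + 2)" by (simp add: \<gamma>_def)
      also have "\<dots> \<le> 3 * real K / (9 / 10 * S2)"
        using late[of i] i S2 by (intro divide_left_mono) auto
      also have "\<dots> \<le> (3 * (A / 2)) / (9 / 10 * S2)"
        using A_bounds S2 by (intro divide_right_mono) auto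
      also have "\<dots> = U * (5 / 3)" by (simp add: U_def)
      finally have "z1 i \<le> U * (5 / 3)" .
      then have "real K * \<gamma> i * z1 i \<le> real K * \<gamma> i * (U * (5 / 3))"
        by (intro mult_left_mono) (auto simp: \<gamma>_def)
      then show "e (Suc i) - e i \<le> real K * \<gamma> i * (U * (5 / 3))"
        using increase[of i] i s by simp
    qed
    also have "\<dots> = W * (U * (5 / 3))" by (simp only: W_def sum_distrib_right)
    also have "\<dots> \<le> q / 10 * (U * (5 / 3))" using W U by (intro mult_right_mono) auto
    finally show ?thesis by (simp add: mult.commute)
  qed
  have log: "1 + ln (S2 / 10 / real j) \<le> 5 / 2 + ln (real K) + 41 / 100 * real k"
  proof -
    \<comment> \<open>Rounding a window of length at least 1 down loses at most a factor 2. The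
      logarithm then splits into a constant, \<open>ln (real K)\<close> and a term linear in
      \<open>k\<close>.\<close>
    have "S2 / 10 / real j \<le> S2 / 10 / (x / 2)"
      using j x1 S2 by (intro divide_left_mono mult_pos_pos) auto
    also have "\<dots> = 40 / 9 * real K * (3 / 2) ^ k"
      using K S2 q by (simp add: x_def q_def power_divide)
    also have "\<dots> \<le> 89 / 20 * real K * (3 / 2) ^ k" using K by simp
    finally have "ln (S2 / 10 / real j) \<le> ln (89 / 20 * real K * (3 / 2) ^ k)"
      using j S2 by (intro ln_mono) auto
    also have "\<dots> = ln (89 / 20) + ln (real K) + real k * ln (3 / 2)"
    proof -
      have "ln (89 / 20 * real K * (3 / 2) ^ k) = ln (89 / 20 * real K) + ln ((3 / 2) ^ k)"
        using K by (intro ln_mult_pos) auto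
      moreover have "ln (89 / 20 * real K) = ln (89 / 20) + ln (real K)"
        using K by (intro ln_mult_pos) auto
      ultimately show ?thesis by (simp add: ln_realpow)
    qed
    also have "\<dots> \<le> 3 / 2 + ln (real K) + real k * (41 / 100)"
      using ln_bounds by (intro add_mono mult_left_mono) auto
    finally show ?thesis by simp
  qed
  define R where "R = 19 / 2 + 139 / 25 * real K
    + (247 / 100 * real K + 31 / 50) * (5 / 2 + ln (real K) + 41 / 100 * real k)"
  have \<nu>: "\<nu> t \<le> U * R"
  proof -
    have "19 / 2 + 139 / 25 * real K + (247 / 100 * real K + 31 / 50) * (1 + ln (S2 / 10 / real j)) \<le> R"
      unfolding R_def using log by (intro add_left_mono mult_left_mono) auto
    then have "U * (19 / 2 + 139 / 25 * real K + (247 / 100 * real K + 31 / 50) * (1 + ln (S2 / 10 / real j))) \<le> U * R"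
      using U by (intro mult_left_mono) auto
    with t(2) show ?thesis by simp
  qed
  have "\<phi> s k \<le> (e s - e t) + (W + q) * \<nu> t"
    unfolding W_def q_def using ts s by (intro \<phi>_le) auto
  also have "\<dots> \<le> q * (U * (1 / 6)) + (q / 10 + q) * (U * R)"
    using drop W W0 q \<nu> \<nu>_nonneg[of t] ts s by (intro add_mono mult_mono) auto
  also have "\<dots> = U * (q * (11 / 10 * (R + 5 / 33)))"
    by (simp add: field_simps)
  also have "\<dots> \<le> U * (q * (11 / 10 * (97 / 10 + 139 / 25 * real K
    + (247 / 100 * real K + 31 / 50) * (5 / 2 + ln (real K) + 41 / 100 * real k))))"
    unfolding R_def using U q by (intro mult_left_mono) auto
  finally show ?thesis by (simp only: U_def S2_def q_def)
qed

text \<open>The factor \<open>x\<close> costs at most a multiple of 2^l, and Bernoulli's inequality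
  absorbs the growth linear in \<open>l\<close> into (9/8)^l. Two additional scales per level
  contribute (4/9)^l, and 4/9 * 2 * 9/8 = 1.\<close>

lemma scale_budget:
  assumes K: "1 \<le> x" "x \<le> 9 / 8 * 2 ^ l"
  shows "(2 / 3) ^ (21 + 2 * l + i) * (11 / 10 * (97 / 10 + 139 / 25 * x
      + (247 / 100 * x + 31 / 50) * (5 / 2 + ln x + 41 / 100 * real (21 + 2 * l + i))))
    \<le> 221 / 1000000 * ((2 / 3) ^ i * (271 / 5 + 7 / 5 * real i))"
proof -
  define p where "p = (2::real) ^ l"
  have p: "1 \<le> p" by (simp add: p_def)
  define Y where "Y = 2247 / 200 + 38 / 25 * real l + 41 / 100 * real i"
  have "ln x \<le> ln (9 / 8 * 2 ^ l)" using K by (intro ln_mono) auto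
  also have "\<dots> = ln (9 / 8) + real l * ln 2" by (subst ln_mult_pos) (auto simp: ln_realpow)
  also have "\<dots> \<le> 1 / 8 + real l * (7 / 10)"
    using ln_bounds by (intro add_mono mult_left_mono) auto
  finally have Y: "5 / 2 + ln x + 41 / 100 * real (21 + 2 * l + i) \<le> Y"
    by (simp add: Y_def field_simps)
  have "97 / 10 + 139 / 25 * x + (247 / 100 * x + 31 / 50) * (5 / 2 + ln x + 41 / 100 * real (21 + 2 * l + i))
      \<le> 97 / 10 * p + 139 / 25 * (9 / 8 * p) + (247 / 100 * (9 / 8 * p) + 31 / 50 * p) * Y"
  proof (rule add_mono)
    show "97 / 10 + 139 / 25 * x \<le> 97 / 10 * p + 139 / 25 * (9 / 8 * p)"
    proof (rule add_mono)
      show "97 / 10 \<le> 97 / 10 * p" using p by simp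
      show "139 / 25 * x \<le> 139 / 25 * (9 / 8 * p)"
        using K(2) unfolding p_def by (rule mult_left_mono) simp
    qed
    show "(247 / 100 * x + 31 / 50) * (5 / 2 + ln x + 41 / 100 * real (21 + 2 * l + i))
        \<le> (247 / 100 * (9 / 8 * p) + 31 / 50 * p) * Y"
    proof (rule mult_mono[OF _ Y])
      show "247 / 100 * x + 31 / 50 \<le> 247 / 100 * (9 / 8 * p) + 31 / 50 * p"
      proof (rule add_mono)
        show "247 / 100 * x \<le> 247 / 100 * (9 / 8 * p)"
          using K(2) unfolding p_def by (rule mult_left_mono) simp
      qed (use p in simp)
    qed (use K p in auto)
  qed
  also have "\<dots> = p * (97 / 10 + 139 / 25 * (9 / 8) + (247 / 100 * (9 / 8) + 31 / 50) * Y)"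
    by (simp add: algebra_simps)
  also have "\<dots> \<le> p * (271 / 5 + 271 / 40 * real l + 7 / 5 * real i)"
  proof (rule mult_left_mono)
    show "97 / 10 + 139 / 25 * (9 / 8) + (247 / 100 * (9 / 8) + 31 / 50) * Y \<le> 271 / 5 + 271 / 40 * real l + 7 / 5 * real i"
    proof -
      have "97 / 10 + 139 / 25 * (9 / 8) + (247 / 100 * (9 / 8) + 31 / 50) * (2247 / 200 + 38 / 25 * u + 41 / 100 * v)
          \<le> 271 / 5 + 271 / 40 * u + 7 / 5 * v" if "0 \<le> u" "0 \<le> v" for u v :: real
        using that by (simp add: field_simps)
      then show ?thesis unfolding Y_def by simp
    qed
  qed (use p in simp)
  also have "\<dots> \<le> p * ((9 / 8) ^ l * (271 / 5 + 7 / 5 * real i))"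
  proof (rule mult_left_mono)
    have B: "1 + real l * (1 / 8) \<le> (1 + 1 / 8) ^ l" by (rule Bernoulli_inequality) simp
    have "271 / 5 + 271 / 40 * real l + 7 / 5 * real i \<le> (1 + real l * (1 / 8)) * (271 / 5 + 7 / 5 * real i)"
    proof -
      have "(1 + real l * (1 / 8)) * (271 / 5 + 7 / 5 * real i)
          = 271 / 5 + 271 / 40 * real l + 7 / 5 * real i + 7 / 40 * (real l * real i)"
        by (simp add: field_simps)
      then show ?thesis by simp
    qed
    also have "\<dots> \<le> (9 / 8) ^ l * (271 / 5 + 7 / 5 * real i)"
      using B by (intro mult_right_mono) auto
    finally show "271 / 5 + 271 / 40 * real l + 7 / 5 * real i \<le> (9 / 8) ^ l * (271 / 5 + 7 / 5 * real i)" .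
  qed (use p in simp)
  finally have bracket: "(2 / 3) ^ (21 + 2 * l + i) * (11 / 10 * (97 / 10 + 139 / 25 * x
      + (247 / 100 * x + 31 / 50) * (5 / 2 + ln x + 41 / 100 * real (21 + 2 * l + i))))
    \<le> (2 / 3) ^ (21 + 2 * l + i) * (11 / 10 * (p * ((9 / 8) ^ l * (271 / 5 + 7 / 5 * real i))))"
    by (intro mult_left_mono) auto
  have "(2 / 3 :: real) ^ (21 + 2 * l + i) = (2 / 3) ^ 21 * ((4 / 9) ^ l * (2 / 3) ^ i)"
    by (simp add: power_add power_mult power2_eq_square)
  then have "(2 / 3) ^ (21 + 2 * l + i) * (11 / 10 * (p * ((9 / 8) ^ l * (271 / 5 + 7 / 5 * real i))))
      = (2 / 3) ^ 21 * ((4 / 9) ^ l * (2 / 3) ^ i) * (11 / 10 * (p * ((9 / 8) ^ l * (271 / 5 + 7 / 5 * real i))))"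
    by (simp only:)
  also have "(2 / 3) ^ 21 * ((4 / 9) ^ l * (2 / 3) ^ i) * (11 / 10 * (p * ((9 / 8) ^ l * (271 / 5 + 7 / 5 * real i))))
      = ((2 / 3) ^ 21 * (11 / 10)) * (((4 / 9) ^ l * 2 ^ l * (9 / 8) ^ l) * ((2 / 3) ^ i * (271 / 5 + 7 / 5 * real i)))"
    by (simp only: p_def mult.assoc mult.left_commute mult.commute)
  also have "(4 / 9 :: real) ^ l * 2 ^ l * (9 / 8) ^ l = 1"
    by (simp flip: power_mult_distrib)
  also have "((2 / 3 :: real) ^ 21 * (11 / 10)) * (1 * ((2 / 3) ^ i * (271 / 5 + 7 / 5 * real i)))
      \<le> 221 / 1000000 * (1 * ((2 / 3) ^ i * (271 / 5 + 7 / 5 * real i)))"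
    by (intro mult_right_mono) (auto simp: eval_nat_numeral)
  finally show ?thesis by (intro order_trans[OF bracket]) (simp only: mult_1_left)
qed

lemma r_bound_large:
  assumes s: "s \<le> T"
    and e: "\<And>t. 1 \<le> t \<Longrightarrow> t \<le> s \<Longrightarrow> e t \<le> A / (real t + 2)"
    and z: "\<And>t. 1 \<le> t \<Longrightarrow> t < s \<Longrightarrow> z1 t \<le> 3 / 2 * real K * \<gamma> t"
    and large: "5 / 22 * A * (9 / 4) ^ (20 + 2 * level) < real s + 2"
  shows "r s \<le> c * A / (real s + 2)"
proof -
  define n where "n = 20 + 2 * level"
  define S2 where "S2 = real s + 2"
  define U where "U = A / S2"
  have big: "2512000 * A \<le> 5 / 22 * A * (9 / 4) ^ 20"
    using A_bounds by (simp add: eval_nat_numeral)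
  have "5 / 22 * A * (9 / 4) ^ 20 \<le> 5 / 22 * A * (9 / 4) ^ n"
    using A_bounds by (intro mult_left_mono power_increasing) (auto simp: n_def)
  then have S2A: "2512000 * A < S2" using large big by (simp add: S2_def n_def)
  have s_ge: "22000 \<le> s"
  proof -
    have "2512000 * 6 < S2" using S2A A_bounds by linarith
    then show ?thesis by (simp add: S2_def)
  qed
  have S2: "0 < S2" by (simp add: S2_def)
  have U: "0 < U" using A_bounds S2 by (simp add: U_def)
  have K: "0 < real K" using K_pos by simp
  have KA: "real K \<le> A / 2" using A_bounds by simp
  \<comment> \<open>\<open>?P N\<close> says that the window used at scale \<open>n + N\<close>
    would be shorter than one iteration. The last \<open>N\<close> without this property ends the
    range in which \<open>\<phi>_bound\<close> applies.\<close>
  let ?P = "\<lambda>N. 9 / 200 * ((2 / 3) ^ (n + N) * S2) < real K"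
  obtain N0 where "?P N0"
  proof -
    obtain N where "(2 / 3 :: real) ^ N < real K / S2"
      using real_arch_pow_inv[of "real K / S2" "2 / 3"] K S2 by auto
    moreover have "(2 / 3 :: real) ^ (n + N) \<le> (2 / 3) ^ N"
      by (intro power_decreasing) auto
    ultimately have "(2 / 3) ^ (n + N) < real K / S2" by linarith
    then have "(2 / 3) ^ (n + N) * S2 < real K" using S2 by (simp add: field_simps)
    moreover have "0 \<le> (2 / 3) ^ (n + N) * S2" using S2 by simp
    ultimately show ?thesis by (intro that[of N]) linarith
  qed
  moreover have "\<not> ?P 0"
  proof -
    have "real K \<le> 9 / 200 * ((2 / 3) ^ n * (5 / 22 * A * (9 / 4) ^ n))"
    proof -
      have "(2 / 3 :: real) ^ n * (5 / 22 * A * (9 / 4) ^ n) = 5 / 22 * A * (3 / 2) ^ n"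
        by (simp add: power_divide field_simps flip: power_mult_distrib)
      moreover have "(1000 :: real) \<le> (3 / 2) ^ n"
      proof -
        have "(1000::real) \<le> (3 / 2) ^ 20" by (simp add: eval_nat_numeral)
        also have "\<dots> \<le> (3 / 2) ^ n" by (intro power_increasing) (auto simp: n_def)
        finally show ?thesis .
      qed
      then have "5 / 22 * A * 1000 \<le> 5 / 22 * A * (3 / 2) ^ n"
        using A_bounds by (intro mult_left_mono) auto
      ultimately show ?thesis using KA A_bounds by linarith
    qed
    also have "\<dots> \<le> 9 / 200 * ((2 / 3) ^ n * S2)"
      using large by (intro mult_left_mono) (auto simp: S2_def n_def)
    finally show ?thesis by simp
  qed
  ultimately obtain N where N: "\<not> ?P N" "?P (Suc N)"
    using ex_least_nat_less[of ?P N0] by blast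
  have tail: "\<phi> s (n + Suc i) \<le> U * (221 / 1000000 * ((2 / 3) ^ i * (271 / 5 + 7 / 5 * real i)))" if "i < N" for i
  proof -
    have "(2 / 3 :: real) ^ (n + N) \<le> (2 / 3) ^ (n + Suc i)" using that by (intro power_decreasing) auto
    then have "9 / 200 * ((2 / 3) ^ (n + N) * S2) \<le> 9 / 200 * ((2 / 3) ^ (n + Suc i) * S2)"
      using S2 by (intro mult_left_mono mult_right_mono) auto
    from order_trans[OF leI[OF N(1)] this]
    have kK: "real K \<le> 9 / 200 * ((2 / 3) ^ (n + Suc i) * (real s + 2))"
      by (simp only: S2_def)
    have "\<phi> s (n + Suc i) \<le> U * ((2 / 3) ^ (n + Suc i) * (11 / 10 *
        (97 / 10 + 139 / 25 * real K + (247 / 100 * real K + 31 / 50) * (5 / 2 + ln (real K) + 41 / 100 * real (n + Suc i)))))"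
      unfolding U_def S2_def by (rule \<phi>_bound[OF s s_ge e z _ kK]) (auto simp: n_def)
    also have "\<dots> \<le> U * (221 / 1000000 * ((2 / 3) ^ i * (271 / 5 + 7 / 5 * real i)))"
    proof -
      have idx: "n + Suc i = 21 + 2 * level + i" by (simp add: n_def)
      show ?thesis
        unfolding idx using U K_pos level_upper by (intro mult_left_mono scale_budget) auto
    qed
    finally show ?thesis .
  qed
  have sum: "(\<Sum>i<N. (5 / 4) ^ i * (\<phi> s (n + Suc i) / 2)) \<le> U * (203 / 5000)"
  proof -
    have "(\<Sum>i<N. (5 / 4) ^ i * (\<phi> s (n + Suc i) / 2))
        \<le> (\<Sum>i<N. (U * (221 / 2000000)) * ((5 / 6) ^ i * (271 / 5 + 7 / 5 * real i)))"
    proof (rule sum_mono)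
      fix i assume "i \<in> {..<N}"
      then have "(5 / 4) ^ i * (\<phi> s (n + Suc i) / 2)
          \<le> (5 / 4) ^ i * (U * (221 / 1000000 * ((2 / 3) ^ i * (271 / 5 + 7 / 5 * real i))) / 2)"
        using tail[of i] by (intro mult_left_mono divide_right_mono) auto
      also have "\<dots> = (U * (221 / 2000000)) * (((5 / 4) ^ i * (2 / 3) ^ i) * (271 / 5 + 7 / 5 * real i))"
        by simp
      also have "(5 / 4 :: real) ^ i * (2 / 3) ^ i = (5 / 6) ^ i"
        by (simp flip: power_mult_distrib)
      finally show "(5 / 4) ^ i * (\<phi> s (n + Suc i) / 2)
          \<le> (U * (221 / 2000000)) * ((5 / 6) ^ i * (271 / 5 + 7 / 5 * real i))" .
    qed
    also have "\<dots> = (U * (221 / 2000000)) * (\<Sum>i<N. (5 / 6) ^ i * (271 / 5 + 7 / 5 * real i))"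
      by (simp only: sum_distrib_left)
    also have "\<dots> \<le> (U * (221 / 2000000)) * (6 * (271 / 5) + 30 * (7 / 5))"
      using U by (intro mult_left_mono sum_geometric_weighted) auto
    also have "\<dots> \<le> U * (203 / 5000)" using U by simp
    finally show ?thesis .
  qed
  \<comment> \<open>Beyond the last usable scale the Lipschitz bound is of order (K/s)^2, which is
    negligible against A/s for such large \<open>s\<close>. The factor is 1111 = 11 * 101.\<close>
  have last: "1111 * (4 / 9) ^ (n + N) \<le> U * (6 / 25)"
  proof -
    have "(2 / 3) ^ (n + N) * S2 < 100 / 3 * real K" using N(2) by (simp add: field_simps)
    then have "((2 / 3) ^ (n + N) * S2)\<^sup>2 \<le> (100 / 3 * real K)\<^sup>2"
      using S2 by (intro power_mono) auto
    also have "\<dots> \<le> (100 / 3 * (A / 2))\<^sup>2" using KA by (intro power_mono mult_left_mono) auto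
    also have "(100 / 3 * (A / 2))\<^sup>2 = 2500 / 9 * A\<^sup>2" by (simp add: power2_eq_square)
    also have "((2 / 3) ^ (n + N) * S2)\<^sup>2 = (4 / 9) ^ (n + N) * S2\<^sup>2"
    proof -
      have "((2 / 3 :: real) ^ (n + N))\<^sup>2 = (4 / 9) ^ (n + N)"
        by (simp add: power2_eq_square flip: power_mult_distrib)
      then show ?thesis by (simp only: power_mult_distrib)
    qed
    finally have "(4 / 9) ^ (n + N) * S2\<^sup>2 \<le> 2500 / 9 * A\<^sup>2" .
    then have "1111 * ((4 / 9) ^ (n + N) * S2\<^sup>2) \<le> 1111 * (2500 / 9 * A\<^sup>2)"
      by (rule mult_left_mono) simp
    also have "\<dots> = 1111 * (2500 / 9) * (A * A)"
      by (simp add: power2_eq_square)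
    also have "\<dots> \<le> 6 / 25 * (A * (2512000 * A))" using A_bounds by simp
    also have "\<dots> \<le> 6 / 25 * (A * S2)"
      using S2A A_bounds by (intro mult_left_mono) auto
    finally have "1111 * (4 / 9) ^ (n + N) * S2\<^sup>2 \<le> 6 / 25 * A * S2" by simp
    then show ?thesis using S2 by (simp add: U_def power2_eq_square field_simps)
  qed
  have "r s \<le> 11 / 10 * (real n / 2 * e s)
      + 11 * (101 / 100 * (5 * (\<Sum>i<N. (5 / 4) ^ i * (\<phi> s (n + Suc i) / 2))) + 101 * (4 / 9) ^ (n + N))"
    by (rule r_large[OF s])
  also have "\<dots> \<le> 11 / 10 * (real n / 2 * U) + 11 * (101 / 100 * (5 * (U * (203 / 5000)))) + U * (6 / 25)"
  proof -
    have "real n / 2 * e s \<le> real n / 2 * U"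
      using e[of s] s_ge by (intro mult_left_mono) (auto simp: U_def S2_def)
    then show ?thesis using sum last by (simp add: algebra_simps)
  qed
  \<comment> \<open>The primal gap takes 11 + 11/10 \<open>level\<close>. The fine scales and the
    remainder take 11 * 101/100 * 5 * 203/5000 + 6/25, just below the 5/2 that \<open>c\<close>
    reserves.\<close>
  also have "\<dots> \<le> c * U"
  proof -
    have "11 / 10 * (real n / 2 * U) = 11 * U + 11 / 10 * (U * real level)"
      by (simp add: n_def field_simps)
    moreover have "c * U = 27 / 2 * U + 11 / 10 * (U * real level)"
      by (simp add: c_def field_simps)
    ultimately show ?thesis using U by linarith
  qed
  finally show ?thesis by (simp add: U_def S2_def)
qed

text \<open>The case distinction is made where 11 (4/9)^n equals 5/2 A/(s+2). Before that point the
  Lipschitz bound already pays for everything beyond the first n scales, without any knowledge of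
  past gaps.\<close>

lemma r_bound:
  assumes s: "s \<le> T" "1 \<le> s"
    and e: "\<And>t. 1 \<le> t \<Longrightarrow> t \<le> s \<Longrightarrow> e t \<le> A / (real t + 2)"
    and z: "\<And>t. 1 \<le> t \<Longrightarrow> t < s \<Longrightarrow> z1 t \<le> 3 / 2 * real K * \<gamma> t"
  shows "r s \<le> c * A / (real s + 2)"
proof (cases "5 / 22 * A * (9 / 4) ^ (20 + 2 * level) < real s + 2")
  case True
  with r_bound_large[OF s(1) e z] show ?thesis by blast
next
  case False
  define n where "n = 20 + 2 * level"
  define U where "U = A / (real s + 2)"
  have "(4 / 9) ^ n * (real s + 2) \<le> (4 / 9) ^ n * (5 / 22 * A * (9 / 4) ^ n)"
    using False by (intro mult_left_mono) (auto simp: n_def)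
  also have "\<dots> = 5 / 22 * A"
    by (simp add: power_divide field_simps)
  finally have "11 * (4 / 9) ^ n \<le> 5 / 2 * U"
    by (simp add: U_def field_simps)
  moreover have "real n / 2 * e s \<le> real n / 2 * U"
    using e[of s] s by (intro mult_left_mono) (auto simp: U_def)
  moreover have "11 / 10 * (real n / 2 * U) + 5 / 2 * U = c * U"
    by (simp add: n_def c_def field_simps)
  ultimately have "r s \<le> c * U" using r_small[OF s(1), of n] by linarith
  then show ?thesis by (simp add: U_def)
qed

text \<open>
  For large \<open>K\<close>, \<open>\<mu> = 23/20 * K / x\<close> in the cubic bound nearly minimizes the total charge, where \<open>x\<close>
  is the size of the noise variance.
\<close>

lemma noise_budget:
  obtains \<theta> \<omega> where "1 / 2 \<le> \<theta>" "\<theta> \<le> A" "\<theta> * ((5 + 5 / 2 * c) / 12) + \<omega> \<le> 2 * real K"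
    "\<And>t. t < T \<Longrightarrow> e (Suc t) \<le> e t - \<gamma> t * d t + (\<gamma> t)\<^sup>2 * \<kappa> / 2 + \<gamma> t * z1 t
        + (\<theta> - 1 / 2) * z2 t + \<omega> / (real t + 2)\<^sup>2"
proof (cases "level \<le> 3")
  case True
  show ?thesis
  \<comment> \<open>Up to level 3 the variance factor is below 4, so even K/2 units of variance cost
    at most 2K.\<close>
  proof (rule that[of "real K / 2" 0])
    have "(5 + 5 / 2 * c) / 12 \<le> 4" using True by (simp add: c_def)
    then have "real K / 2 * ((5 + 5 / 2 * c) / 12) \<le> real K / 2 * 4" by (intro mult_left_mono) auto
    then show "real K / 2 * ((5 + 5 / 2 * c) / 12) + 0 \<le> 2 * real K" by simp
    show "e (Suc t) \<le> e t - \<gamma> t * d t + (\<gamma> t)\<^sup>2 * \<kappa> / 2 + \<gamma> t * z1 t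
        + (real K / 2 - 1 / 2) * z2 t + 0 / (real t + 2)\<^sup>2" if "t < T" for t
      using main_small[OF that] by (simp add: field_simps)
  qed (use K_pos A_bounds in auto)
next
  case False
  define x where "x = (5 + 5 / 2 * c) / 12"
  have x: "x = (155 / 4 + 11 / 4 * real level) / 12"
    by (simp add: x_def c_def field_simps)
  have x0: "4 \<le> x" using False by (simp add: x)
  have Kl: "9 / 16 * 2 ^ level < real K" using level_lower False by auto
  define m where "m = level - 4"
  have lev: "level = m + 4" using False by (simp add: m_def)
  \<comment> \<open>At m = 0 the strict inequality 9 < K gives 10 by integrality, which the two
    bounds on \<open>x\<close> need there. For larger \<open>m\<close> the growth of 2^m makes 9 *
    2^m sufficient.\<close>
  have Kbound: "10 * 2 ^ m \<le> real K \<or> (1 \<le> m \<and> 9 * 2 ^ m \<le> real K)"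
  proof (cases "m = 0")
    case True
    then have "9 < real K" using Kl lev by simp
    then have "10 \<le> K" by linarith
    then show ?thesis using True by simp
  next
    case False
    then show ?thesis using Kl lev by (auto simp: power_add)
  qed
  have x_m: "x = (199 / 4 + 11 / 4 * real m) / 12" by (simp add: x lev)
  have B: "1 + real m * (1 / 10) \<le> (1 + 1 / 10) ^ m" by (rule Bernoulli_inequality) simp
  have xm: "x \<le> 199 / 48 * (11 / 10) ^ m"
    using B by (simp add: x_m)
  have x1: "x \<le> 199 / 480 * real K"
  proof (cases "m = 0")
    case True
    then show ?thesis using Kbound by (simp add: x_m)
  next
    case False
    have "x \<le> 199 / 480 * (9 * 2 ^ m)"
    proof -
      have "2 * (1 + real (m - 1)) \<le> 2 * 2 ^ (m - 1)" using two_power_ge[of "m - 1"] by simp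
      then have "2 * real m \<le> 2 ^ m" using False by (cases m) auto
      then show ?thesis using False by (simp add: x_m)
    qed
    also have "\<dots> \<le> 199 / 480 * real K"
    proof -
      have "(0::real) \<le> 2 ^ m" by simp
      then have "9 * 2 ^ m \<le> real K" using Kbound by linarith
      then show ?thesis by simp
    qed
    finally show ?thesis .
  qed
  have x2: "x\<^sup>2 \<le> 172 / 100 * real K"
  proof (cases "m = 0")
    case True
    then show ?thesis using Kbound by (simp add: x_m power2_eq_square)
  next
    case False
    have "x\<^sup>2 \<le> (199 / 48 * (11 / 10) ^ m)\<^sup>2" using xm x0 by (intro power_mono) auto
    also have "\<dots> = (199 / 48)\<^sup>2 * ((121 / 100) ^ (m - 1) * (121 / 100))"
      using False by (cases m) (simp_all add: power_mult_distrib power2_eq_square field_simps flip: power_mult_distrib)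
    also have "\<dots> \<le> (199 / 48)\<^sup>2 * (2 ^ (m - 1) * (121 / 100))"
      by (intro mult_left_mono mult_right_mono power_mono) auto
    also have "\<dots> = (199 / 48)\<^sup>2 * (121 / 200) * 2 ^ m"
      using False by (cases m) simp_all
    also have "\<dots> \<le> 172 / 100 * (9 * 2 ^ m)" by (simp add: power2_eq_square)
    also have "\<dots> \<le> 172 / 100 * real K"
    proof -
      have "(0::real) \<le> 2 ^ m" by simp
      then have "9 * 2 ^ m \<le> real K" using Kbound by linarith
      then show ?thesis by simp
    qed
    finally show ?thesis .
  qed
  define \<mu> where "\<mu> = 23 / 20 * real K / x"
  have K0: "0 < real K" using K_pos by simp
  have \<mu>: "0 < \<mu>" using K0 x0 by (simp add: \<mu>_def)
  define \<omega> where "\<omega> = 4 * (real K)\<^sup>2 / (3 * \<mu> ^ 3)"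
  show ?thesis
  proof (rule that[of "1 / 2 + \<mu>" \<omega>])
    show "1 / 2 \<le> 1 / 2 + \<mu>" using \<mu> by simp
    have "\<mu> \<le> 23 / 20 * real K / 4" unfolding \<mu>_def using x0 K0 by (intro divide_left_mono) auto
    then show "1 / 2 + \<mu> \<le> A" using A_bounds K_pos by simp
    have "\<omega> = 32000 / 36501 * (x * x\<^sup>2) / real K"
      using K0 x0 by (simp add: \<omega>_def \<mu>_def power2_eq_square power3_eq_cube field_simps)
    also have "\<dots> \<le> 32000 / 36501 * (x * (172 / 100 * real K)) / real K"
      using x2 x0 K0 by (intro divide_right_mono mult_left_mono) auto
    also have "\<dots> = 32000 / 36501 * (172 / 100) * x" using K0 by simp
    finally have "(1 / 2 + \<mu>) * x + \<omega> \<le> (1 / 2 + 32000 / 36501 * (172 / 100)) * x + 23 / 20 * real K"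
      using x0 by (simp add: \<mu>_def algebra_simps)
    also have "(1 / 2 + 32000 / 36501 * (172 / 100)) * x \<le> (1 / 2 + 32000 / 36501 * (172 / 100)) * (199 / 480 * real K)"
      using x1 by (intro mult_left_mono) auto
    also have "\<dots> + 23 / 20 * real K \<le> 2 * real K" using K0 by simp
    finally show "(1 / 2 + \<mu>) * ((5 + 5 / 2 * c) / 12) + \<omega> \<le> 2 * real K"
      by (simp add: x_def)
    show "e (Suc t) \<le> e t - \<gamma> t * d t + (\<gamma> t)\<^sup>2 * \<kappa> / 2 + \<gamma> t * z1 t
        + (1 / 2 + \<mu> - 1 / 2) * z2 t + \<omega> / (real t + 2)\<^sup>2" if "t < T" for t
    proof -
      have "(real K)\<^sup>2 * (\<gamma> t)\<^sup>2 / (3 * \<mu> ^ 3) = \<omega> / (real t + 2)\<^sup>2"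
        by (simp add: \<gamma>_def \<omega>_def power_divide mult.commute mult.left_commute)
      then show ?thesis using main_large[OF that \<mu>] by simp
    qed
  qed
qed

section \<open>Closing the induction\<close>

lemma e_step:
  assumes t: "t < T" and e: "1 \<le> t \<Longrightarrow> e t \<le> A / (real t + 2)"
    and r: "t \<notin> S \<Longrightarrow> r (\<sigma> t) \<le> c * A / (real (\<sigma> t) + 2)"
  shows "e (Suc t) \<le> A / (real (Suc t) + 2)"
proof (cases "t = 0")
  \<comment> \<open>The first step size is 1, so \<open>e 0\<close> is cancelled by
    \<open>d 0\<close>, and 0 is a snapshot. The initial gap drops out.\<close>
  case True
  then have z2: "z2 0 \<le> 0" using no_noise t snapshot(4) by simp
  have "z1 0 \<le> z2 0 / (2 * 1) + 1 / 2" using z1_le[of 0 1] t True by simp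
  moreover have "(real K - 1) * z2 0 / 2 \<le> 0"
    using z2 K_pos by (simp add: mult_nonneg_nonpos)
  moreover have "e 0 \<le> d 0" using d_ge[of 0] by simp
  ultimately have "e (Suc 0) \<le> \<kappa> / 2 + 1 / 2"
    using main_small[of 0] t True z2 by (simp add: \<gamma>_def)
  also have "\<dots> \<le> A / 3" using \<kappa>_ge K_pos by (simp add: A_def)
  finally show ?thesis using True by simp
next
  case False
  define a where "a = real t + 2"
  have a: "3 \<le> a" using False by (simp add: a_def)
  obtain \<theta> \<omega> where \<theta>: "1 / 2 \<le> \<theta>" "\<theta> \<le> A" "\<theta> * ((5 + 5 / 2 * c) / 12) + \<omega> \<le> 2 * real K"
    and step: "e (Suc t) \<le> e t - \<gamma> t * d t + (\<gamma> t)\<^sup>2 * \<kappa> / 2 + \<gamma> t * z1 t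
        + (\<theta> - 1 / 2) * z2 t + \<omega> / (real t + 2)\<^sup>2"
    using noise_budget t by metis
  have d: "e t \<le> d t" "0 \<le> e t" using d_ge e_nonneg t by auto
  have cA: "0 < c * A" using c_pos A_bounds by simp
  \<comment> \<open>The share of \<open>d t\<close> is kept separate: divided by 12A(t+2) and
    multiplied by \<theta> <= A, it is only a fraction of the contraction term 2 d/(t+2).\<close>
  define Z where "Z = (5 * d t + 5 / 2 * (c * A / a)) / (12 * A * a)"
  have Z: "z2 t \<le> Z"
  proof (cases "t \<in> S")
    case True
    then have "z2 t \<le> 0" using no_noise t by simp
    also have "0 \<le> Z" using d cA a A_bounds by (simp add: Z_def)
    finally show ?thesis .
  next
    case False
    have s: "a / 2 \<le> real (\<sigma> t) + 2" using snapshot(3)[OF False] by (simp add: a_def)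
    have "c * A / (real (\<sigma> t) + 2) \<le> c * A / (a / 2)"
      using s a cA by (intro divide_left_mono) auto
    also have "c * A / (a / 2) = 2 * (c * A / a)" by simp
    finally have "5 / 4 * r (\<sigma> t) \<le> 5 / 4 * (2 * (c * A / a))"
      by (intro mult_left_mono order_trans[OF r[OF False]]) simp_all
    also have "\<dots> = 5 / 2 * (c * A / a)" by simp
    finally have num: "5 * d t + 5 / 4 * r (\<sigma> t) \<le> 5 * d t + 5 / 2 * (c * A / a)"
      by (rule add_left_mono)
    have b: "0 < 12 * A * a" "12 * A * a \<le> b t" "0 < b t"
    proof -
      show "0 < 12 * A * a" "12 * A * a \<le> b t" using b_ge[of t] a A_bounds by (auto simp: a_def)
      then show "0 < b t" by linarith
    qed
    have "z2 t \<le> (5 * d t + 5 / 2 * (c * A / a)) / b t"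
      using noise[OF t False] divide_right_mono[OF num, of "b t"] b by simp
    also have "\<dots> \<le> Z"
      unfolding Z_def using a b d cA A_bounds by (intro divide_left_mono mult_pos_pos) auto
    finally show ?thesis .
  qed
  have "\<gamma> t * z1 t \<le> \<gamma> t * (z2 t / (2 * \<gamma> t) + \<gamma> t / 2)"
    using z1_le[OF t \<gamma>_pos[of t]] \<gamma>_pos[of t] by (intro mult_left_mono) auto
  also have "\<dots> = z2 t / 2 + (\<gamma> t)\<^sup>2 / 2"
    using \<gamma>_pos[of t] by (simp add: field_simps power2_eq_square)
  finally have "\<gamma> t * z1 t + (\<theta> - 1 / 2) * z2 t \<le> \<theta> * z2 t + (\<gamma> t)\<^sup>2 / 2"
    by (simp add: algebra_simps)
  also have "\<dots> \<le> \<theta> * Z + (\<gamma> t)\<^sup>2 / 2"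
    using Z \<theta> by (simp add: mult_left_mono)
  finally have "e (Suc t) \<le> e t - \<gamma> t * d t + (\<gamma> t)\<^sup>2 * \<kappa> / 2 + (\<theta> * Z + (\<gamma> t)\<^sup>2 / 2) + \<omega> / a\<^sup>2"
    using step by (simp add: a_def)
  also have "\<dots> = e t - (2 - 5 * \<theta> / (12 * A)) / a * d t
      + (\<theta> * (5 / 2 * c / 12) + 2 * \<kappa> + 2 + \<omega>) / a\<^sup>2"
  proof -
    have g: "\<gamma> t = 2 / a" by (simp add: \<gamma>_def a_def)
    show ?thesis unfolding g Z_def using a A_bounds by (simp add: power2_eq_square field_simps)
  qed
  \<comment> \<open>After absorbing the noise the coefficient of \<open>d t\<close> is still
    nonpositive, so \<open>d t\<close> may be lowered to \<open>e t\<close>.\<close>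
  also have "\<dots> \<le> e t - (2 - 5 * \<theta> / (12 * A)) / a * e t
      + (\<theta> * (5 / 2 * c / 12) + 2 * \<kappa> + 2 + \<omega>) / a\<^sup>2"
  proof -
    have "5 * \<theta> / (12 * A) \<le> 2" using \<theta>(2) A_bounds by (simp add: divide_le_eq)
    then have "(2 - 5 * \<theta> / (12 * A)) / a * e t \<le> (2 - 5 * \<theta> / (12 * A)) / a * d t"
      using d a by (intro mult_left_mono) auto
    then show ?thesis by simp
  qed
  also have "e t - (2 - 5 * \<theta> / (12 * A)) / a * e t = (1 - (2 - 5 * \<theta> / (12 * A)) / a) * e t"
    by (simp add: algebra_simps)
  also have "\<dots> \<le> (1 - (2 - 5 * \<theta> / (12 * A)) / a) * (A / a)"
  proof (rule mult_left_mono)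
    have "(2 - 5 * \<theta> / (12 * A)) \<le> a" using \<theta>(1) a A_bounds
      by (smt (verit) divide_nonneg_nonneg)
    then show "0 \<le> 1 - (2 - 5 * \<theta> / (12 * A)) / a" using a by (simp add: divide_le_eq)
    show "e t \<le> A / a" using e False by (simp add: a_def)
  qed
  also have "\<dots> + (\<theta> * (5 / 2 * c / 12) + 2 * \<kappa> + 2 + \<omega>) / a\<^sup>2
      = A / a - 2 * A / a\<^sup>2 + (\<theta> * ((5 + 5 / 2 * c) / 12) + \<omega> + 2 * \<kappa> + 2) / a\<^sup>2"
    using a A_bounds by (simp add: power2_eq_square field_simps)
  \<comment> \<open>The budget closes: 2K for the noise, 2\<kappa> for the curvature and 2 from
    Young's inequality add up to \<open>A\<close>.\<close>
  also have "\<dots> \<le> A / a - 2 * A / a\<^sup>2 + A / a\<^sup>2"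
    using \<theta>(3) by (intro add_left_mono divide_right_mono) (auto simp: A_def)
  also have "\<dots> = A * ((a - 1) / a\<^sup>2)"
    using a by (simp add: power2_eq_square field_simps)
  also have "\<dots> \<le> A * (1 / (a + 1))"
    using a A_bounds by (intro mult_left_mono) (auto simp: power2_eq_square field_simps)
  finally show ?thesis by (simp add: a_def add.commute)
qed

text \<open>\<open>e t\<close> uses \<open>r\<close> at an earlier snapshot, while
  \<open>r t\<close> uses \<open>e\<close> up to \<open>t\<close> and \<open>z1\<close> before
  \<open>t\<close>, which uses \<open>r\<close> again. The bounds are never invoked at index 0: it
  is a snapshot itself, and the snapshots of all other sampled iterations are at least 1.\<close>

theorem e_bound:
  assumes "1 \<le> t" "t \<le> T"
  shows "e t \<le> A / (real t + 2)"
proof -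
  have "e t \<le> A / (real t + 2) \<and> r t \<le> c * A / (real t + 2)" if "1 \<le> t" "t \<le> T" for t
    using that
  proof (induction t rule: less_induct)
    case (less t)
    have IH: "e i \<le> A / (real i + 2)" "r i \<le> c * A / (real i + 2)" if "1 \<le> i" "i < t" for i
      using less that by auto
    have z: "z1 i \<le> 3 / 2 * real K * \<gamma> i" if "1 \<le> i" "i < t" for i
      using that less.prems snapshot(1-3)[of i] by (intro z1_bound IH) auto
    obtain i where i: "t = Suc i" using less.prems by (cases t) auto
    have e: "e t \<le> A / (real t + 2)"
      unfolding i using i less.prems snapshot(1-3)[of i] by (intro e_step IH) auto
    have "r t \<le> c * A / (real t + 2)"
    proof (rule r_bound)
      show "e j \<le> A / (real j + 2)" if "1 \<le> j" "j \<le> t" for j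
        using that e IH by (cases "j = t") auto
    qed (use less.prems z in auto)
    with e show ?case by simp
  qed
  with assms show ?thesis by blast
qed

end

section \<open>Stochastic iterations\<close>

text \<open>Continuity is available on \<open>C\<close> only; extension by zero outside the closed
  set is Borel measurable.\<close>

lemma measurable_continuous_on_comp:
  fixes h :: "'a::euclidean_space \<Rightarrow> 'b::{real_normed_vector, second_countable_topology}"
  assumes "continuous_on C h" "closed C" "X \<in> borel_measurable M" "\<And>\<omega>. \<omega> \<in> space M \<Longrightarrow> X \<omega> \<in> C"
  shows "(\<lambda>\<omega>. h (X \<omega>)) \<in> borel_measurable M"
proof -
  have "(\<lambda>x. indicator C x *\<^sub>R h x) \<in> borel_measurable borel"
    using assms(1,2) by (intro borel_measurable_continuous_on_indicator) auto
  then have "(\<lambda>\<omega>. indicator C (X \<omega>) *\<^sub>R h (X \<omega>)) \<in> borel_measurable M"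
    using assms(3) by (rule measurable_compose[rotated])
  then show ?thesis
    using assms(4) by (subst measurable_cong[where g="\<lambda>\<omega>. indicator C (X \<omega>) *\<^sub>R h (X \<omega>)"]) auto
qed

context smooth_family
begin

lemma continuous_on_F: "continuous_on C F"
proof -
  obtain B where B: "0 \<le> B" "\<And>x. x \<in> C \<Longrightarrow> norm (dF x) \<le> B"
    using dF_bounded by blast
  have *: "F x - F y \<le> B * norm (x - y)" if "x \<in> C" "y \<in> C" for x y
  proof -
    have "dF x \<bullet> (x - y) \<le> norm (dF x) * norm (x - y)" by (rule norm_cauchy_schwarz)
    also have "\<dots> \<le> B * norm (x - y)" using B(2)[OF that(1)] by (intro mult_right_mono) auto
    finally show ?thesis using F_tangent[OF that] by (simp add: inner_diff_right)
  qed
  have "\<bar>F x - F y\<bar> \<le> B * norm (x - y)" if "x \<in> C" "y \<in> C" for x y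
    using *[OF that] *[OF that(2,1)] by (simp add: norm_minus_commute abs_le_iff)
  then have "B-lipschitz_on C F"
    using B(1) by (simp add: lipschitz_on_def dist_norm)
  then show ?thesis by (rule lipschitz_on_continuous_on)
qed

lemma continuous_on_df: "i \<in> {1..m} \<Longrightarrow> continuous_on C (df i)"
proof -
  assume "i \<in> {1..m}"
  then have "L-lipschitz_on C (df i)"
    using L_pos lip by (auto simp: lipschitz_on_def dist_norm)
  then show ?thesis by (rule lipschitz_on_continuous_on)
qed

lemma continuous_on_P: "continuous_on A h \<Longrightarrow> continuous_on A (\<lambda>x. P (h x))"
  by (rule bounded_linear.continuous_on[OF P_linear[unfolded linear_conv_bounded_linear]])

lemma continuous_on_q: "continuous_on C (\<lambda>x. q x y)"
  unfolding q_def divide_inverse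
  by (rule continuous_on_mult_right, rule continuous_on_sum, rule continuous_on_power, rule continuous_on_norm,
      rule continuous_on_P, rule continuous_on_diff[OF continuous_on_df continuous_on_const])

lemma q_bound: "x \<in> C \<Longrightarrow> y \<in> C \<Longrightarrow> q x y \<le> L\<^sup>2 * D\<^sup>2"
  by (rule order_trans[OF q_le_dist]) (auto intro!: mult_left_mono power_mono diam)

end

text \<open>Interface between sampling and rates. The iterates and the tangential noise are the
  random variables; the other data of an iteration appear pathwise behind an existential, so the
  geometric lemmas apply to each outcome.\<close>

locale svrf_process = smooth_family C m f df L D P + prob_space M
  for C :: "'a::euclidean_space set" and m f df L D P and M :: "'w measure" +
  fixes K T :: nat and \<kappa> :: real and b :: "nat \<Rightarrow> real" and \<sigma> :: "nat \<Rightarrow> nat" and S :: "nat set"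
    and X \<Xi> :: "nat \<Rightarrow> 'w \<Rightarrow> 'a" and xo :: 'a and Bz :: "nat \<Rightarrow> real"
  assumes D_pos: "0 < D" and K_pos: "1 \<le> K" and \<kappa>_ge: "1 \<le> \<kappa>"
    and xo: "xo \<in> C" "\<And>u. u \<in> C \<Longrightarrow> F xo \<le> F u"
    and X_measurable: "t \<le> T \<Longrightarrow> X t \<in> borel_measurable M"
    and X_in: "t \<le> T \<Longrightarrow> \<omega> \<in> space M \<Longrightarrow> X t \<omega> \<in> C"
    and \<Xi>_measurable: "t < T \<Longrightarrow> (\<lambda>\<omega>. P (\<Xi> t \<omega>)) \<in> borel_measurable M"
    and \<Xi>_bounded: "t < T \<Longrightarrow> \<omega> \<in> space M \<Longrightarrow> norm (P (\<Xi> t \<omega>)) \<le> Bz t"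
    and step: "t < T \<Longrightarrow> \<omega> \<in> space M \<Longrightarrow> \<exists>g A y v. outer_step C m f df L D P (X t \<omega>) g A \<kappa>
      (2 / (real t + 2)) K y v \<and> g - dF (X t \<omega>) = \<Xi> t \<omega> \<and> X (Suc t) \<omega> = y K"
    and unbiased: "t < T \<Longrightarrow> expectation (\<lambda>\<omega>. P (\<Xi> t \<omega>) \<bullet> (X t \<omega> - xo)) = 0"
    and variance: "t < T \<Longrightarrow> t \<notin> S \<Longrightarrow>
      expectation (\<lambda>\<omega>. (norm (P (\<Xi> t \<omega>)))\<^sup>2) \<le> expectation (\<lambda>\<omega>. q (X t \<omega>) (X (\<sigma> t) \<omega>)) / b t"
    and exact: "t < T \<Longrightarrow> t \<in> S \<Longrightarrow> \<omega> \<in> space M \<Longrightarrow> P (\<Xi> t \<omega>) = 0"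
    and snapshot: "t \<notin> S \<Longrightarrow> 1 \<le> \<sigma> t" "t \<notin> S \<Longrightarrow> \<sigma> t \<le> t" "t \<notin> S \<Longrightarrow> t + 2 \<le> 2 * (\<sigma> t + 2)"
      "0 \<in> S"
    and b_ge: "12 * (2 * (real K + 1 + \<kappa>)) * (real t + 2) \<le> b t"
begin

definition gm :: "nat \<Rightarrow> real" where "gm t = 2 / (real t + 2)"
definition Z :: "nat \<Rightarrow> 'w \<Rightarrow> real" where "Z t = (\<lambda>\<omega>. norm (P (\<Xi> t \<omega>)))"
definition LD :: real where "LD = L * D\<^sup>2"
definition slk :: "nat \<Rightarrow> 'w \<Rightarrow> real" where
  "slk t = (\<lambda>\<omega>. 2 * (D * Z t \<omega>) + (2 * \<kappa> + 3 / 2) * ((real K - 1) * gm t * LD)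
     + (\<kappa> + 1 / 2) * (gm t * LD) + (F (X t \<omega>) - F xo))"

lemma LD_pos: "0 < LD"
  using L_pos D_pos by (simp add: LD_def)

context
  fixes t \<omega> assumes t: "t < T" and \<omega>: "\<omega> \<in> space M"
begin

section \<open>Pathwise estimates\<close>

lemma path:
  shows path_small: "F (X (Suc t) \<omega>) \<le> F (X t \<omega>) - gm t * (dF (X t \<omega>) \<bullet> (X t \<omega> - xo))
      - gm t * (P (\<Xi> t \<omega>) \<bullet> (X t \<omega> - xo)) + (gm t)\<^sup>2 * \<kappa> * LD / 2 + gm t * D * Z t \<omega>
      + (real K - 1) * ((Z t \<omega>)\<^sup>2 / (2 * L))" (is ?A)
    and path_large: "0 < \<mu> \<Longrightarrow> F (X (Suc t) \<omega>) \<le> F (X t \<omega>) - gm t * (dF (X t \<omega>) \<bullet> (X t \<omega> - xo))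
      - gm t * (P (\<Xi> t \<omega>) \<bullet> (X t \<omega> - xo)) + (gm t)\<^sup>2 * \<kappa> * LD / 2 + gm t * D * Z t \<omega>
      + (\<mu> * ((Z t \<omega>)\<^sup>2 / L) + (real K)\<^sup>2 * (gm t)\<^sup>2 * LD / (3 * \<mu> ^ 3))" (is "_ \<Longrightarrow> ?B")
    and path_increase: "F (X (Suc t) \<omega>) \<le> F (X t \<omega>) + real K * gm t * D * Z t \<omega>" (is ?C)
    and path_decrease: "F (X (Suc t) \<omega>) \<le> F (X t \<omega>) - gm t * (gap (X t \<omega>) - slk t \<omega>) / 2
      + real K * gm t * D * Z t \<omega>" (is ?D)
    and path_tilted: "u \<in> C \<Longrightarrow> F (X (Suc t) \<omega>) - dF u \<bullet> X (Suc t) \<omega> \<le> F (X t \<omega>) - dF u \<bullet> X t \<omega>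
      - real K * (gm t * (gap (X t \<omega>) - gap u - slk t \<omega>))" (is "_ \<Longrightarrow> ?E")
    and path_combination: "\<exists>w c. 0 \<le> w \<and> w \<le> 1 \<and> w \<le> real K * gm t \<and> c \<in> C \<and>
      X (Suc t) \<omega> = X t \<omega> + w *\<^sub>R (c - X t \<omega>)" (is ?F)
proof -
  obtain g A y v where o: "outer_step C m f df L D P (X t \<omega>) g A \<kappa> (2 / (real t + 2)) K y v"
    and g: "g - dF (X t \<omega>) = \<Xi> t \<omega>" and y: "X (Suc t) \<omega> = y K"
    using step[OF t \<omega>] by blast
  interpret o: outer_step C m f df L D P "X t \<omega>" g A \<kappa> "gm t" K y v
    using o by (simp only: gm_def)
  have \<xi>: "o.\<xi> = \<Xi> t \<omega>" "o.\<zeta> = Z t \<omega>"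
    by (simp_all add: o.\<xi>_def o.\<zeta>_def Z_def g)
  have slk: "o.slack (F xo) = slk t \<omega>"
    by (simp add: o.slack_def slk_def \<xi> LD_def)
  have P: "\<Xi> t \<omega> \<bullet> (X t \<omega> - xo) = P (\<Xi> t \<omega>) \<bullet> (X t \<omega> - xo)"
    using P_diff[OF o.x_in xo(1)] by simp
  show ?A
    using o.main_step[OF xo(1) o.inner_noise_small] unfolding \<xi> P y LD_def .
  show ?B if "0 < \<mu>"
    using o.main_step[OF xo(1) o.inner_noise_large[OF that]] unfolding \<xi> P y LD_def .
  show ?C using o.F_increase[of K] unfolding \<xi> y by simp
  show ?D using o.F_decrease_gap[OF xo(2)] unfolding \<xi> slk y .
  show ?E if "u \<in> C" using o.tilted_decrease[OF that xo(2)] unfolding \<xi> slk y .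
  show ?F using o.outer_combination unfolding y .
qed

end

text \<open>One and the same tilted function, taken at \<open>X i \<omega>\<close>, serves the whole
  window, so its decreases telescope. Its minimum over \<open>C\<close> is at
  \<open>X i \<omega>\<close> by the tangent inequality, hence the total decrease is not
  positive.\<close>

lemma path_window:
  assumes i: "i \<le> s" "s \<le> T" and \<omega>: "\<omega> \<in> space M"
  shows "(\<Sum>t=i..<s. gm t * (gap (X t \<omega>) - gap (X i \<omega>) - slk t \<omega>)) \<le> 0"
proof -
  let ?u = "X i \<omega>"
  have u: "?u \<in> C" using X_in i \<omega> by simp
  have "F (X s \<omega>) - dF ?u \<bullet> X s \<omega> \<le> F ?u - dF ?u \<bullet> ?u
      - real K * (\<Sum>t=i..<s. gm t * (gap (X t \<omega>) - gap ?u - slk t \<omega>))"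
    using i
  proof (induction s rule: dec_induct)
    case (step n)
    then show ?case
      using path_tilted[of n \<omega> ?u] u \<omega> by (simp add: sum.atLeastLessThan_Suc algebra_simps)
  qed simp
  moreover have "F ?u + dF ?u \<bullet> (X s \<omega> - ?u) \<le> F (X s \<omega>)"
    using X_in i \<omega> by (intro F_tangent) auto
  ultimately have "real K * (\<Sum>t=i..<s. gm t * (gap (X t \<omega>) - gap ?u - slk t \<omega>)) \<le> 0"
    by (simp add: inner_diff_right)
  then show ?thesis using K_pos by (simp add: mult_le_0_iff)
qed

text \<open>Seen from \<open>X t \<omega>\<close>, the point at scale \<open>k\<close> is reached by
  a merged step of length at most the sum of the step bounds and a step of length (2/3)^k towards
  \<open>xo\<close>. Along each of them the linearization decreases by at most the length times the
  gap.\<close>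

lemma path_far:
  assumes t: "t \<le> s" "s \<le> T" and \<omega>: "\<omega> \<in> space M"
  shows "F (X s \<omega>) - F (geo xo (X s \<omega>) k)
    \<le> (F (X s \<omega>) - F (X t \<omega>)) + ((\<Sum>i=t..<s. real K * gm i) + (2 / 3) ^ k) * gap (X t \<omega>)"
proof -
  have comb: "\<exists>w c. 0 \<le> w \<and> w \<le> 1 \<and> w \<le> (\<Sum>i=t..<s. real K * gm i) \<and> c \<in> C \<and> X s \<omega> = X t \<omega> + w *\<^sub>R (c - X t \<omega>)"
    using t X_in[of t \<omega>] \<omega> path_combination[of _ \<omega>] by (intro combination_of_steps) auto
  then obtain w c where w: "0 \<le> w" "w \<le> 1" "w \<le> (\<Sum>i=t..<s. real K * gm i)" "c \<in> C" "X s \<omega> = X t \<omega> + w *\<^sub>R (c - X t \<omega>)"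
    by auto
  define \<rho> where "\<rho> = (2 / 3 :: real) ^ k"
  have \<rho>: "0 \<le> \<rho>" "\<rho> \<le> 1" by (auto simp: \<rho>_def intro: power_le_one)
  have in_C: "X t \<omega> \<in> C" "X s \<omega> \<in> C" using X_in t \<omega> by auto
  have gap0: "0 \<le> gap (X t \<omega>)" by (rule gap_nonneg[OF in_C(1)])
  let ?a = "dF (X t \<omega>)"
  have "geo xo (X s \<omega>) k - X t \<omega> = ((1 - \<rho>) * w) *\<^sub>R (c - X t \<omega>) + \<rho> *\<^sub>R (xo - X t \<omega>)"
    unfolding geo_def \<rho>_def[symmetric] w(5) by (simp add: algebra_simps)
  then have "?a \<bullet> (geo xo (X s \<omega>) k - X t \<omega>) = ((1 - \<rho>) * w) * (?a \<bullet> (c - X t \<omega>)) + \<rho> * (?a \<bullet> (xo - X t \<omega>))"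
    by (simp only: inner_add_right inner_scaleR_right)
  then have "- (?a \<bullet> (geo xo (X s \<omega>) k - X t \<omega>)) = ((1 - \<rho>) * w) * (?a \<bullet> (X t \<omega> - c)) + \<rho> * (?a \<bullet> (X t \<omega> - xo))"
    by (simp add: inner_diff_right algebra_simps)
  also have "\<dots> \<le> ((1 - \<rho>) * w) * gap (X t \<omega>) + \<rho> * gap (X t \<omega>)"
    using w \<rho> xo by (intro add_mono mult_left_mono gap_upper) auto
  also have "\<dots> \<le> ((\<Sum>i=t..<s. real K * gm i) + \<rho>) * gap (X t \<omega>)"
  proof -
    have "(1 - \<rho>) * w \<le> 1 * w" using w \<rho> by (intro mult_right_mono) auto
    then have "((1 - \<rho>) * w + \<rho>) * gap (X t \<omega>) \<le> ((\<Sum>i=t..<s. real K * gm i) + \<rho>) * gap (X t \<omega>)"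
      using w(3) gap0 by (intro mult_right_mono) auto
    then show ?thesis by (simp add: distrib_right)
  qed
  moreover have "F (X t \<omega>) + ?a \<bullet> (geo xo (X s \<omega>) k - X t \<omega>) \<le> F (geo xo (X s \<omega>) k)"
    using in_C xo by (intro F_tangent geo_in) auto
  ultimately show ?thesis by (simp add: \<rho>_def)
qed

section \<open>Integrability\<close>

lemma measurable_X_comp:
  fixes h :: "'a \<Rightarrow> 'b::{real_normed_vector, second_countable_topology}"
  assumes "continuous_on C h" "t \<le> T"
  shows "(\<lambda>\<omega>. h (X t \<omega>)) \<in> borel_measurable M"
  by (rule measurable_continuous_on_comp[OF assms(1) compact_imp_closed[OF compact_C] X_measurable[OF assms(2)] X_in[OF assms(2)]])

lemma integrable_X_comp:
  fixes h :: "'a \<Rightarrow> real"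
  assumes "continuous_on C h" "t \<le> T"
  shows "integrable M (\<lambda>\<omega>. h (X t \<omega>))"
proof -
  have "compact (h ` C)" using assms compact_C by (intro compact_continuous_image)
  then obtain B where "\<And>x. x \<in> C \<Longrightarrow> norm (h x) \<le> B"
    using compact_imp_bounded[of "h ` C"] by (auto simp: bounded_iff)
  then show ?thesis
    using X_in[OF assms(2)] by (intro integrable_const_bound[where B=B] measurable_X_comp assms) auto
qed

lemma integrable_F: "t \<le> T \<Longrightarrow> integrable M (\<lambda>\<omega>. F (X t \<omega>))"
  by (rule integrable_X_comp[OF continuous_on_F])

lemma integrable_gap: "t \<le> T \<Longrightarrow> integrable M (\<lambda>\<omega>. gap (X t \<omega>))"
  by (rule integrable_X_comp[OF continuous_on_gap])

lemma integrable_slope: "t \<le> T \<Longrightarrow> integrable M (\<lambda>\<omega>. dF (X t \<omega>) \<bullet> (X t \<omega> - xo))"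
  by (rule integrable_X_comp[OF continuous_on_inner[OF continuous_on_dF
        continuous_on_diff[OF continuous_on_id continuous_on_const]]])

lemma integrable_q: "t \<le> T \<Longrightarrow> integrable M (\<lambda>\<omega>. q (X t \<omega>) y)"
  by (rule integrable_X_comp[OF continuous_on_q])

lemma integrable_geo: "t \<le> T \<Longrightarrow> integrable M (\<lambda>\<omega>. F (geo xo (X t \<omega>) k))"
proof (rule integrable_X_comp[where h="\<lambda>x. F (geo xo x k)"])
  have "continuous_on C (\<lambda>x. geo xo x k)" unfolding geo_def by (intro continuous_intros)
  moreover have "(\<lambda>x. geo xo x k) ` C \<subseteq> C" using geo_in xo by auto
  ultimately show "continuous_on C (\<lambda>x. F (geo xo x k))"
    by (rule continuous_on_compose2[OF continuous_on_F])
qed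

lemma integrable_Z: "t < T \<Longrightarrow> integrable M (Z t)" "t < T \<Longrightarrow> integrable M (\<lambda>\<omega>. (Z t \<omega>)\<^sup>2)"
proof -
  assume t: "t < T"
  note [measurable] = \<Xi>_measurable[OF t]
  show "integrable M (Z t)"
    unfolding Z_def
  proof (rule integrable_const_bound[where B="Bz t"])
    show "AE \<omega> in M. norm (norm (P (\<Xi> t \<omega>))) \<le> Bz t" using \<Xi>_bounded[OF t] by simp
  qed simp
  show "integrable M (\<lambda>\<omega>. (Z t \<omega>)\<^sup>2)"
    unfolding Z_def
  proof (rule integrable_const_bound[where B="(Bz t)\<^sup>2"])
    show "AE \<omega> in M. norm ((norm (P (\<Xi> t \<omega>)))\<^sup>2) \<le> (Bz t)\<^sup>2"
    proof (rule AE_I2)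
      fix \<omega> assume "\<omega> \<in> space M"
      then have "(norm (P (\<Xi> t \<omega>)))\<^sup>2 \<le> (Bz t)\<^sup>2" using \<Xi>_bounded[OF t] by (intro power_mono) auto
      then show "norm ((norm (P (\<Xi> t \<omega>)))\<^sup>2) \<le> (Bz t)\<^sup>2" by simp
    qed
  qed simp
qed

lemma integrable_noise: "t < T \<Longrightarrow> integrable M (\<lambda>\<omega>. P (\<Xi> t \<omega>) \<bullet> (X t \<omega> - xo))"
proof -
  assume t: "t < T"
  note [measurable] = \<Xi>_measurable[OF t] X_measurable[OF less_imp_le[OF t]]
  have "AE \<omega> in M. norm (P (\<Xi> t \<omega>) \<bullet> (X t \<omega> - xo)) \<le> Bz t * D"
  proof (rule AE_I2)
    fix \<omega> assume \<omega>: "\<omega> \<in> space M"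
    have B0: "0 \<le> Bz t"
      by (rule order_trans[OF norm_ge_zero \<Xi>_bounded[OF t \<omega>]])
    have "\<bar>P (\<Xi> t \<omega>) \<bullet> (X t \<omega> - xo)\<bar> \<le> norm (P (\<Xi> t \<omega>)) * norm (X t \<omega> - xo)"
      by (rule Cauchy_Schwarz_ineq2)
    also have "\<dots> \<le> Bz t * D"
      using \<Xi>_bounded[OF t \<omega>] diam[OF X_in xo(1), of t \<omega>] \<omega> t B0
      by (intro mult_mono) auto
    finally show "norm (P (\<Xi> t \<omega>) \<bullet> (X t \<omega> - xo)) \<le> Bz t * D" by simp
  qed
  then show ?thesis by (rule integrable_const_bound) simp
qed

section \<open>Normalized expectations and their recursions\<close>

definition "E t = (expectation (\<lambda>\<omega>. F (X t \<omega>)) - F xo) / LD"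
definition "S1 t = expectation (\<lambda>\<omega>. dF (X t \<omega>) \<bullet> (X t \<omega> - xo)) / LD"
definition "Z1 t = D * expectation (Z t) / LD"
definition "Z2 t = expectation (\<lambda>\<omega>. (Z t \<omega>)\<^sup>2) / (L * LD)"
definition "V t = expectation (\<lambda>\<omega>. gap (X t \<omega>)) / LD"
definition "R t = expectation (\<lambda>\<omega>. q (X t \<omega>) xo) / (L * LD)"
definition "Ph s k = expectation (\<lambda>\<omega>. F (X s \<omega>) - F (geo xo (X s \<omega>) k)) / LD"

lemma expectation_mono:
  fixes g h :: "'w \<Rightarrow> real"
  assumes "integrable M g" "integrable M h" "\<And>\<omega>. \<omega> \<in> space M \<Longrightarrow> g \<omega> \<le> h \<omega>"
  shows "expectation g \<le> expectation h"
  using assms by (intro integral_mono)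

lemma E_slk:
  assumes "t < T"
  shows "expectation (slk t) / LD = 2 * Z1 t + (2 * \<kappa> + 3 / 2) * ((real K - 1) * gm t)
    + (\<kappa> + 1 / 2) * gm t + E t" "integrable M (slk t)"
proof -
  have [simp]: "integrable M (Z t)" "integrable M (\<lambda>\<omega>. F (X t \<omega>))"
    using integrable_Z(1)[OF assms] integrable_F[OF less_imp_le[OF assms]] .
  show "integrable M (slk t)" unfolding slk_def by simp
  show "expectation (slk t) / LD = 2 * Z1 t + (2 * \<kappa> + 3 / 2) * ((real K - 1) * gm t)
    + (\<kappa> + 1 / 2) * gm t + E t"
    unfolding slk_def Z1_def E_def using LD_pos by (simp add: prob_space add_divide_distrib diff_divide_distrib)
qed

lemma E_nonneg: "t \<le> T \<Longrightarrow> 0 \<le> E t"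
proof -
  assume t: "t \<le> T"
  have "expectation (\<lambda>_. F xo) \<le> expectation (\<lambda>\<omega>. F (X t \<omega>))"
    using t xo X_in by (intro expectation_mono integrable_F) auto
  then show ?thesis using LD_pos by (simp add: E_def prob_space)
qed

lemma E_le_S1: "t \<le> T \<Longrightarrow> E t \<le> S1 t"
proof -
  assume t: "t \<le> T"
  have "expectation (\<lambda>\<omega>. F (X t \<omega>) - F xo) \<le> expectation (\<lambda>\<omega>. dF (X t \<omega>) \<bullet> (X t \<omega> - xo))"
  proof (rule expectation_mono)
    fix \<omega> assume "\<omega> \<in> space M"
    then have "X t \<omega> \<in> C" using X_in t by simp
    from F_tangent[OF this xo(1)] show "F (X t \<omega>) - F xo \<le> dF (X t \<omega>) \<bullet> (X t \<omega> - xo)"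
      by (simp add: inner_diff_right)
  qed (use t integrable_F integrable_slope in auto)
  then show ?thesis
    using LD_pos integrable_F[OF t] by (simp add: E_def S1_def prob_space divide_right_mono)
qed

lemma R_le_S1: "t \<le> T \<Longrightarrow> R t \<le> S1 t"
proof -
  assume t: "t \<le> T"
  have "expectation (\<lambda>\<omega>. q (X t \<omega>) xo) \<le> expectation (\<lambda>\<omega>. L * (dF (X t \<omega>) \<bullet> (X t \<omega> - xo)))"
  proof (rule expectation_mono)
    fix \<omega> assume "\<omega> \<in> space M"
    then have x: "X t \<omega> \<in> C" using X_in t by simp
    have "q (X t \<omega>) xo \<le> L * ((dF (X t \<omega>) - dF xo) \<bullet> (X t \<omega> - xo))"
      by (rule q_le_inner[OF x xo(1)])
    also have "\<dots> \<le> L * (dF (X t \<omega>) \<bullet> (X t \<omega> - xo))"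
      using optimality[OF xo x] L_pos by (intro mult_left_mono) (auto simp: inner_diff_left)
    finally show "q (X t \<omega>) xo \<le> L * (dF (X t \<omega>) \<bullet> (X t \<omega> - xo))" .
  qed (use t integrable_q integrable_slope in auto)
  then have "R t \<le> (L * expectation (\<lambda>\<omega>. dF (X t \<omega>) \<bullet> (X t \<omega> - xo))) / (L * LD)"
    unfolding R_def using LD_pos L_pos by (intro divide_right_mono) auto
  then show ?thesis using L_pos by (simp add: S1_def)
qed

lemma Z1_Young: "t < T \<Longrightarrow> 0 < \<alpha> \<Longrightarrow> Z1 t \<le> Z2 t / (2 * \<alpha>) + \<alpha> / 2"
proof -
  assume t: "t < T" and \<alpha>: "0 < \<alpha>"
  define a where "a = \<alpha> * (L * D)"
  have a: "0 < a" using \<alpha> L_pos D_pos by (simp add: a_def)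
  have "expectation (Z t) \<le> expectation (\<lambda>\<omega>. (Z t \<omega>)\<^sup>2 / (2 * a) + a / 2)"
  proof (rule expectation_mono)
    fix \<omega>
    have "0 \<le> (Z t \<omega> - a)\<^sup>2 / (2 * a)" using a by simp
    also have "\<dots> = (Z t \<omega>)\<^sup>2 / (2 * a) + a / 2 - Z t \<omega>"
      using a by (simp add: power2_eq_square field_simps)
    finally show "Z t \<omega> \<le> (Z t \<omega>)\<^sup>2 / (2 * a) + a / 2" by simp
  qed (use integrable_Z[OF t] in auto)
  also have "\<dots> = expectation (\<lambda>\<omega>. (Z t \<omega>)\<^sup>2) / (2 * a) + a / 2"
    using integrable_Z[OF t] by (simp add: prob_space)
  finally have "D * expectation (Z t) / LD \<le> D * (expectation (\<lambda>\<omega>. (Z t \<omega>)\<^sup>2) / (2 * a) + a / 2) / LD"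
    using D_pos LD_pos by (intro divide_right_mono mult_left_mono) auto
  also have "\<dots> = Z2 t / (2 * \<alpha>) + \<alpha> / 2"
    unfolding Z2_def a_def LD_def using \<alpha> L_pos D_pos by (simp add: power2_eq_square field_simps)
  finally show ?thesis by (simp add: Z1_def)
qed

lemma E_main_small:
  assumes t: "t < T"
  shows "E (Suc t) \<le> E t - gm t * S1 t + (gm t)\<^sup>2 * \<kappa> / 2 + gm t * Z1 t + (real K - 1) * Z2 t / 2"
proof -
  note I = integrable_F[of t] integrable_slope[of t] integrable_noise[OF t] integrable_Z[OF t]
  have "expectation (\<lambda>\<omega>. F (X (Suc t) \<omega>)) \<le> expectation (\<lambda>\<omega>. F (X t \<omega>) - gm t * (dF (X t \<omega>) \<bullet> (X t \<omega> - xo))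
      - gm t * (P (\<Xi> t \<omega>) \<bullet> (X t \<omega> - xo)) + (gm t)\<^sup>2 * \<kappa> * LD / 2 + gm t * D * Z t \<omega>
      + (real K - 1) * ((Z t \<omega>)\<^sup>2 / (2 * L)))"
    using t I by (intro expectation_mono integrable_F path_small) auto
  also have "\<dots> = expectation (\<lambda>\<omega>. F (X t \<omega>)) - gm t * expectation (\<lambda>\<omega>. dF (X t \<omega>) \<bullet> (X t \<omega> - xo))
      + (gm t)\<^sup>2 * \<kappa> * LD / 2 + gm t * D * expectation (Z t)
      + (real K - 1) * (expectation (\<lambda>\<omega>. (Z t \<omega>)\<^sup>2) / (2 * L))"
    using t I unbiased[OF t] by (simp add: prob_space)
  finally have "(expectation (\<lambda>\<omega>. F (X (Suc t) \<omega>)) - F xo) / LD \<le>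
      (expectation (\<lambda>\<omega>. F (X t \<omega>)) - gm t * expectation (\<lambda>\<omega>. dF (X t \<omega>) \<bullet> (X t \<omega> - xo))
      + (gm t)\<^sup>2 * \<kappa> * LD / 2 + gm t * D * expectation (Z t)
      + (real K - 1) * (expectation (\<lambda>\<omega>. (Z t \<omega>)\<^sup>2) / (2 * L)) - F xo) / LD"
    using LD_pos by (intro divide_right_mono) auto
  also have "\<dots> = E t - gm t * S1 t + (gm t)\<^sup>2 * \<kappa> / 2 + gm t * Z1 t + (real K - 1) * Z2 t / 2"
    unfolding E_def S1_def Z1_def Z2_def using LD_pos L_pos by (simp add: field_simps)
  finally show ?thesis by (simp add: E_def)
qed

lemma E_main_large:
  assumes t: "t < T" and \<mu>: "0 < \<mu>"
  shows "E (Suc t) \<le> E t - gm t * S1 t + (gm t)\<^sup>2 * \<kappa> / 2 + gm t * Z1 t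
    + (\<mu> * Z2 t + (real K)\<^sup>2 * (gm t)\<^sup>2 / (3 * \<mu> ^ 3))"
proof -
  note I = integrable_F[of t] integrable_slope[of t] integrable_noise[OF t] integrable_Z[OF t]
  define c where "c = (real K)\<^sup>2 * (gm t)\<^sup>2 / (3 * \<mu> ^ 3)"
  have c: "(real K)\<^sup>2 * (gm t)\<^sup>2 * LD / (3 * \<mu> ^ 3) = c * LD" by (simp add: c_def)
  have "expectation (\<lambda>\<omega>. F (X (Suc t) \<omega>)) \<le> expectation (\<lambda>\<omega>. F (X t \<omega>) - gm t * (dF (X t \<omega>) \<bullet> (X t \<omega> - xo))
      - gm t * (P (\<Xi> t \<omega>) \<bullet> (X t \<omega> - xo)) + (gm t)\<^sup>2 * \<kappa> * LD / 2 + gm t * D * Z t \<omega>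
      + (\<mu> * ((Z t \<omega>)\<^sup>2 / L) + c * LD))"
    using t I path_large[OF t _ \<mu>] unfolding c by (intro expectation_mono integrable_F) auto
  also have "\<dots> = expectation (\<lambda>\<omega>. F (X t \<omega>)) - gm t * expectation (\<lambda>\<omega>. dF (X t \<omega>) \<bullet> (X t \<omega> - xo))
      + (gm t)\<^sup>2 * \<kappa> * LD / 2 + gm t * D * expectation (Z t)
      + (\<mu> * (expectation (\<lambda>\<omega>. (Z t \<omega>)\<^sup>2) / L) + c * LD)"
    using t I unbiased[OF t] by (simp add: prob_space)
  finally have "(expectation (\<lambda>\<omega>. F (X (Suc t) \<omega>)) - F xo) / LD \<le>
      (expectation (\<lambda>\<omega>. F (X t \<omega>)) - gm t * expectation (\<lambda>\<omega>. dF (X t \<omega>) \<bullet> (X t \<omega> - xo))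
      + (gm t)\<^sup>2 * \<kappa> * LD / 2 + gm t * D * expectation (Z t)
      + (\<mu> * (expectation (\<lambda>\<omega>. (Z t \<omega>)\<^sup>2) / L) + c * LD) - F xo) / LD"
    using LD_pos by (intro divide_right_mono) auto
  also have "\<dots> = E t - gm t * S1 t + (gm t)\<^sup>2 * \<kappa> / 2 + gm t * Z1 t + (\<mu> * Z2 t + c)"
    unfolding E_def S1_def Z1_def Z2_def using LD_pos L_pos by (simp add: field_simps)
  finally show ?thesis by (simp add: E_def c_def)
qed

lemma E_increase:
  assumes t: "t < T"
  shows "E (Suc t) \<le> E t + real K * gm t * Z1 t"
proof -
  note I = integrable_F[of t] integrable_Z[OF t]
  have "expectation (\<lambda>\<omega>. F (X (Suc t) \<omega>)) \<le> expectation (\<lambda>\<omega>. F (X t \<omega>) + real K * gm t * D * Z t \<omega>)"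
    using t I by (intro expectation_mono integrable_F path_increase) auto
  also have "\<dots> = expectation (\<lambda>\<omega>. F (X t \<omega>)) + real K * gm t * D * expectation (Z t)"
    using t I by simp
  finally have "(expectation (\<lambda>\<omega>. F (X (Suc t) \<omega>)) - F xo) / LD \<le>
      (expectation (\<lambda>\<omega>. F (X t \<omega>)) + real K * gm t * D * expectation (Z t) - F xo) / LD"
    using LD_pos by (intro divide_right_mono) auto
  also have "\<dots> = E t + real K * gm t * Z1 t"
    unfolding E_def Z1_def using LD_pos by (simp add: field_simps)
  finally show ?thesis by (simp add: E_def)
qed

lemma E_decrease:
  assumes t: "t < T"
  shows "E (Suc t) \<le> E t - gm t * (V t - expectation (slk t) / LD) / 2 + real K * gm t * Z1 t"
proof -
  note I = integrable_F[of t] integrable_Z[OF t] integrable_gap[of t] E_slk(2)[OF t]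
  have "expectation (\<lambda>\<omega>. F (X (Suc t) \<omega>)) \<le> expectation (\<lambda>\<omega>. F (X t \<omega>) - gm t * (gap (X t \<omega>) - slk t \<omega>) / 2
      + real K * gm t * D * Z t \<omega>)"
    using t I by (intro expectation_mono integrable_F path_decrease) auto
  also have "\<dots> = expectation (\<lambda>\<omega>. F (X t \<omega>)) - gm t * (expectation (\<lambda>\<omega>. gap (X t \<omega>)) - expectation (slk t)) / 2
      + real K * gm t * D * expectation (Z t)"
    using t I by simp
  finally have "(expectation (\<lambda>\<omega>. F (X (Suc t) \<omega>)) - F xo) / LD \<le>
      (expectation (\<lambda>\<omega>. F (X t \<omega>)) - gm t * (expectation (\<lambda>\<omega>. gap (X t \<omega>)) - expectation (slk t)) / 2
      + real K * gm t * D * expectation (Z t) - F xo) / LD"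
    using LD_pos by (intro divide_right_mono) auto
  also have "\<dots> = E t - gm t * (V t - expectation (slk t) / LD) / 2 + real K * gm t * Z1 t"
    unfolding E_def Z1_def V_def using LD_pos by (simp add: field_simps)
  finally show ?thesis by (simp add: E_def)
qed

lemma E_window:
  assumes i: "i \<le> s" "s \<le> T"
  shows "(\<Sum>t=i..<s. gm t * (V t - V i - expectation (slk t) / LD)) \<le> 0"
proof -
  have I: "integrable M (\<lambda>\<omega>. gap (X t \<omega>))" "integrable M (slk t)" "integrable M (\<lambda>\<omega>. gap (X i \<omega>))"
    if "t \<in> {i..<s}" for t
    using that i by (auto intro!: integrable_gap E_slk)
  have "expectation (\<lambda>\<omega>. \<Sum>t=i..<s. gm t * (gap (X t \<omega>) - gap (X i \<omega>) - slk t \<omega>)) \<le> expectation (\<lambda>_. 0)"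
    using I path_window[OF i] by (intro expectation_mono) auto
  also have "expectation (\<lambda>\<omega>. \<Sum>t=i..<s. gm t * (gap (X t \<omega>) - gap (X i \<omega>) - slk t \<omega>))
      = (\<Sum>t=i..<s. expectation (\<lambda>\<omega>. gm t * (gap (X t \<omega>) - gap (X i \<omega>) - slk t \<omega>)))"
    using I by (intro Bochner_Integration.integral_sum) auto
  also have "\<dots> = (\<Sum>t=i..<s. LD * (gm t * (V t - V i - expectation (slk t) / LD)))"
    using I LD_pos by (intro sum.cong refl) (simp add: V_def field_simps)
  also have "\<dots> = LD * (\<Sum>t=i..<s. gm t * (V t - V i - expectation (slk t) / LD))"
    by (simp add: sum_distrib_left)
  finally show ?thesis using LD_pos by (simp add: mult_le_0_iff)
qed

lemma V_nonneg: "t \<le> T \<Longrightarrow> 0 \<le> V t"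
  unfolding V_def using LD_pos X_in gap_nonneg by (intro divide_nonneg_pos integral_nonneg) auto

lemma R_small:
  assumes t: "t \<le> T"
  shows "R t \<le> 11 / 10 * (real n / 2 * E t) + 11 * (4 / 9) ^ n"
proof -
  have "expectation (\<lambda>\<omega>. q (X t \<omega>) xo) \<le>
      expectation (\<lambda>\<omega>. 11 / 10 * (real n * (L / 2 * (F (X t \<omega>) - F xo))) + 11 * (L\<^sup>2 * D\<^sup>2 * (4 / 9) ^ n))"
  proof (rule expectation_mono)
    fix \<omega> assume "\<omega> \<in> space M"
    then have x: "X t \<omega> \<in> C" using X_in t by simp
    have "q xo (X t \<omega>) \<le> (1 + 1 / 10) * q xo (geo xo (X t \<omega>) n) + (1 + 1 / (1 / 10)) * q (geo xo (X t \<omega>) n) (X t \<omega>)"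
      by (rule q_Young) simp
    also have "\<dots> \<le> (1 + 1 / 10) * (real n * (L / 2 * (F (X t \<omega>) - F xo))) + (1 + 1 / (1 / 10)) * (L\<^sup>2 * D\<^sup>2 * (4 / 9) ^ n)"
      using q_scale_head[OF xo x] q_scale_end[OF xo x] by (intro add_mono mult_left_mono) auto
    finally show "q (X t \<omega>) xo \<le> 11 / 10 * (real n * (L / 2 * (F (X t \<omega>) - F xo))) + 11 * (L\<^sup>2 * D\<^sup>2 * (4 / 9) ^ n)"
      by (simp add: q_commute)
  qed (use t integrable_q integrable_F in auto)
  also have "\<dots> = 11 / 10 * (real n * (L / 2 * (expectation (\<lambda>\<omega>. F (X t \<omega>)) - F xo))) + 11 * (L\<^sup>2 * D\<^sup>2 * (4 / 9) ^ n)"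
    using integrable_F[OF t] by (simp add: prob_space)
  finally have "R t \<le> (11 / 10 * (real n * (L / 2 * (expectation (\<lambda>\<omega>. F (X t \<omega>)) - F xo))) + 11 * (L\<^sup>2 * D\<^sup>2 * (4 / 9) ^ n)) / (L * LD)"
    unfolding R_def using LD_pos L_pos by (intro divide_right_mono) auto
  also have "\<dots> = 11 / 10 * (real n / 2 * E t) + 11 * (4 / 9) ^ n"
    unfolding E_def LD_def using L_pos D_pos by (simp add: power2_eq_square field_simps)
  finally show ?thesis .
qed

lemma sum_four_fifths: "(\<Sum>i<N. 1 / (5 / 4) ^ i) \<le> (5 :: real)"
proof -
  have "(\<Sum>i<N. (4 / 5 :: real) ^ i) = 5 * (1 - (4 / 5) ^ N)"
    by (simp add: geometric_sum)
  then show ?thesis by (simp add: power_divide)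
qed

lemma path_q_mid:
  assumes x: "x \<in> C"
  shows "q (geo xo x n) x \<le> 101 / 100 * (5 * (\<Sum>i<N. (5 / 4) ^ i * (L / 2 * (F x - F (geo xo x (n + Suc i))))))
    + 101 * (L\<^sup>2 * D\<^sup>2 * (4 / 9) ^ (n + N))"
proof -
  define B where "B = (\<Sum>i<N. (5 / 4) ^ i * (L / 2 * (F x - F (geo xo x (n + Suc i)))))"
  have B: "0 \<le> B"
    unfolding B_def
  proof (rule sum_nonneg)
    fix i
    have "0 \<le> L / 2 * (F x - F (geo xo x (n + Suc i)))"
      using order_trans[OF q_nonneg q_scale_tail[OF xo x, of "n + i"]] by simp
    then show "0 \<le> (5 / 4) ^ i * (L / 2 * (F x - F (geo xo x (n + Suc i))))"
      by (rule mult_nonneg_nonneg[rotated]) simp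
  qed
  \<comment> \<open>The inverses of the weights (5/4)^i add up to at most 5. Since the decrease of
    \<open>F\<close> shrinks about like (2/3)^i, the weighted terms still decay, with ratio
    5/6.\<close>
  have "q (geo xo x n) (geo xo x (n + N)) \<le> (\<Sum>i<N. 1 / (5 / 4) ^ i) * B"
    unfolding B_def by (rule q_scale_mid[OF xo x]) (assumption | (rule zero_less_power, simp))+
  also have "\<dots> \<le> 5 * B" using sum_four_fifths B by (intro mult_right_mono) auto
  finally have mid: "q (geo xo x n) (geo xo x (n + N)) \<le> 5 * B" .
  have "q (geo xo x n) x \<le> (1 + 1 / 100) * q (geo xo x n) (geo xo x (n + N)) + (1 + 1 / (1 / 100)) * q (geo xo x (n + N)) x"
    by (rule q_Young) simp
  also have "\<dots> \<le> (1 + 1 / 100) * (5 * B) + (1 + 1 / (1 / 100)) * (L\<^sup>2 * D\<^sup>2 * (4 / 9) ^ (n + N))"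
    using mid q_scale_end[OF xo x, of "n + N"] by (intro add_mono mult_left_mono) auto
  finally show ?thesis by (simp add: B_def)
qed

lemma R_large:
  assumes t: "t \<le> T"
  shows "R t \<le> 11 / 10 * (real n / 2 * E t)
      + 11 * (101 / 100 * (5 * (\<Sum>i<N. (5 / 4) ^ i * (Ph t (n + Suc i) / 2))) + 101 * (4 / 9) ^ (n + N))"
proof -
  define c where "c = L\<^sup>2 * D\<^sup>2 * (4 / 9) ^ (n + N)"
  note I = integrable_F[OF t] integrable_geo[OF t]
  have "expectation (\<lambda>\<omega>. q (X t \<omega>) xo) \<le>
      expectation (\<lambda>\<omega>. 11 / 10 * (real n * (L / 2 * (F (X t \<omega>) - F xo)))
        + 11 * (101 / 100 * (5 * (\<Sum>i<N. (5 / 4) ^ i * (L / 2 * (F (X t \<omega>) - F (geo xo (X t \<omega>) (n + Suc i)))))) + 101 * c))"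
  proof (rule expectation_mono)
    fix \<omega> assume "\<omega> \<in> space M"
    then have x: "X t \<omega> \<in> C" using X_in t by simp
    have "q xo (X t \<omega>) \<le> (1 + 1 / 10) * q xo (geo xo (X t \<omega>) n) + (1 + 1 / (1 / 10)) * q (geo xo (X t \<omega>) n) (X t \<omega>)"
      by (rule q_Young) simp
    also have "\<dots> \<le> (1 + 1 / 10) * (real n * (L / 2 * (F (X t \<omega>) - F xo))) + (1 + 1 / (1 / 10)) *
        (101 / 100 * (5 * (\<Sum>i<N. (5 / 4) ^ i * (L / 2 * (F (X t \<omega>) - F (geo xo (X t \<omega>) (n + Suc i)))))) + 101 * c)"
      unfolding c_def using q_scale_head[OF xo x] path_q_mid[OF x] by (intro add_mono mult_left_mono) auto
    finally show "q (X t \<omega>) xo \<le> 11 / 10 * (real n * (L / 2 * (F (X t \<omega>) - F xo)))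
        + 11 * (101 / 100 * (5 * (\<Sum>i<N. (5 / 4) ^ i * (L / 2 * (F (X t \<omega>) - F (geo xo (X t \<omega>) (n + Suc i)))))) + 101 * c)"
      by (simp add: q_commute)
  qed (use integrable_q[OF t] I in \<open>auto intro!: Bochner_Integration.integrable_sum\<close>)
  also have "\<dots> = 11 / 10 * (real n * (L / 2 * (expectation (\<lambda>\<omega>. F (X t \<omega>)) - F xo)))
        + 11 * (101 / 100 * (5 * (\<Sum>i<N. (5 / 4) ^ i * (L / 2 * expectation (\<lambda>\<omega>. F (X t \<omega>) - F (geo xo (X t \<omega>) (n + Suc i)))))) + 101 * c)"
    using I by (simp add: prob_space Bochner_Integration.integral_sum)
  also have "(\<Sum>i<N. (5 / 4) ^ i * (L / 2 * expectation (\<lambda>\<omega>. F (X t \<omega>) - F (geo xo (X t \<omega>) (n + Suc i)))))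
      = (L * LD) * (\<Sum>i<N. (5 / 4) ^ i * (Ph t (n + Suc i) / 2))"
    unfolding sum_distrib_left using LD_pos by (intro sum.cong refl) (simp add: Ph_def)
  finally have "R t \<le> (11 / 10 * (real n * (L / 2 * (expectation (\<lambda>\<omega>. F (X t \<omega>)) - F xo)))
        + 11 * (101 / 100 * (5 * ((L * LD) * (\<Sum>i<N. (5 / 4) ^ i * (Ph t (n + Suc i) / 2)))) + 101 * c)) / (L * LD)"
    unfolding R_def using LD_pos L_pos by (intro divide_right_mono) auto
  also have "\<dots> = 11 / 10 * (real n / 2 * E t)
      + 11 * (101 / 100 * (5 * (\<Sum>i<N. (5 / 4) ^ i * (Ph t (n + Suc i) / 2))) + 101 * (4 / 9) ^ (n + N))"
  proof -
    have a: "L / 2 * (expectation (\<lambda>\<omega>. F (X t \<omega>)) - F xo) = (L * LD) * E t / 2"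
      using LD_pos by (simp add: E_def)
    have b: "c = (L * LD) * (4 / 9) ^ (n + N)" by (simp add: c_def LD_def power2_eq_square)
    have nz: "L * LD \<noteq> 0" using L_pos LD_pos by simp
    have "(11 / 10 * (k * (z * l / 2)) + 11 * (101 / 100 * (5 * (z * y)) + 101 * (z * w))) / z
        = 11 / 10 * (k / 2 * l) + 11 * (101 / 100 * (5 * y) + 101 * w)" if "z \<noteq> 0" for k l z y w :: real
      using that by (simp add: field_simps)
    then show ?thesis unfolding a b using nz by blast
  qed
  finally show ?thesis .
qed

lemma Ph_le:
  assumes "t \<le> s" "s \<le> T"
  shows "Ph s k \<le> (E s - E t) + ((\<Sum>i=t..<s. real K * gm i) + (2 / 3) ^ k) * V t"
proof -
  define w where "w = (\<Sum>i=t..<s. real K * gm i) + (2 / 3) ^ k"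
  have t: "t \<le> T" using assms by simp
  note I = integrable_F[OF assms(2)] integrable_F[OF t] integrable_gap[OF t] integrable_geo[OF assms(2)]
  have "expectation (\<lambda>\<omega>. F (X s \<omega>) - F (geo xo (X s \<omega>) k))
      \<le> expectation (\<lambda>\<omega>. (F (X s \<omega>) - F (X t \<omega>)) + w * gap (X t \<omega>))"
    unfolding w_def using I path_far[OF assms] by (intro expectation_mono) auto
  also have "\<dots> = expectation (\<lambda>\<omega>. F (X s \<omega>)) - expectation (\<lambda>\<omega>. F (X t \<omega>)) + w * expectation (\<lambda>\<omega>. gap (X t \<omega>))"
    using I by simp
  finally have "Ph s k \<le> (expectation (\<lambda>\<omega>. F (X s \<omega>)) - expectation (\<lambda>\<omega>. F (X t \<omega>)) + w * expectation (\<lambda>\<omega>. gap (X t \<omega>))) / LD"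
    unfolding Ph_def using LD_pos by (intro divide_right_mono) auto
  also have "\<dots> = (E s - E t) + w * V t"
    unfolding E_def V_def using LD_pos by (simp add: field_simps)
  finally show ?thesis by (simp add: w_def)
qed

lemma noise_R:
  assumes t: "t < T" "t \<notin> S"
  shows "Z2 t \<le> (5 * R t + 5 / 4 * R (\<sigma> t)) / b t"
proof -
  have tT: "t \<le> T" "\<sigma> t \<le> T" using t snapshot(2)[OF t(2)] by auto
  have b: "0 < b t"
  proof -
    have "0 < 12 * (2 * (real K + 1 + \<kappa>)) * (real t + 2)" using \<kappa>_ge by simp
    then show ?thesis using b_ge[of t] by linarith
  qed
  have meas: "(\<lambda>\<omega>. q (X t \<omega>) (X (\<sigma> t) \<omega>)) \<in> borel_measurable M"
  proof -
    have df [measurable]: "(\<lambda>\<omega>. df i (X j \<omega>)) \<in> borel_measurable M" if "i \<in> {1..m}" "j \<le> T" for i j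
      using measurable_X_comp[OF continuous_on_df[OF that(1)] that(2)] .
    have "P \<in> borel_measurable borel"
      using P_linear by (intro borel_measurable_continuous_onI linear_continuous_on) (simp add: linear_conv_bounded_linear)
    from measurable_compose[OF borel_measurable_diff[OF df[OF _ tT(1)] df[OF _ tT(2)]] this]
    show ?thesis
      unfolding q_def by (intro borel_measurable_divide borel_measurable_sum borel_measurable_power borel_measurable_norm) auto
  qed
  have int: "integrable M (\<lambda>\<omega>. q (X t \<omega>) (X (\<sigma> t) \<omega>))"
  proof (rule integrable_const_bound[where B="L\<^sup>2 * D\<^sup>2", OF _ meas])
    show "AE \<omega> in M. norm (q (X t \<omega>) (X (\<sigma> t) \<omega>)) \<le> L\<^sup>2 * D\<^sup>2"
      using q_bound X_in tT by (intro AE_I2) (simp add: q_nonneg)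
  qed
  have "expectation (\<lambda>\<omega>. q (X t \<omega>) (X (\<sigma> t) \<omega>)) \<le> expectation (\<lambda>\<omega>. 5 * q (X t \<omega>) xo + 5 / 4 * q (X (\<sigma> t) \<omega>) xo)"
  proof (rule expectation_mono[OF int])
    \<comment> \<open>Young's inequality with parameter 4 puts the large factor on the current
      iterate, whose share is absorbed by the slope, and keeps the factor of the snapshot, which
      will be multiplied by \<open>c\<close>, close to 1.\<close>
    show "q (X t \<omega>) (X (\<sigma> t) \<omega>) \<le> 5 * q (X t \<omega>) xo + 5 / 4 * q (X (\<sigma> t) \<omega>) xo" for \<omega>
      using q_Young[of 4 "X t \<omega>" "X (\<sigma> t) \<omega>" xo] by (simp add: q_commute[of xo])
  qed (use integrable_q tT in auto)
  also have "\<dots> = 5 * expectation (\<lambda>\<omega>. q (X t \<omega>) xo) + 5 / 4 * expectation (\<lambda>\<omega>. q (X (\<sigma> t) \<omega>) xo)"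
    using integrable_q[OF tT(1)] integrable_q[OF tT(2)] by simp
  finally have "expectation (\<lambda>\<omega>. q (X t \<omega>) (X (\<sigma> t) \<omega>)) / b t \<le>
      (5 * expectation (\<lambda>\<omega>. q (X t \<omega>) xo) + 5 / 4 * expectation (\<lambda>\<omega>. q (X (\<sigma> t) \<omega>) xo)) / b t"
    using b by (intro divide_right_mono) auto
  with variance[OF t] have "expectation (\<lambda>\<omega>. (Z t \<omega>)\<^sup>2) \<le>
      (5 * expectation (\<lambda>\<omega>. q (X t \<omega>) xo) + 5 / 4 * expectation (\<lambda>\<omega>. q (X (\<sigma> t) \<omega>) xo)) / b t"
    unfolding Z_def by linarith
  then have "Z2 t \<le> (5 * expectation (\<lambda>\<omega>. q (X t \<omega>) xo) + 5 / 4 * expectation (\<lambda>\<omega>. q (X (\<sigma> t) \<omega>) xo)) / b t / (L * LD)"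
    unfolding Z2_def using LD_pos L_pos by (intro divide_right_mono) auto
  also have "\<dots> = (5 * R t + 5 / 4 * R (\<sigma> t)) / b t"
    unfolding R_def using L_pos LD_pos b by (simp add: field_simps)
  finally show ?thesis .
qed

lemma no_noise: "t < T \<Longrightarrow> t \<in> S \<Longrightarrow> Z2 t \<le> 0"
proof -
  assume t: "t < T" "t \<in> S"
  have "expectation (\<lambda>\<omega>. (Z t \<omega>)\<^sup>2) = expectation (\<lambda>_. 0)"
    using exact[OF t] by (intro Bochner_Integration.integral_cong) (auto simp: Z_def)
  then show ?thesis by (simp add: Z2_def)
qed

lemma rates: "svrf_rates K T \<kappa> E S1 Z1 Z2 V R b Ph \<sigma> S"
proof
  fix t assume t: "t < T"
  show "E (Suc t) \<le> E t - 2 / (real t + 2) * (V t - (2 * Z1 t + (2 * \<kappa> + 3 / 2) * ((real K - 1) * (2 / (real t + 2)))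
      + (\<kappa> + 1 / 2) * (2 / (real t + 2)) + E t)) / 2 + real K * (2 / (real t + 2)) * Z1 t"
    using E_decrease[OF t] unfolding E_slk(1)[OF t] gm_def .
next
  fix i s assume i: "i \<le> s" "s \<le> T"
  have "(\<Sum>t=i..<s. gm t * (V t - V i - (2 * Z1 t + (2 * \<kappa> + 3 / 2) * ((real K - 1) * gm t)
      + (\<kappa> + 1 / 2) * gm t + E t))) = (\<Sum>t=i..<s. gm t * (V t - V i - expectation (slk t) / LD))"
    using i by (intro sum.cong refl) (simp add: E_slk(1))
  also have "\<dots> \<le> 0" by (rule E_window[OF i])
  finally show "(\<Sum>t=i..<s. 2 / (real t + 2) * (V t - V i - (2 * Z1 t + (2 * \<kappa> + 3 / 2) * ((real K - 1) * (2 / (real t + 2)))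
      + (\<kappa> + 1 / 2) * (2 / (real t + 2)) + E t))) \<le> 0"
    unfolding gm_def .
next
  fix t assume t: "t < T" "t \<notin> S"
  have b: "0 \<le> b t"
  proof -
    have "0 < 12 * (2 * (real K + 1 + \<kappa>)) * (real t + 2)" using \<kappa>_ge by simp
    then show ?thesis using b_ge[of t] by linarith
  qed
  \<comment> \<open>This form with the slope feeds the recursion for the primal gap;
    \<open>noise_R\<close> itself, with \<open>R t\<close>, feeds the bound on the first moment of
    the noise.\<close>
  have "5 * R t + 5 / 4 * R (\<sigma> t) \<le> 5 * S1 t + 5 / 4 * R (\<sigma> t)"
    using R_le_S1 t by simp
  from order_trans[OF noise_R[OF t] divide_right_mono[OF this b]]
  show "Z2 t \<le> (5 * S1 t + 5 / 4 * R (\<sigma> t)) / b t" .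
qed (rule K_pos \<kappa>_ge snapshot(4) b_ge
    | (rule E_nonneg E_le_S1 Z1_Young E_main_small[unfolded gm_def] E_main_large[unfolded gm_def]
        E_increase[unfolded gm_def] V_nonneg R_small R_large Ph_le[unfolded gm_def] noise_R no_noise
        snapshot(1-3); assumption))+

theorem expected_gap_le:
  assumes "1 \<le> t" "t \<le> T"
  shows "expectation (\<lambda>\<omega>. F (X t \<omega>)) - F xo \<le> 2 * L * D\<^sup>2 * (real K + 1 + \<kappa>) / (real t + 2)"
proof -
  have "E t \<le> 2 * (real K + 1 + \<kappa>) / (real t + 2)"
    by (rule svrf_rates.e_bound[OF rates assms])
  then have "E t * LD \<le> 2 * (real K + 1 + \<kappa>) / (real t + 2) * LD"
    using LD_pos by (intro mult_right_mono) auto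
  also have "E t * LD = expectation (\<lambda>\<omega>. F (X t \<omega>)) - F xo"
    using LD_pos by (simp add: E_def)
  finally show ?thesis by (simp add: LD_def algebra_simps)
qed

end

section \<open>Projection onto the directions of the affine hull\<close>

text \<open>Picked by the properties that \<open>smooth_family\<close> asks for; the witness is the
  orthogonal projection onto the span of the differences of points of \<open>C\<close>, centred at a
  relative interior point.\<close>

definition tangential_proj :: "'a::euclidean_space set \<Rightarrow> 'a \<Rightarrow> 'a" where
  "tangential_proj C = (SOME P. linear P \<and> (\<forall>z. norm (P z) \<le> norm z) \<and>
    (\<forall>z. \<forall>x\<in>C. \<forall>y\<in>C. P z \<bullet> (x - y) = z \<bullet> (x - y)) \<and>
    (\<exists>c\<in>C. \<exists>\<rho>>0. \<forall>z. norm (P z) \<le> \<rho> \<longrightarrow> c + P z \<in> C))"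

lemma tangential_proj:
  fixes C :: "'a::euclidean_space set"
  assumes "convex C" "C \<noteq> {}"
  shows "linear (tangential_proj C)" "norm (tangential_proj C z) \<le> norm z"
    "x \<in> C \<Longrightarrow> y \<in> C \<Longrightarrow> tangential_proj C z \<bullet> (x - y) = z \<bullet> (x - y)"
    "\<exists>c\<in>C. \<exists>\<rho>>0. \<forall>z. norm (tangential_proj C z) \<le> \<rho> \<longrightarrow> c + tangential_proj C z \<in> C"
proof -
  obtain c where c: "c \<in> rel_interior C"
    using rel_interior_eq_empty[OF assms(1)] assms(2) by auto
  then obtain \<rho> where \<rho>: "\<rho> > 0" "cball c \<rho> \<inter> affine hull C \<subseteq> C" and cC: "c \<in> C"
    by (auto simp: mem_rel_interior_cball)
  define W where "W = span ((\<lambda>x. - c + x) ` C)"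
  have W: "subspace W" by (simp add: W_def)
  obtain B where B: "B \<subseteq> W" "pairwise orthogonal B" "\<And>b. b \<in> B \<Longrightarrow> norm b = 1"
    "independent B" "card B = dim W" "span B = W"
    using orthonormal_basis_subspace[OF W] by metis
  have fB: "finite B" using B(4) by (rule independent_imp_finite)
  define P where "P z = (\<Sum>b\<in>B. (b \<bullet> z) *\<^sub>R b)" for z :: 'a
  have linP: "linear P"
    unfolding P_def by (intro linear_compose_sum ballI linearI) (auto simp: inner_add_right scaleR_add_left)
  have PW: "P z \<in> W" for z
    unfolding P_def B(6)[symmetric] by (intro span_sum span_scale span_base)
  have expand: "P w = w" if "w \<in> W" for w
    unfolding P_def using orthonormal_basis_expand[OF B(2,3) _ fB, of w] that B(6) by (simp add: inner_commute[of _ w])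
  have sym: "P u \<bullet> w = u \<bullet> P w" for u w
    unfolding P_def by (simp add: inner_sum_left inner_sum_right inner_commute mult.commute)
  have Pnorm: "norm (P z) \<le> norm z" for z
  proof (cases "P z = 0")
    case False
    have "norm (P z) * norm (P z) = P z \<bullet> P z" by (simp add: norm_eq_sqrt_inner)
    also have "\<dots> = z \<bullet> P (P z)" by (rule sym)
    also have "\<dots> = z \<bullet> P z" by (simp add: expand PW)
    also have "\<dots> \<le> norm z * norm (P z)" by (rule norm_cauchy_schwarz)
    finally show ?thesis using False by simp
  qed simp
  have dW: "x - y \<in> W" if "x \<in> C" "y \<in> C" for x y
  proof -
    have "- c + x \<in> W" "- c + y \<in> W" unfolding W_def using that by (auto intro: span_base)
    then have "(- c + x) - (- c + y) \<in> W" using W by (rule subspace_diff[rotated])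
    then show ?thesis by simp
  qed
  have Pdiff: "P z \<bullet> (x - y) = z \<bullet> (x - y)" if "x \<in> C" "y \<in> C" for z x y
    using sym[of z "x - y"] expand[OF dW[OF that]] by simp
  have int: "c + P z \<in> C" if "norm (P z) \<le> \<rho>" for z
  proof -
    have "affine hull C = (\<lambda>x. c + x) ` W"
      unfolding W_def using cC by (intro affine_hull_span_gen) (simp add: hull_inc)
    then have "c + P z \<in> affine hull C" using PW by simp
    moreover have "c + P z \<in> cball c \<rho>" using that by (simp add: dist_norm)
    ultimately show ?thesis using \<rho>(2) by blast
  qed
  have "\<exists>P. linear P \<and> (\<forall>z. norm (P z) \<le> norm z) \<and> (\<forall>z. \<forall>x\<in>C. \<forall>y\<in>C. P z \<bullet> (x - y) = z \<bullet> (x - y)) \<and>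
    (\<exists>c\<in>C. \<exists>\<rho>>0. \<forall>z. norm (P z) \<le> \<rho> \<longrightarrow> c + P z \<in> C)"
    using linP Pnorm Pdiff int \<rho>(1) cC by blast
  then have *: "linear (tangential_proj C) \<and> (\<forall>z. norm (tangential_proj C z) \<le> norm z) \<and>
    (\<forall>z. \<forall>x\<in>C. \<forall>y\<in>C. tangential_proj C z \<bullet> (x - y) = z \<bullet> (x - y)) \<and>
    (\<exists>c\<in>C. \<exists>\<rho>>0. \<forall>z. norm (tangential_proj C z) \<le> \<rho> \<longrightarrow> c + tangential_proj C z \<in> C)"
    unfolding tangential_proj_def by (rule someI_ex)
  then show "linear (tangential_proj C)" "norm (tangential_proj C z) \<le> norm z"
    "x \<in> C \<Longrightarrow> y \<in> C \<Longrightarrow> tangential_proj C z \<bullet> (x - y) = z \<bullet> (x - y)"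
    "\<exists>c\<in>C. \<exists>\<rho>>0. \<forall>z. norm (tangential_proj C z) \<le> \<rho> \<longrightarrow> c + tangential_proj C z \<in> C"
    by blast+
qed

section \<open>Uniform sampling\<close>

text \<open>Independence makes the conditional expectation of the indicator given \<open>G\<close>
  the constant \<open>p\<close>.\<close>

lemma (in prob_space) expectation_mult_indicator_indep:
  fixes h :: "'a \<Rightarrow> real"
  assumes G: "subalgebra M G" and S: "S \<in> events"
    and indep: "\<And>B. B \<in> sets G \<Longrightarrow> prob (B \<inter> S) = prob B * p"
    and h: "h \<in> borel_measurable G" "\<And>\<omega>. \<omega> \<in> space M \<Longrightarrow> \<bar>h \<omega>\<bar> \<le> Bd"
  shows "expectation (\<lambda>\<omega>. h \<omega> * indicator S \<omega>) = p * expectation h"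
proof -
  interpret finite_measure_subalgebra M G
    by unfold_locales (rule G)
  have hM [measurable]: "h \<in> borel_measurable M"
    using measurable_from_subalg[OF G h(1)] .
  note [measurable] = S
  have AE: "AE \<omega> in M. real_cond_exp M G (indicator S) \<omega> = p"
  proof (rule real_cond_exp_charact)
    fix B assume B: "B \<in> sets G"
    then have BM [measurable]: "B \<in> events" using G by (auto simp: subalgebra_def)
    have "(\<integral>\<omega>\<in>B. indicator S \<omega> \<partial>M) = expectation (indicator (B \<inter> S))"
      unfolding set_lebesgue_integral_def by (intro Bochner_Integration.integral_cong) (auto simp: indicator_def)
    also have "\<dots> = prob (B \<inter> S)" by simp
    also have "\<dots> = (\<integral>\<omega>\<in>B. p \<partial>M)"
      using indep[OF B] BM by (simp add: set_lebesgue_integral_def)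
    finally show "(\<integral>\<omega>\<in>B. indicator S \<omega> \<partial>M) = (\<integral>\<omega>\<in>B. p \<partial>M)" .
  next
    show "integrable M (indicator S :: 'a \<Rightarrow> real)"
      by (rule integrable_const_bound[where B=1]) (auto simp: indicator_def)
  qed auto
  have int: "integrable M (\<lambda>\<omega>. h \<omega> * indicator S \<omega>)"
  proof (rule integrable_const_bound[where B="\<bar>Bd\<bar>"])
    show "AE \<omega> in M. norm (h \<omega> * indicator S \<omega>) \<le> \<bar>Bd\<bar>"
      using h(2) by (intro AE_I2) (fastforce simp: indicator_def)
  qed simp
  have "expectation (\<lambda>\<omega>. h \<omega> * indicator S \<omega>) = expectation (\<lambda>\<omega>. h \<omega> * real_cond_exp M G (indicator S) \<omega>)"
    by (rule real_cond_exp_intg(2)[symmetric, OF int h(1)]) simp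
  also have "\<dots> = expectation (\<lambda>\<omega>. h \<omega> * p)"
    using AE by (intro integral_cong_AE) auto
  finally show ?thesis by simp
qed

lemma integral_double_sum:
  fixes h :: "'i \<Rightarrow> 'j \<Rightarrow> 'a \<Rightarrow> real"
  assumes "\<And>i j. i \<in> I \<Longrightarrow> j \<in> J \<Longrightarrow> integrable M (h i j)"
  shows "(\<integral>\<omega>. (\<Sum>i\<in>I. \<Sum>j\<in>J. h i j \<omega>) \<partial>M) = (\<Sum>i\<in>I. \<Sum>j\<in>J. integral\<^sup>L M (h i j))"
proof -
  have "(\<integral>\<omega>. (\<Sum>i\<in>I. \<Sum>j\<in>J. h i j \<omega>) \<partial>M) = (\<Sum>i\<in>I. \<integral>\<omega>. (\<Sum>j\<in>J. h i j \<omega>) \<partial>M)"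
    by (intro Bochner_Integration.integral_sum Bochner_Integration.integrable_sum assms)
  also have "\<dots> = (\<Sum>i\<in>I. \<Sum>j\<in>J. integral\<^sup>L M (h i j))"
    by (intro sum.cong refl Bochner_Integration.integral_sum assms)
  finally show ?thesis .
qed

locale uniform_sampling = prob_space M
  for M :: "'w measure" +
  fixes G :: "'w measure" and m b :: nat and ind :: "nat \<Rightarrow> 'w \<Rightarrow> nat"
  assumes sub: "subalgebra M G" and m_pos: "1 \<le> m" and b_pos: "0 < b"
    and ind_measurable: "j \<in> {1..b} \<Longrightarrow> ind j \<in> measurable M (count_space {1..m})"
    and ind_uniform: "j \<in> {1..b} \<Longrightarrow> distr M (count_space {1..m}) (ind j) = uniform_count_measure {1..m}"
    and ind_indep: "indep_sets (\<lambda>j. if j = 0 then sets G else {ind j -` B \<inter> space M |B. B \<subseteq> {1..m}}) {0..b}"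
begin

definition picks :: "nat \<Rightarrow> nat \<Rightarrow> 'w set" where
  "picks j i = ind j -` {i} \<inter> space M"

lemma picks_events: "j \<in> {1..b} \<Longrightarrow> i \<in> {1..m} \<Longrightarrow> picks j i \<in> events"
  unfolding picks_def using ind_measurable by (rule measurable_sets) auto

lemma prob_picks: "j \<in> {1..b} \<Longrightarrow> i \<in> {1..m} \<Longrightarrow> prob (picks j i) = 1 / real m"
proof -
  assume j: "j \<in> {1..b}" and i: "i \<in> {1..m}"
  have "prob (picks j i) = measure (distr M (count_space {1..m}) (ind j)) {i}"
    unfolding picks_def using ind_measurable[OF j] i by (subst measure_distr) auto
  also have "\<dots> = 1 / real m"
    unfolding ind_uniform[OF j] using i by (subst measure_uniform_count_measure) auto
  finally show ?thesis .
qed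

lemma ind_in: "j \<in> {1..b} \<Longrightarrow> \<omega> \<in> space M \<Longrightarrow> ind j \<omega> \<in> {1..m}"
  using measurable_space[OF ind_measurable] by simp

lemma prob_pick1:
  assumes "B \<in> sets G" "j \<in> {1..b}" "i \<in> {1..m}"
  shows "prob (B \<inter> picks j i) = prob B * (1 / real m)"
proof -
  let ?A = "\<lambda>k. if k = 0 then B else picks j i"
  have "prob (\<Inter>k\<in>{0, j}. ?A k) = (\<Prod>k\<in>{0, j}. prob (?A k))"
    using assms by (intro indep_setsD[OF ind_indep]) (auto simp: picks_def intro!: exI[of _ "{i}"])
  then show ?thesis using assms prob_picks by simp
qed

lemma prob_pick2:
  assumes "B \<in> sets G" "j \<in> {1..b}" "l \<in> {1..b}" "j \<noteq> l" "i \<in> {1..m}" "i' \<in> {1..m}"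
  shows "prob (B \<inter> (picks j i \<inter> picks l i')) = prob B * (1 / (real m)\<^sup>2)"
proof -
  let ?A = "\<lambda>k. if k = 0 then B else if k = j then picks j i else picks l i'"
  have "prob (\<Inter>k\<in>{0, j, l}. ?A k) = (\<Prod>k\<in>{0, j, l}. prob (?A k))"
    using assms by (intro indep_setsD[OF ind_indep])
      (auto simp: picks_def intro: exI[of _ "{i}"] exI[of _ "{i'}"])
  then show ?thesis using assms prob_picks by (simp add: power2_eq_square Int_ac)
qed

context
  fixes h :: "nat \<Rightarrow> 'w \<Rightarrow> real" and Bd :: real
  assumes h: "\<And>i. i \<in> {1..m} \<Longrightarrow> h i \<in> borel_measurable G"
    "\<And>i \<omega>. i \<in> {1..m} \<Longrightarrow> \<omega> \<in> space M \<Longrightarrow> \<bar>h i \<omega>\<bar> \<le> Bd"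
begin

lemma integrable_bounded: "i \<in> {1..m} \<Longrightarrow> integrable M (h i)"
  by (rule integrable_const_bound[where B=Bd])
    (auto intro!: AE_I2 h(2) measurable_from_subalg[OF sub h(1)])

text \<open>Expanding the random index into indicators leaves integrands with a fixed index, which
  are measurable in the past and thus independent of the sample.\<close>

lemma pick_sum:
  assumes "j \<in> {1..b}" "\<omega> \<in> space M"
  shows "h (ind j \<omega>) \<omega> = (\<Sum>i=1..m. h i \<omega> * indicator (picks j i) \<omega>)"
proof -
  have "(\<Sum>i=1..m. h i \<omega> * indicator (picks j i) \<omega>) = (\<Sum>i=1..m. if i = ind j \<omega> then h i \<omega> else 0)"
    using assms by (intro sum.cong refl) (auto simp: picks_def indicator_def)
  also have "\<dots> = h (ind j \<omega>) \<omega>" using ind_in[OF assms] by (simp add: sum.delta)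
  finally show ?thesis by simp
qed

lemma integrable_indicator:
  assumes "A \<in> events" "i \<in> {1..m}"
  shows "integrable M (\<lambda>\<omega>. h i \<omega> * indicator A \<omega>)"
  using integrable_real_mult_indicator[OF assms(1) integrable_bounded[OF assms(2)]] .

lemma integrable_pick: "j \<in> {1..b} \<Longrightarrow> integrable M (\<lambda>\<omega>. h (ind j \<omega>) \<omega>)"
  by (subst Bochner_Integration.integrable_cong[OF refl pick_sum], assumption, assumption)
    (intro Bochner_Integration.integrable_sum integrable_indicator picks_events)

lemma expectation_pick:
  assumes j: "j \<in> {1..b}"
  shows "expectation (\<lambda>\<omega>. h (ind j \<omega>) \<omega>) = (\<Sum>i=1..m. expectation (h i)) / real m"
proof -
  have "expectation (\<lambda>\<omega>. h (ind j \<omega>) \<omega>) = expectation (\<lambda>\<omega>. \<Sum>i=1..m. h i \<omega> * indicator (picks j i) \<omega>)"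
    by (rule Bochner_Integration.integral_cong[OF refl pick_sum[OF j]])
  also have "\<dots> = (\<Sum>i=1..m. expectation (\<lambda>\<omega>. h i \<omega> * indicator (picks j i) \<omega>))"
    using j by (intro Bochner_Integration.integral_sum integrable_indicator picks_events) auto
  also have "\<dots> = (\<Sum>i=1..m. 1 / real m * expectation (h i))"
    using j h prob_pick1 picks_events
    by (intro sum.cong refl expectation_mult_indicator_indep[OF sub, where Bd=Bd]) auto
  finally show ?thesis by (simp add: sum_divide_distrib)
qed

end

lemma expectation_pick2:
  fixes h :: "nat \<Rightarrow> nat \<Rightarrow> 'w \<Rightarrow> real"
  assumes h: "\<And>i i'. i \<in> {1..m} \<Longrightarrow> i' \<in> {1..m} \<Longrightarrow> h i i' \<in> borel_measurable G"
    "\<And>i i' \<omega>. i \<in> {1..m} \<Longrightarrow> i' \<in> {1..m} \<Longrightarrow> \<omega> \<in> space M \<Longrightarrow> \<bar>h i i' \<omega>\<bar> \<le> Bd"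
    and jl: "j \<in> {1..b}" "l \<in> {1..b}" "j \<noteq> l"
  shows "expectation (\<lambda>\<omega>. h (ind j \<omega>) (ind l \<omega>) \<omega>) = (\<Sum>i=1..m. \<Sum>i'=1..m. expectation (h i i')) / (real m)\<^sup>2"
    "integrable M (\<lambda>\<omega>. h (ind j \<omega>) (ind l \<omega>) \<omega>)"
proof -
  have eq: "h (ind j \<omega>) (ind l \<omega>) \<omega> = (\<Sum>i=1..m. \<Sum>i'=1..m. h i i' \<omega> * indicator (picks j i \<inter> picks l i') \<omega>)"
    if "\<omega> \<in> space M" for \<omega>
  proof -
    have "(\<Sum>i=1..m. \<Sum>i'=1..m. h i i' \<omega> * indicator (picks j i \<inter> picks l i') \<omega>)
        = (\<Sum>i=1..m. if i = ind j \<omega> then (\<Sum>i'=1..m. if i' = ind l \<omega> then h i i' \<omega> else 0) else 0)"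
      using that by (intro sum.cong refl) (auto simp: picks_def indicator_def intro!: sum.cong sum.neutral)
    also have "\<dots> = h (ind j \<omega>) (ind l \<omega>) \<omega>"
      using ind_in[OF jl(1) that] ind_in[OF jl(2) that] by (simp add: sum.delta)
    finally show ?thesis by simp
  qed
  have ev: "picks j i \<inter> picks l i' \<in> events" if "i \<in> {1..m}" "i' \<in> {1..m}" for i i'
    using picks_events jl that by auto
  have int: "integrable M (\<lambda>\<omega>. h i i' \<omega> * indicator (picks j i \<inter> picks l i') \<omega>)"
    if "i \<in> {1..m}" "i' \<in> {1..m}" for i i'
    using that by (intro integrable_real_mult_indicator ev integrable_const_bound[where B=Bd])
      (auto intro!: h measurable_from_subalg[OF sub])
  show "integrable M (\<lambda>\<omega>. h (ind j \<omega>) (ind l \<omega>) \<omega>)"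
    by (subst Bochner_Integration.integrable_cong[OF refl eq], assumption)
      (intro Bochner_Integration.integrable_sum int)
  have "expectation (\<lambda>\<omega>. h (ind j \<omega>) (ind l \<omega>) \<omega>)
      = expectation (\<lambda>\<omega>. \<Sum>i=1..m. \<Sum>i'=1..m. h i i' \<omega> * indicator (picks j i \<inter> picks l i') \<omega>)"
    by (rule Bochner_Integration.integral_cong[OF refl eq])
  also have "\<dots> = (\<Sum>i=1..m. \<Sum>i'=1..m. expectation (\<lambda>\<omega>. h i i' \<omega> * indicator (picks j i \<inter> picks l i') \<omega>))"
    by (rule integral_double_sum) (rule int)
  also have "\<dots> = (\<Sum>i=1..m. \<Sum>i'=1..m. 1 / (real m)\<^sup>2 * expectation (h i i'))"
    using jl h prob_pick2 ev
    by (intro sum.cong refl expectation_mult_indicator_indep[OF sub, where Bd=Bd]) auto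
  finally show "expectation (\<lambda>\<omega>. h (ind j \<omega>) (ind l \<omega>) \<omega>) = (\<Sum>i=1..m. \<Sum>i'=1..m. expectation (h i i')) / (real m)\<^sup>2"
    by (simp add: sum_divide_distrib)
qed

section \<open>Bias and variance of a sample mean given the past\<close>

definition avg :: "(nat \<Rightarrow> 'w \<Rightarrow> 'a::euclidean_space) \<Rightarrow> 'w \<Rightarrow> 'a" where
  "avg \<phi> \<omega> = (1 / real m) *\<^sub>R (\<Sum>i=1..m. \<phi> i \<omega>)"

definition err :: "(nat \<Rightarrow> 'w \<Rightarrow> 'a::euclidean_space) \<Rightarrow> 'w \<Rightarrow> 'a" where
  "err \<phi> \<omega> = (1 / real b) *\<^sub>R (\<Sum>j=1..b. \<phi> (ind j \<omega>) \<omega>) - avg \<phi> \<omega>"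

context
  fixes \<phi> :: "nat \<Rightarrow> 'w \<Rightarrow> 'a::euclidean_space" and Bd :: real
  assumes \<phi>: "\<And>i. i \<in> {1..m} \<Longrightarrow> \<phi> i \<in> borel_measurable G"
    "\<And>i \<omega>. i \<in> {1..m} \<Longrightarrow> \<omega> \<in> space M \<Longrightarrow> norm (\<phi> i \<omega>) \<le> Bd"
begin

lemma avg_measurable: "avg \<phi> \<in> borel_measurable G"
  unfolding avg_def using \<phi>(1) by (intro borel_measurable_scaleR borel_measurable_sum) auto

lemma avg_bound: "\<omega> \<in> space M \<Longrightarrow> norm (avg \<phi> \<omega>) \<le> Bd"
proof -
  assume "\<omega> \<in> space M"
  then have "norm (\<Sum>i=1..m. \<phi> i \<omega>) \<le> (\<Sum>i=1..m. Bd)"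
    using \<phi>(2) by (intro order_trans[OF norm_sum] sum_mono) auto
  then show ?thesis using m_pos by (simp add: avg_def divide_le_eq mult.commute)
qed

lemma err_bound: "\<omega> \<in> space M \<Longrightarrow> norm (err \<phi> \<omega>) \<le> 2 * Bd"
proof -
  assume \<omega>: "\<omega> \<in> space M"
  then have "norm (\<Sum>j=1..b. \<phi> (ind j \<omega>) \<omega>) \<le> (\<Sum>j=1..b. Bd)"
    using \<phi>(2) ind_in by (intro order_trans[OF norm_sum] sum_mono) auto
  then have "norm ((1 / real b) *\<^sub>R (\<Sum>j=1..b. \<phi> (ind j \<omega>) \<omega>)) \<le> Bd"
    using b_pos by (simp add: divide_le_eq mult.commute)
  then show ?thesis
    using norm_triangle_ineq4[of "(1 / real b) *\<^sub>R (\<Sum>j=1..b. \<phi> (ind j \<omega>) \<omega>)" "avg \<phi> \<omega>"] avg_bound[OF \<omega>]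
    by (simp add: err_def)
qed

lemma inner_bound: "norm u \<le> B1 \<Longrightarrow> norm w \<le> B2 \<Longrightarrow> \<bar>u \<bullet> w\<bar> \<le> B1 * B2" for u w :: 'a
  using Cauchy_Schwarz_ineq2[of u w] mult_mono[of "norm u" B1 "norm w" B2]
  by (meson norm_ge_zero order_trans)

lemma err_unbiased:
  assumes W: "W \<in> borel_measurable G" "\<And>\<omega>. \<omega> \<in> space M \<Longrightarrow> norm (W \<omega>) \<le> B2"
  shows "expectation (\<lambda>\<omega>. err \<phi> \<omega> \<bullet> W \<omega>) = 0"
proof -
  let ?h = "\<lambda>i \<omega>. \<phi> i \<omega> \<bullet> W \<omega>"
  have h: "?h i \<in> borel_measurable G" "\<And>\<omega>. \<omega> \<in> space M \<Longrightarrow> \<bar>?h i \<omega>\<bar> \<le> Bd * B2" if "i \<in> {1..m}" for i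
    using that \<phi> W by (auto intro!: inner_bound)
  have "expectation (\<lambda>\<omega>. err \<phi> \<omega> \<bullet> W \<omega>)
      = expectation (\<lambda>\<omega>. (\<Sum>j=1..b. ?h (ind j \<omega>) \<omega>) / real b - (\<Sum>i=1..m. ?h i \<omega>) / real m)"
    by (simp add: err_def avg_def inner_diff_left inner_sum_left)
  also have "\<dots> = (\<Sum>j=1..b. expectation (\<lambda>\<omega>. ?h (ind j \<omega>) \<omega>)) / real b - (\<Sum>i=1..m. expectation (?h i)) / real m"
  proof -
    have 1: "integrable M (\<lambda>\<omega>. ?h (ind j \<omega>) \<omega>)" if "j \<in> {1..b}" for j
      by (rule integrable_pick[of ?h "Bd * B2", OF h that])
    have 2: "integrable M (?h i)" if "i \<in> {1..m}" for i
      by (rule integrable_bounded[of ?h "Bd * B2", OF h that])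
    show ?thesis
      using 1 2 by (subst Bochner_Integration.integral_diff)
        (auto intro!: integrable_divide Bochner_Integration.integrable_sum simp only: integral_divide_zero Bochner_Integration.integral_sum)
  qed
  also have "(\<Sum>j=1..b. expectation (\<lambda>\<omega>. ?h (ind j \<omega>) \<omega>)) = (\<Sum>j=1..b. (\<Sum>i=1..m. expectation (?h i)) / real m)"
    by (intro sum.cong refl expectation_pick[of ?h "Bd * B2"] h)
  finally show ?thesis using b_pos by simp
qed

text \<open>Deviations of distinct samples from the mean are uncorrelated because both cross moments
  equal that of the mean. Only the \<open>b\<close> diagonal terms survive, and centring can only
  lower their second moment.\<close>

lemma err_variance:
  "expectation (\<lambda>\<omega>. (norm (err \<phi> \<omega>))\<^sup>2) \<le> expectation (\<lambda>\<omega>. (\<Sum>i=1..m. (norm (\<phi> i \<omega>))\<^sup>2) / real m) / real b"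
proof -
  let ?U = "\<lambda>j \<omega>. \<phi> (ind j \<omega>) \<omega>"
  let ?d = "\<lambda>j \<omega>. ?U j \<omega> - avg \<phi> \<omega>"
  define a where "a = expectation (\<lambda>\<omega>. avg \<phi> \<omega> \<bullet> avg \<phi> \<omega>)"
  have int_a: "integrable M (\<lambda>\<omega>. avg \<phi> \<omega> \<bullet> avg \<phi> \<omega>)"
  proof (rule integrable_const_bound[where B="Bd * Bd"])
    show "AE \<omega> in M. norm (avg \<phi> \<omega> \<bullet> avg \<phi> \<omega>) \<le> Bd * Bd"
      unfolding real_norm_def by (intro AE_I2 inner_bound avg_bound)
  qed (intro borel_measurable_inner measurable_from_subalg[OF sub avg_measurable])
  let ?h1 = "\<lambda>i \<omega>. \<phi> i \<omega> \<bullet> avg \<phi> \<omega>" and ?h2 = "\<lambda>i i' \<omega>. \<phi> i \<omega> \<bullet> \<phi> i' \<omega>" and ?h3 = "\<lambda>i \<omega>. \<phi> i \<omega> \<bullet> \<phi> i \<omega>"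
  have h1: "?h1 i \<in> borel_measurable G" "\<And>\<omega>. \<omega> \<in> space M \<Longrightarrow> \<bar>?h1 i \<omega>\<bar> \<le> Bd * Bd" if "i \<in> {1..m}" for i
    using that \<phi> avg_measurable avg_bound by (auto intro!: inner_bound)
  have h2: "?h2 i i' \<in> borel_measurable G" "\<And>\<omega>. \<omega> \<in> space M \<Longrightarrow> \<bar>?h2 i i' \<omega>\<bar> \<le> Bd * Bd"
    if "i \<in> {1..m}" "i' \<in> {1..m}" for i i'
    using that \<phi> by (auto intro!: inner_bound)
  have int2: "integrable M (?h2 i i')" if "i \<in> {1..m}" "i' \<in> {1..m}" for i i'
    by (rule integrable_const_bound[where B="Bd * Bd"])
      (use h2[OF that] measurable_from_subalg[OF sub h2(1)[OF that]] in auto)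
  have E1: "expectation (\<lambda>\<omega>. ?U j \<omega> \<bullet> avg \<phi> \<omega>) = a" if j: "j \<in> {1..b}" for j
  proof -
    have "expectation (\<lambda>\<omega>. ?U j \<omega> \<bullet> avg \<phi> \<omega>) = (\<Sum>i=1..m. expectation (?h1 i)) / real m"
      by (rule expectation_pick[of ?h1 "Bd * Bd", OF h1 j])
    also have "\<dots> = expectation (\<lambda>\<omega>. (\<Sum>i=1..m. ?h1 i \<omega>) / real m)"
      using integrable_bounded[of ?h1 "Bd * Bd", OF h1] by (simp add: Bochner_Integration.integral_sum)
    also have "(\<lambda>\<omega>. (\<Sum>i=1..m. ?h1 i \<omega>) / real m) = (\<lambda>\<omega>. avg \<phi> \<omega> \<bullet> avg \<phi> \<omega>)"
    proof
      fix \<omega>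
      have "avg \<phi> \<omega> \<bullet> avg \<phi> \<omega> = ((1 / real m) *\<^sub>R (\<Sum>i=1..m. \<phi> i \<omega>)) \<bullet> avg \<phi> \<omega>"
        by (subst avg_def) simp
      then show "(\<Sum>i=1..m. ?h1 i \<omega>) / real m = avg \<phi> \<omega> \<bullet> avg \<phi> \<omega>"
        by (simp add: inner_sum_left)
    qed
    finally show ?thesis by (simp add: a_def)
  qed
  have E2: "expectation (\<lambda>\<omega>. ?U j \<omega> \<bullet> ?U l \<omega>) = a" if "j \<in> {1..b}" "l \<in> {1..b}" "j \<noteq> l" for j l
  proof -
    have "expectation (\<lambda>\<omega>. ?U j \<omega> \<bullet> ?U l \<omega>) = (\<Sum>i=1..m. \<Sum>i'=1..m. expectation (?h2 i i')) / (real m)\<^sup>2"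
      by (rule expectation_pick2(1)[of ?h2 "Bd * Bd", OF h2 that])
    also have "\<dots> = expectation (\<lambda>\<omega>. (\<Sum>i=1..m. \<Sum>i'=1..m. ?h2 i i' \<omega>) / (real m)\<^sup>2)"
      unfolding integral_divide_zero by (subst integral_double_sum) (auto intro: int2)
    also have "(\<lambda>\<omega>. (\<Sum>i=1..m. \<Sum>i'=1..m. ?h2 i i' \<omega>) / (real m)\<^sup>2) = (\<lambda>\<omega>. avg \<phi> \<omega> \<bullet> avg \<phi> \<omega>)"
    proof
      fix \<omega>
      have "(\<Sum>i=1..m. \<Sum>i'=1..m. ?h2 i i' \<omega>) = (\<Sum>i=1..m. \<phi> i \<omega>) \<bullet> (\<Sum>i=1..m. \<phi> i \<omega>)"
        by (subst inner_sum_left) (simp add: inner_sum_right)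
      then show "(\<Sum>i=1..m. \<Sum>i'=1..m. ?h2 i i' \<omega>) / (real m)\<^sup>2 = avg \<phi> \<omega> \<bullet> avg \<phi> \<omega>"
        by (simp add: avg_def power2_eq_square)
    qed
    finally show ?thesis by (simp add: a_def)
  qed
  have E3: "expectation (\<lambda>\<omega>. ?U j \<omega> \<bullet> ?U j \<omega>) = (\<Sum>i=1..m. expectation (?h3 i)) / real m" if "j \<in> {1..b}" for j
    by (rule expectation_pick[of ?h3 "Bd * Bd", OF h2(1) h2(2) that])
  have I: "integrable M (\<lambda>\<omega>. ?U j \<omega> \<bullet> avg \<phi> \<omega>)" "integrable M (\<lambda>\<omega>. ?U j \<omega> \<bullet> ?U l \<omega>)"
    if "j \<in> {1..b}" "l \<in> {1..b}" for j l
  proof -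
    show "integrable M (\<lambda>\<omega>. ?U j \<omega> \<bullet> avg \<phi> \<omega>)"
      by (rule integrable_pick[of ?h1 "Bd * Bd", OF h1 that(1)])
    show "integrable M (\<lambda>\<omega>. ?U j \<omega> \<bullet> ?U l \<omega>)"
    proof (cases "j = l")
      case True
      show ?thesis unfolding True
        by (rule integrable_pick[of ?h3 "Bd * Bd", OF h2(1) h2(2) that(2)])
    next
      case False
      show ?thesis by (rule expectation_pick2(2)[of ?h2 "Bd * Bd", OF h2 that False])
    qed
  qed
  have dd: "?d j \<omega> \<bullet> ?d l \<omega> = ?U j \<omega> \<bullet> ?U l \<omega> - ?U j \<omega> \<bullet> avg \<phi> \<omega> - ?U l \<omega> \<bullet> avg \<phi> \<omega> + avg \<phi> \<omega> \<bullet> avg \<phi> \<omega>" for j l \<omega>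
    by (simp add: inner_diff_left inner_diff_right inner_commute)
  have Id: "integrable M (\<lambda>\<omega>. ?d j \<omega> \<bullet> ?d l \<omega>)" if "j \<in> {1..b}" "l \<in> {1..b}" for j l
    unfolding dd using I(1)[OF that] I(1)[OF that(2,1)] I(2)[OF that] int_a by auto
  have Ed: "expectation (\<lambda>\<omega>. ?d j \<omega> \<bullet> ?d l \<omega>) = expectation (\<lambda>\<omega>. ?U j \<omega> \<bullet> ?U l \<omega>) - a" if "j \<in> {1..b}" "l \<in> {1..b}" for j l
    unfolding dd using I(1)[OF that] I(1)[OF that(2,1)] I(2)[OF that] int_a E1[OF that(1)] E1[OF that(2)]
    by (simp add: a_def)
  have err: "err \<phi> \<omega> = (1 / real b) *\<^sub>R (\<Sum>j=1..b. ?d j \<omega>)" for \<omega>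
    using b_pos by (simp add: err_def sum_subtractf scaleR_diff_right sum_constant_scaleR)
  have "expectation (\<lambda>\<omega>. (norm (err \<phi> \<omega>))\<^sup>2)
      = expectation (\<lambda>\<omega>. (\<Sum>j=1..b. \<Sum>l=1..b. ?d j \<omega> \<bullet> ?d l \<omega>) / (real b)\<^sup>2)"
  proof -
    have "(norm (err \<phi> \<omega>))\<^sup>2 = (\<Sum>j=1..b. \<Sum>l=1..b. ?d j \<omega> \<bullet> ?d l \<omega>) / (real b)\<^sup>2" for \<omega>
    proof -
      have "(norm (err \<phi> \<omega>))\<^sup>2 = ((\<Sum>j=1..b. ?d j \<omega>) \<bullet> (\<Sum>j=1..b. ?d j \<omega>)) / (real b)\<^sup>2"
        unfolding err power2_norm_eq_inner by (simp add: power2_eq_square)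
      also have "(\<Sum>j=1..b. ?d j \<omega>) \<bullet> (\<Sum>j=1..b. ?d j \<omega>) = (\<Sum>j=1..b. \<Sum>l=1..b. ?d j \<omega> \<bullet> ?d l \<omega>)"
        by (subst inner_sum_left) (simp only: inner_sum_right)
      finally show ?thesis .
    qed
    then show ?thesis by simp
  qed
  also have "\<dots> = (\<Sum>j=1..b. \<Sum>l=1..b. expectation (\<lambda>\<omega>. ?d j \<omega> \<bullet> ?d l \<omega>)) / (real b)\<^sup>2"
    unfolding integral_divide_zero by (subst integral_double_sum) (auto intro: Id)
  also have "(\<Sum>j=1..b. \<Sum>l=1..b. expectation (\<lambda>\<omega>. ?d j \<omega> \<bullet> ?d l \<omega>))
      = (\<Sum>j=1..b. \<Sum>l=1..b. if l = j then (\<Sum>i=1..m. expectation (?h3 i)) / real m - a else 0)"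
    by (intro sum.cong refl) (auto simp: Ed E2 E3)
  also have "\<dots> = real b * ((\<Sum>i=1..m. expectation (?h3 i)) / real m - a)"
    by (simp add: sum.delta)
  also have "\<dots> / (real b)\<^sup>2 \<le> (\<Sum>i=1..m. expectation (?h3 i)) / real m / real b"
  proof -
    have "0 \<le> a" unfolding a_def by (rule Bochner_Integration.integral_nonneg) simp
    then show ?thesis using b_pos by (simp add: power2_eq_square field_simps)
  qed
  also have "(\<Sum>i=1..m. expectation (?h3 i)) / real m = expectation (\<lambda>\<omega>. (\<Sum>i=1..m. (norm (\<phi> i \<omega>))\<^sup>2) / real m)"
    using int2 by (simp add: Bochner_Integration.integral_sum power2_norm_eq_inner)
  finally show ?thesis .
qed

end

end

section \<open>Diagonal scalings and subproblems\<close>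

text \<open>The clipped matrix as an operator, read off the diagonal of an arbitrary matrix. This
  makes it jointly continuous in matrix and vector, hence measurable along random matrices.\<close>

definition diag_scale :: "real \<Rightarrow> real \<Rightarrow> real^'n^'n \<Rightarrow> real^'n \<Rightarrow> real^'n" where
  "diag_scale l u A w = (\<chi> i. max l (min u (A $ i $ i)) * w $ i)"

lemma clip_diagonal_mult:
  assumes "is_diagonal A"
  shows "clip_diagonal l u A *v w = diag_scale l u A w"
proof -
  have "(\<Sum>j\<in>UNIV. clip_diagonal l u A $ i $ j * w $ j) = max l (min u (A $ i $ i)) * w $ i" for i
  proof -
    have "(\<Sum>j\<in>UNIV. clip_diagonal l u A $ i $ j * w $ j)
        = (\<Sum>j\<in>UNIV. if i = j then max l (min u (A $ i $ j)) * w $ j else 0)"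
      using assms by (intro sum.cong refl) (auto simp: clip_diagonal_def is_diagonal_def)
    then show ?thesis by simp
  qed
  then show ?thesis by (simp add: vec_eq_iff matrix_vector_mult_def diag_scale_def)
qed

lemma linear_diag_scale: "linear (diag_scale l u A)"
  by (rule linearI) (simp_all add: diag_scale_def vec_eq_iff algebra_simps)

lemma diag_scale_sym: "z \<bullet> diag_scale l u A w = diag_scale l u A z \<bullet> w"
  by (simp add: diag_scale_def inner_vec_def mult_ac)

lemma diag_scale_lower: "l * (norm w)\<^sup>2 \<le> w \<bullet> diag_scale l u A w"
proof -
  have "l * (norm w)\<^sup>2 = (\<Sum>i\<in>UNIV. l * (w $ i * w $ i))"
    by (simp add: power2_norm_eq_inner inner_vec_def sum_distrib_left)
  also have "\<dots> \<le> (\<Sum>i\<in>UNIV. max l (min u (A $ i $ i)) * (w $ i * w $ i))"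
    by (intro sum_mono mult_right_mono) auto
  also have "\<dots> = w \<bullet> diag_scale l u A w"
    by (simp add: diag_scale_def inner_vec_def mult_ac)
  finally show ?thesis .
qed

lemma norm_diag_scale_le:
  assumes "0 \<le> l" "l \<le> u"
  shows "norm (diag_scale l u A w) \<le> u * norm w"
proof -
  have "norm (diag_scale l u A w) \<le> norm (u *\<^sub>R w)"
    using assms by (intro norm_le_componentwise_cart) (auto simp: diag_scale_def abs_mult intro!: mult_right_mono)
  then show ?thesis using assms by simp
qed

lemma continuous_on_diag_scale: "continuous_on UNIV (\<lambda>p. diag_scale l u (fst p) (snd p))"
  unfolding diag_scale_def by (intro continuous_intros)

lemma norm_wrt_clip_diagonal:
  assumes "is_diagonal A" "0 \<le> l"
  shows "(norm_wrt (clip_diagonal l u A) w)\<^sup>2 = w \<bullet> diag_scale l u A w"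
proof -
  have "0 \<le> w \<bullet> diag_scale l u A w"
    using assms(2) by (intro order_trans[OF _ diag_scale_lower]) simp
  then show ?thesis by (simp add: norm_wrt_def clip_diagonal_mult[OF assms(1)])
qed

lemma gradient_subproblem:
  assumes "is_diagonal A" "0 \<le> l"
  shows "gradient (subproblem fx g \<eta> (clip_diagonal l u A) x) z = g + (1 / \<eta>) *\<^sub>R diag_scale l u A (z - x)"
proof (rule gradient_eqI)
  let ?S = "diag_scale l u A"
  note [derivative_intros] = bounded_linear.has_derivative[OF linear_diag_scale[unfolded linear_conv_bounded_linear]]
  have eq: "subproblem fx g \<eta> (clip_diagonal l u A) x
      = (\<lambda>z. fx + g \<bullet> (z - x) + 1 / (2 * \<eta>) * ((z - x) \<bullet> ?S (z - x)))"
    by (rule ext) (simp add: subproblem_def norm_wrt_clip_diagonal[OF assms])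
  have "((\<lambda>z. fx + g \<bullet> (z - x) + c * ((z - x) \<bullet> ?S (z - x))) has_derivative
      (\<lambda>h. g \<bullet> h + c * ((z - x) \<bullet> ?S h + h \<bullet> ?S (z - x)))) (at z)" for c
    by (auto intro!: derivative_eq_intros)
  note this[of "1 / (2 * \<eta>)"]
  moreover have "g \<bullet> h + 1 / (2 * \<eta>) * ((z - x) \<bullet> ?S h + h \<bullet> ?S (z - x)) = h \<bullet> (g + (1 / \<eta>) *\<^sub>R ?S (z - x))" for h
    by (simp add: diag_scale_sym[of "z - x"] inner_commute inner_add_right)
  ultimately show "GDERIV (subproblem fx g \<eta> (clip_diagonal l u A) x) z :> g + (1 / \<eta>) *\<^sub>R ?S (z - x)"
    unfolding eq gderiv_def by simp
qed

text \<open>The Lipschitz hypothesis bounds the quotients, without which their supremum would be an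
  unspecified real.\<close>

lemma lipschitz_smoothness_const:
  assumes "i \<in> {1..m}" "B-lipschitz_on C (gradient (f i))" "u \<in> C" "w \<in> C"
  shows "norm (gradient (f i) u - gradient (f i) w) \<le> smoothness_const C m f * norm (u - w)"
proof (cases "u = w")
  case False
  let ?r = "\<lambda>i (x, y). norm (gradient (f i) y - gradient (f i) x) / norm (y - x)"
  let ?A = "{(x, y). x \<in> C \<and> y \<in> C \<and> x \<noteq> y}"
  have "bdd_above (?r i ` ?A)"
    using lipschitz_onD[OF assms(2)] by (intro bdd_aboveI[of _ B]) (auto simp: divide_le_eq dist_norm)
  then have "?r i (w, u) \<le> (SUP p\<in>?A. ?r i p)"
    using False assms by (intro cSUP_upper) auto
  also have "\<dots> \<le> smoothness_const C m f"
    unfolding smoothness_const_def using assms(1) by (intro Max_ge) auto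
  finally show ?thesis using False by (simp add: divide_le_eq)
qed simp

section \<open>Snapshots\<close>

fun last_in :: "nat set \<Rightarrow> nat \<Rightarrow> nat" where
  "last_in S 0 = 0"
| "last_in S (Suc t) = (if Suc t \<in> S then Suc t else last_in S t)"

lemma last_in_le: "last_in S t \<le> t"
  by (induction t) auto

text \<open>The second conjunct says that \<open>t\<close> comes before the next snapshot 2^(k+1) -
  1, which limits the age of the current one.\<close>

lemma last_in_dyadic:
  fixes S :: "nat set"
  defines "S \<equiv> range (\<lambda>k. 2 ^ k - 1)"
  shows "\<exists>k. last_in S t = 2 ^ k - 1 \<and> t + 1 < 2 ^ (k + 1)"
proof (induction t)
  case 0
  show ?case by (rule exI[of _ 0]) simp
next
  case (Suc t)
  show ?case
  proof (cases "Suc t \<in> S")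
    case True
    then obtain k where k: "Suc t = 2 ^ k - 1" by (auto simp: S_def)
    then have "Suc (Suc t) = 2 ^ k" by simp
    moreover have "last_in S (Suc t) = Suc t" using True by simp
    ultimately show ?thesis using k by (intro exI[of _ k] conjI) (rule trans, simp_all)
  next
    case False
    from Suc obtain k where k: "last_in S t = 2 ^ k - 1" "t + 1 < 2 ^ (k + 1)" by auto
    have "Suc t \<noteq> 2 ^ (k + 1) - 1" using False range_eqI[of "Suc t" "\<lambda>k. 2 ^ k - 1" "k + 1"] by (auto simp only: S_def)
    with k(2) have "Suc t + 1 < 2 ^ (k + 1)" by simp
    with False k(1) show ?thesis by auto
  qed
qed

section \<open>AdaSVRF\<close>

text \<open>\<open>L\<close> and \<open>D\<close> are only required as upper bounds. A one-point
  \<open>C\<close>, for which \<open>smoothness_const\<close> is unspecified, is therefore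
  covered.\<close>

locale adasvrf_rates = adasvrf M F C m f T x0 s b lm lp K \<eta> \<gamma> ind x xs g A H y v
  for M :: "'w measure" and F :: "nat \<Rightarrow> 'w measure"
    and C :: "(real^'n) set" and m :: nat and f :: "nat \<Rightarrow> real^'n \<Rightarrow> real" and T :: nat
    and x0 :: "real^'n" and s :: "nat \<Rightarrow> nat" and b :: "nat \<Rightarrow> nat"
    and lm lp :: "nat \<Rightarrow> real" and K :: nat and \<eta> \<gamma> :: "nat \<Rightarrow> real"
    and ind :: "nat \<Rightarrow> nat \<Rightarrow> 'w \<Rightarrow> nat"
    and x xs g :: "nat \<Rightarrow> 'w \<Rightarrow> real^'n"
    and A H :: "nat \<Rightarrow> 'w \<Rightarrow> real^'n^'n"
    and y v :: "nat \<Rightarrow> nat \<Rightarrow> 'w \<Rightarrow> real^'n" +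
  fixes L D \<kappa> :: real
  assumes compact: "compact C" and convex: "convex C" and summands: "1 \<le> m"
    and f_convex: "i \<in> {1..m} \<Longrightarrow> convex_on UNIV (f i)"
    and f_differentiable: "i \<in> {1..m} \<Longrightarrow> f i differentiable (at z)"
    and f_smooth: "i \<in> {1..m} \<Longrightarrow> u \<in> C \<Longrightarrow> w \<in> C \<Longrightarrow>
      norm (gradient (f i) u - gradient (f i) w) \<le> L * norm (u - w)"
    and C_diameter: "u \<in> C \<Longrightarrow> w \<in> C \<Longrightarrow> norm (u - w) \<le> D"
    and \<kappa>_eq: "\<kappa> = lp 0 / lm 0"
    and s_eq: "s k = 2 ^ k - 1"
    and b_eq: "b \<tau> = nat \<lceil>24 * (real K + 1 + \<kappa>) * (real \<tau> + 2)\<rceil>"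
    and \<eta>_eq: "\<eta> \<tau> = lm \<tau> / L"
    and \<gamma>_eq: "\<gamma> \<tau> = 2 / (real \<tau> + 2)"
begin

text \<open>Positivity comes from the learning rates: L = 0 would make them 0 by the convention for
  division.\<close>

lemma L_pos: "0 < L"
  using eta_pos[of 0] bounds(1)[of 0] by (simp add: \<eta>_eq zero_less_divide_iff)

sublocale fam: smooth_family C m f "\<lambda>i. gradient (f i)" L D "tangential_proj C"
proof (rule smooth_family.intro)
  have ne: "C \<noteq> {}" using x0_in by auto
  note P = tangential_proj[OF convex ne]
  show "linear (tangential_proj C)" by (rule P(1))
  show "norm (tangential_proj C z) \<le> norm z" for z by (rule P(2))
  show "\<exists>c\<in>C. \<exists>\<rho>>0. \<forall>z. norm (tangential_proj C z) \<le> \<rho> \<longrightarrow> c + tangential_proj C z \<in> C" by (rule P(4))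
  show "tangential_proj C z \<bullet> (u - w) = z \<bullet> (u - w)" if "u \<in> C" "w \<in> C" for z u w by (rule P(3)[OF that])
  show "f i u + gradient (f i) u \<bullet> (w - u) \<le> f i w" if "i \<in> {1..m}" for i u w
    by (rule convex_gradient_ineq[OF f_convex[OF that] f_differentiable[OF that]])
  show "f i w \<le> f i u + gradient (f i) u \<bullet> (w - u) + L / 2 * (norm (w - u))\<^sup>2"
    if "i \<in> {1..m}" "u \<in> C" "w \<in> C" for i u w
    by (rule descent_lemma[OF convex that(2,3) f_differentiable[OF that(1)] f_smooth[OF that(1)]])
qed (use compact convex summands L_pos C_diameter f_smooth in auto)

lemma finite_sum_eq: "finite_sum m f = fam.F"
  by (rule ext) (simp add: finite_sum_def fam.F_def)

lemma gradient_finite_sum: "gradient (finite_sum m f) z = fam.dF z"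
proof (rule gradient_eqI)
  have "((\<lambda>z. (\<Sum>i=1..m. f i z) / real m) has_derivative (\<lambda>h. (\<Sum>i=1..m. h \<bullet> gradient (f i) z) / real m)) (at z)"
    by (rule bounded_linear.has_derivative[OF bounded_linear_divide has_derivative_sum])
      (use GDERIV_gradient[OF f_differentiable] in \<open>simp add: gderiv_def\<close>)
  then show "GDERIV (finite_sum m f) z :> fam.dF z"
    unfolding gderiv_def finite_sum_def[abs_def] fam.dF_def by (simp add: inner_sum_right)
qed

lemma lm_le_lp: "lm t \<le> lp t"
  using bounds(2,3,4)[of t] by linarith

lemma \<kappa>_ge: "1 \<le> \<kappa>"
  using lm_le_lp[of 0] bounds(1)[of 0] by (simp add: \<kappa>_eq)

lemma lp_le: "lp t \<le> \<kappa> * lm t"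
proof -
  have "lp t \<le> lp 0" using lift_Suc_antimono_le[of lp 0 t, OF bounds(4)] by simp
  also have "\<dots> = \<kappa> * lm 0" using bounds(1)[of 0] by (simp add: \<kappa>_eq)
  also have "\<dots> \<le> \<kappa> * lm t"
    using \<kappa>_ge lift_Suc_mono_le[of lm 0 t, OF bounds(2)] by (intro mult_left_mono) auto
  finally show ?thesis .
qed

text \<open>The operator \<open>T\<close> of \<open>outer_step\<close>: the lower clipping bound
  divided by the learning rate is exactly \<open>L\<close>.\<close>

definition scale :: "nat \<Rightarrow> 'w \<Rightarrow> real^'n \<Rightarrow> real^'n" where
  "scale t \<omega> w = (1 / \<eta> t) *\<^sub>R diag_scale (lm t) (lp t) (A t \<omega>) w"

lemma subproblem_gradient:
  assumes "t < T" "\<omega> \<in> space M"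
  shows "gradient (subproblem fx u (\<eta> t) (H t \<omega>) z) w = u + scale t \<omega> (w - z)"
  using assms A_diagonal bounds(1)[of t] by (simp add: H_clip gradient_subproblem scale_def)

lemma step_eq:
  assumes "t < T" "\<omega> \<in> space M" "k < K"
  shows "y t (Suc k) \<omega> = y t k \<omega> + min (((g t \<omega> + scale t \<omega> (y t k \<omega> - x t \<omega>)) \<bullet> (y t k \<omega> - v t k \<omega>)) /
      ((v t k \<omega> - y t k \<omega>) \<bullet> scale t \<omega> (v t k \<omega> - y t k \<omega>))) (\<gamma> t) *\<^sub>R (v t k \<omega> - y t k \<omega>)"
proof -
  let ?S = "diag_scale (lm t) (lp t) (A t \<omega>)" and ?w = "y t k \<omega> - v t k \<omega>"
  have "(- w) \<bullet> scale t \<omega> (- w) = (w \<bullet> ?S w) / \<eta> t" for w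
    by (simp add: scale_def linear_neg[OF linear_diag_scale])
  from this[of ?w] have "(v t k \<omega> - y t k \<omega>) \<bullet> scale t \<omega> (v t k \<omega> - y t k \<omega>) = (?w \<bullet> ?S ?w) / \<eta> t"
    unfolding minus_diff_eq .
  moreover have "(norm_wrt (H t \<omega>) ?w)\<^sup>2 = ?w \<bullet> ?S ?w"
    using assms A_diagonal bounds(1)[of t] by (simp add: H_clip norm_wrt_clip_diagonal)
  ultimately show ?thesis
    using inner_step[OF assms(2,1,3)] by (simp add: subproblem_gradient[OF assms(1,2)] mult.commute[of "\<eta> t"])
qed

lemma outer_step_run:
  assumes t: "t < T" and \<omega>: "\<omega> \<in> space M" and x: "x t \<omega> \<in> C"
  shows "outer_step C m f (\<lambda>i. gradient (f i)) L D (tangential_proj C) (x t \<omega>) (g t \<omega>) (scale t \<omega>) \<kappa>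
    (2 / (real t + 2)) K (\<lambda>k. y t k \<omega>) (\<lambda>k. v t k \<omega>)"
proof (intro outer_step.intro outer_step_axioms.intro fam.smooth_family_axioms)
  have \<eta>: "1 / \<eta> t = L / lm t" by (simp add: \<eta>_eq)
  show "x t \<omega> \<in> C" by (rule x)
  show "linear (scale t \<omega>)"
    unfolding scale_def using linear_diag_scale by (rule linear_compose_scale_right)
  show "u \<bullet> scale t \<omega> w = scale t \<omega> u \<bullet> w" for u w
    by (simp add: scale_def diag_scale_sym)
  show "L * (norm w)\<^sup>2 \<le> w \<bullet> scale t \<omega> w" for w
    using mult_left_mono[OF diag_scale_lower[of "lm t" w "lp t" "A t \<omega>"], of "L / lm t"] L_pos bounds(1)[of t]
    by (simp add: scale_def \<eta>)
  show "norm (scale t \<omega> w) \<le> \<kappa> * L * norm w" for w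
  proof -
    have "norm (scale t \<omega> w) = L / lm t * norm (diag_scale (lm t) (lp t) (A t \<omega>) w)"
      using L_pos bounds(1)[of t] by (simp add: scale_def \<eta>)
    also have "\<dots> \<le> L / lm t * (\<kappa> * lm t * norm w)"
      using L_pos bounds(1)[of t] lm_le_lp[of t] lp_le[of t]
      by (intro mult_left_mono order_trans[OF norm_diag_scale_le] mult_right_mono) auto
    finally show ?thesis using bounds(1)[of t] by (simp add: mult_ac)
  qed
  show "y t 0 \<omega> = x t \<omega>" by (rule y_init[OF \<omega> t])
  show "v t k \<omega> \<in> C" if "k < K" for k
    using lmo[OF \<omega> t that] by (simp add: is_arg_min_def)
  show "(g t \<omega> + scale t \<omega> (y t k \<omega> - x t \<omega>)) \<bullet> v t k \<omega> \<le> (g t \<omega> + scale t \<omega> (y t k \<omega> - x t \<omega>)) \<bullet> u"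
    if "k < K" "u \<in> C" for k u
    using lmo[OF \<omega> t that(1)] that(2) by (auto simp: is_arg_min_def subproblem_gradient[OF t \<omega>] not_less)
  show "y t (Suc k) \<omega> = y t k \<omega> + min (((g t \<omega> + scale t \<omega> (y t k \<omega> - x t \<omega>)) \<bullet> (y t k \<omega> - v t k \<omega>)) /
      ((v t k \<omega> - y t k \<omega>) \<bullet> scale t \<omega> (v t k \<omega> - y t k \<omega>))) (2 / (real t + 2)) *\<^sub>R (v t k \<omega> - y t k \<omega>)"
    if "k < K" for k
    using step_eq[OF t \<omega> that] by (simp add: \<gamma>_eq)
qed (use K_pos \<kappa>_ge in auto)

lemma x_in: "t \<le> T \<Longrightarrow> \<omega> \<in> space M \<Longrightarrow> x t \<omega> \<in> C"
proof (induction t)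
  case 0
  then show ?case by (simp add: x_init x0_in)
next
  case (Suc t)
  then interpret outer_step C m f "\<lambda>i. gradient (f i)" L D "tangential_proj C" "x t \<omega>" "g t \<omega>" "scale t \<omega>" \<kappa>
    "2 / (real t + 2)" K "\<lambda>k. y t k \<omega>" "\<lambda>k. v t k \<omega>"
    by (intro outer_step_run) auto
  show ?case using Suc.prems y_in[of K] by (simp add: outer_step)
qed

section \<open>Snapshots and the gradient estimator\<close>

definition \<sigma> :: "nat \<Rightarrow> nat" where "\<sigma> = last_in (range s)"

lemma zero_snapshot: "0 \<in> range s"
  using snapshot_times(1) by (metis rangeI)

lemma \<sigma>_le: "\<sigma> t \<le> t"
  by (simp add: \<sigma>_def last_in_le)

lemma \<sigma>_recent:
  assumes "t \<notin> range s"
  shows "1 \<le> \<sigma> t" "t + 2 \<le> 2 * (\<sigma> t + 2)"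
proof -
  have "range s = range (\<lambda>k. 2 ^ k - 1)" using s_eq by auto
  with last_in_dyadic[of t] obtain k where k: "\<sigma> t = 2 ^ k - 1" "t + 1 < 2 ^ (k + 1)"
    by (auto simp: \<sigma>_def)
  have "t \<noteq> 0" using assms zero_snapshot by auto
  then have "k \<noteq> 0" using k(2) by (cases k) auto
  then have "(2::nat) ^ 1 \<le> 2 ^ k" by (intro power_increasing) auto
  then show "1 \<le> \<sigma> t" "t + 2 \<le> 2 * (\<sigma> t + 2)" using k by auto
qed

lemma xs_eq: "t < T \<Longrightarrow> \<omega> \<in> space M \<Longrightarrow> xs t \<omega> = x (\<sigma> t) \<omega>"
proof (induction t)
  case 0
  then show ?case using zero_snapshot by (simp add: snapshot \<sigma>_def)
next
  case (Suc t)
  then show ?case by (simp add: snapshot \<sigma>_def)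
qed

definition \<phi> :: "nat \<Rightarrow> nat \<Rightarrow> 'w \<Rightarrow> real^'n" where
  "\<phi> t i \<omega> = gradient (f i) (x t \<omega>) - gradient (f i) (x (\<sigma> t) \<omega>)"

lemma g_exact: "t < T \<Longrightarrow> \<omega> \<in> space M \<Longrightarrow> t \<in> range s \<Longrightarrow> g t \<omega> = fam.dF (x t \<omega>)"
  by (simp add: estimator snapshot gradient_finite_sum)

lemma g_sampled:
  "t < T \<Longrightarrow> \<omega> \<in> space M \<Longrightarrow> t \<notin> range s \<Longrightarrow>
    g t \<omega> = fam.dF (x (\<sigma> t) \<omega>) + (1 / real (b t)) *\<^sub>R (\<Sum>j=1..b t. \<phi> t (ind t j \<omega>) \<omega>)"
  using estimator[of \<omega> t] xs_eq[of t \<omega>] by (simp add: gradient_finite_sum \<phi>_def)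

section \<open>Measurability of the iterates\<close>

lemma measurable_F_mono: "h \<in> measurable (F i) N \<Longrightarrow> i \<le> j \<Longrightarrow> h \<in> measurable (F j) N"
  using sets_F_mono[of i j] by (auto simp: measurable_def space_F)

lemma measurable_F_M: "h \<in> measurable (F t) N \<Longrightarrow> h \<in> measurable M N"
  by (rule measurable_from_subalg[OF F_sub])

lemma measurable_comp_x:
  fixes h :: "real^'n \<Rightarrow> real^'n"
  assumes "continuous_on C h" "t \<le> T" "x t \<in> borel_measurable (F t)" "t \<le> t'"
  shows "(\<lambda>\<omega>. h (x t \<omega>)) \<in> borel_measurable (F t')"
  using x_in[OF assms(2)]
  by (rule measurable_continuous_on_comp[OF assms(1) compact_imp_closed[OF compact] measurable_F_mono[OF assms(3,4)]])
    (simp add: space_F)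

context
  fixes t
  assumes t: "t < T" and x_past: "\<And>r. r \<le> t \<Longrightarrow> x r \<in> borel_measurable (F r)"
begin

lemma measurable_comp_past:
  fixes h :: "real^'n \<Rightarrow> real^'n"
  assumes "continuous_on C h" "r \<le> t" "t \<le> t'"
  shows "(\<lambda>\<omega>. h (x r \<omega>)) \<in> borel_measurable (F t')"
  using t assms by (intro measurable_comp_x[OF assms(1) _ x_past[OF assms(2)]]) auto

lemma measurable_\<phi>_past:
  assumes "i \<in> {1..m}"
  shows "\<phi> t i \<in> borel_measurable (F t)"
  unfolding \<phi>_def
  by (rule borel_measurable_diff[OF measurable_comp_past measurable_comp_past])
    (use assms \<sigma>_le[of t] fam.continuous_on_df in auto)

lemma measurable_g_past: "g t \<in> borel_measurable (F (Suc t))"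
proof (cases "t \<in> range s")
  case True
  have "(\<lambda>\<omega>. fam.dF (x t \<omega>)) \<in> borel_measurable (F (Suc t))"
    by (rule measurable_comp_past[OF fam.continuous_on_dF]) auto
  then show ?thesis
    using g_exact[OF t _ True] by (subst measurable_cong) (auto simp: space_F)
next
  case False
  have "(\<lambda>\<omega>. \<phi> t (ind t j \<omega>) \<omega>) \<in> borel_measurable (F (Suc t))" if "j \<in> {1..b t}" for j
    by (rule measurable_compose_countable'[OF _ ind_measurable[OF t False that]])
      (auto intro!: measurable_F_mono[OF measurable_\<phi>_past])
  moreover have "(\<lambda>\<omega>. fam.dF (x (\<sigma> t) \<omega>)) \<in> borel_measurable (F (Suc t))"
    using \<sigma>_le[of t] by (intro measurable_comp_past[OF fam.continuous_on_dF]) auto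
  ultimately have "(\<lambda>\<omega>. fam.dF (x (\<sigma> t) \<omega>) + (1 / real (b t)) *\<^sub>R (\<Sum>j=1..b t. \<phi> t (ind t j \<omega>) \<omega>))
      \<in> borel_measurable (F (Suc t))"
    by (intro borel_measurable_add borel_measurable_scaleR borel_measurable_const borel_measurable_sum)
  then show ?thesis
    using g_sampled[OF t _ False] by (subst measurable_cong) (auto simp: space_F)
qed

lemma measurable_scale:
  assumes "w \<in> borel_measurable (F (Suc t))"
  shows "(\<lambda>\<omega>. scale t \<omega> (w \<omega>)) \<in> borel_measurable (F (Suc t))"
  unfolding scale_def
  by (rule borel_measurable_scaleR[OF borel_measurable_const
      borel_measurable_continuous_Pair[OF A_measurable[OF t] assms continuous_on_diag_scale]])

lemma measurable_y_past: "k \<le> K \<Longrightarrow> y t k \<in> borel_measurable (F (Suc t))"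
proof (induction k)
  case 0
  have "x t \<in> borel_measurable (F (Suc t))" using x_past by (rule measurable_F_mono) auto
  then show ?case using y_init[OF _ t] by (subst measurable_cong) (auto simp: space_F)
next
  case (Suc k)
  then have k: "k < K" by simp
  have [measurable]: "y t k \<in> borel_measurable (F (Suc t))" "v t k \<in> borel_measurable (F (Suc t))"
    "x t \<in> borel_measurable (F (Suc t))" "g t \<in> borel_measurable (F (Suc t))"
    using Suc v_measurable[OF t k] measurable_g_past measurable_F_mono[OF x_past, of t "Suc t"] by auto
  have [measurable]: "(\<lambda>\<omega>. scale t \<omega> (y t k \<omega> - x t \<omega>)) \<in> borel_measurable (F (Suc t))"
    "(\<lambda>\<omega>. scale t \<omega> (v t k \<omega> - y t k \<omega>)) \<in> borel_measurable (F (Suc t))"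
    by (intro measurable_scale; measurable)+
  show ?case
    by (subst measurable_cong[OF step_eq[OF t _ k]]) (simp add: space_F, measurable)
qed

lemma measurable_x_Suc: "x (Suc t) \<in> borel_measurable (F (Suc t))"
  using measurable_y_past[of K] outer_step[OF _ t] by (subst measurable_cong) (auto simp: space_F)

end

text \<open>Strong induction, because the estimator at \<open>t\<close> looks back to the iterate at
  the snapshot.\<close>

lemma measurable_x: "t \<le> T \<Longrightarrow> x t \<in> borel_measurable (F t)"
proof (induction t rule: less_induct)
  case (less t)
  show ?case
  proof (cases t)
    case 0
    show ?thesis unfolding 0 using x_init by (subst measurable_cong[where g="\<lambda>_. x0"]) (auto simp: space_F)
  next
    case (Suc r)
    show ?thesis unfolding Suc using less Suc by (intro measurable_x_Suc) auto
  qed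
qed

lemma measurable_\<phi>: "t < T \<Longrightarrow> i \<in> {1..m} \<Longrightarrow> (\<lambda>\<omega>. tangential_proj C (\<phi> t i \<omega>)) \<in> borel_measurable (F t)"
  using measurable_compose[OF measurable_\<phi>_past borel_measurable_continuous_onI[OF fam.continuous_on_P[OF continuous_on_id]]]
    measurable_x by auto

lemma \<phi>_bound: "t < T \<Longrightarrow> i \<in> {1..m} \<Longrightarrow> \<omega> \<in> space M \<Longrightarrow> norm (tangential_proj C (\<phi> t i \<omega>)) \<le> L * D"
proof -
  assume t: "t < T" and i: "i \<in> {1..m}" and \<omega>: "\<omega> \<in> space M"
  have x: "x t \<omega> \<in> C" "x (\<sigma> t) \<omega> \<in> C" using t \<sigma>_le[of t] \<omega> by (auto intro!: x_in)
  have "norm (tangential_proj C (\<phi> t i \<omega>)) \<le> L * norm (x t \<omega> - x (\<sigma> t) \<omega>)"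
    unfolding \<phi>_def by (rule order_trans[OF fam.P_norm f_smooth[OF i x]])
  also have "\<dots> \<le> L * D" using C_diameter[OF x] L_pos by simp
  finally show ?thesis .
qed

section \<open>The noise of the estimator\<close>

definition \<Xi> :: "nat \<Rightarrow> 'w \<Rightarrow> real^'n" where "\<Xi> t \<omega> = g t \<omega> - fam.dF (x t \<omega>)"

lemma measurable_\<Xi>: "t < T \<Longrightarrow> (\<lambda>\<omega>. tangential_proj C (\<Xi> t \<omega>)) \<in> borel_measurable M"
proof -
  assume t: "t < T"
  have "g t \<in> borel_measurable M"
    using measurable_F_M[OF measurable_g_past[OF t]] measurable_x t by auto
  moreover have "(\<lambda>\<omega>. fam.dF (x t \<omega>)) \<in> borel_measurable M"
    using t measurable_F_M[OF measurable_comp_x[OF fam.continuous_on_dF _ measurable_x, of t t]] by simp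
  ultimately have "\<Xi> t \<in> borel_measurable M" unfolding \<Xi>_def by simp
  then show ?thesis
    by (rule measurable_compose[OF _ borel_measurable_continuous_onI[OF fam.continuous_on_P[OF continuous_on_id]]])
qed

lemma exact: "t < T \<Longrightarrow> t \<in> range s \<Longrightarrow> \<omega> \<in> space M \<Longrightarrow> tangential_proj C (\<Xi> t \<omega>) = 0"
  using linear_0[OF fam.P_linear] by (simp add: \<Xi>_def g_exact)

lemma sampling:
  assumes "t < T" "t \<notin> range s"
  shows "uniform_sampling M (F t) m (b t) (ind t)"
proof (intro uniform_sampling.intro uniform_sampling_axioms.intro)
  show "prob_space M" by unfold_locales
  show "ind t j \<in> measurable M (count_space {1..m})" if "j \<in> {1..b t}" for j
    by (rule measurable_F_M[OF ind_measurable[OF assms that]])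
qed (rule F_sub summands batch_pos ind_uniform[OF assms] ind_indep[OF assms], assumption?)+

text \<open>By linearity the tangential noise is the sampling error of the projected gradient
  differences, whose mean square is \<open>q\<close> between iterate and snapshot.\<close>

lemma P_\<Xi>_sampled:
  assumes "t < T" "t \<notin> range s" "\<omega> \<in> space M"
  shows "tangential_proj C (\<Xi> t \<omega>) = uniform_sampling.err m (b t) (ind t) (\<lambda>i \<omega>. tangential_proj C (\<phi> t i \<omega>)) \<omega>"
proof -
  interpret us: uniform_sampling M "F t" m "b t" "ind t" by (rule sampling[OF assms(1,2)])
  note lin = linear_add[OF fam.P_linear] linear_diff[OF fam.P_linear] linear_sum[OF fam.P_linear] linear_scale[OF fam.P_linear]
  have "\<Xi> t \<omega> = (1 / real (b t)) *\<^sub>R (\<Sum>j=1..b t. \<phi> t (ind t j \<omega>) \<omega>) - (1 / real m) *\<^sub>R (\<Sum>i=1..m. \<phi> t i \<omega>)"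
    by (simp add: \<Xi>_def g_sampled assms fam.dF_def \<phi>_def sum_subtractf scaleR_diff_right)
  then show ?thesis
    by (simp add: us.err_def us.avg_def lin)
qed

lemma unbiased:
  assumes t: "t < T" and xo: "xo \<in> C"
  shows "expectation (\<lambda>\<omega>. tangential_proj C (\<Xi> t \<omega>) \<bullet> (x t \<omega> - xo)) = 0"
proof (cases "t \<in> range s")
  case True
  then show ?thesis using exact[OF t] by (subst Bochner_Integration.integral_cong[OF refl, where g="\<lambda>_. 0"]) auto
next
  case False
  interpret us: uniform_sampling M "F t" m "b t" "ind t" by (rule sampling[OF t False])
  have "expectation (\<lambda>\<omega>. tangential_proj C (\<Xi> t \<omega>) \<bullet> (x t \<omega> - xo))
      = expectation (\<lambda>\<omega>. us.err (\<lambda>i \<omega>. tangential_proj C (\<phi> t i \<omega>)) \<omega> \<bullet> (x t \<omega> - xo))"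
    by (rule Bochner_Integration.integral_cong) (simp_all add: P_\<Xi>_sampled[OF t False])
  also have "\<dots> = 0"
  proof (rule us.err_unbiased[OF measurable_\<phi>[OF t] \<phi>_bound[OF t]])
    show "(\<lambda>\<omega>. x t \<omega> - xo) \<in> borel_measurable (F t)"
      using measurable_x[of t] t by simp
    show "norm (x t \<omega> - xo) \<le> D" if "\<omega> \<in> space M" for \<omega>
      using t that xo by (intro C_diameter x_in) auto
  qed
  finally show ?thesis .
qed

lemma variance:
  assumes t: "t < T" "t \<notin> range s"
  shows "expectation (\<lambda>\<omega>. (norm (tangential_proj C (\<Xi> t \<omega>)))\<^sup>2) \<le> expectation (\<lambda>\<omega>. fam.q (x t \<omega>) (x (\<sigma> t) \<omega>)) / real (b t)"
proof -
  interpret us: uniform_sampling M "F t" m "b t" "ind t" by (rule sampling[OF t])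
  have "expectation (\<lambda>\<omega>. (norm (tangential_proj C (\<Xi> t \<omega>)))\<^sup>2)
      = expectation (\<lambda>\<omega>. (norm (us.err (\<lambda>i \<omega>. tangential_proj C (\<phi> t i \<omega>)) \<omega>))\<^sup>2)"
    by (rule Bochner_Integration.integral_cong) (simp_all add: P_\<Xi>_sampled[OF t])
  also have "\<dots> \<le> expectation (\<lambda>\<omega>. (\<Sum>i=1..m. (norm (tangential_proj C (\<phi> t i \<omega>)))\<^sup>2) / real m) / real (b t)"
    by (rule us.err_variance[OF measurable_\<phi>[OF t(1)] \<phi>_bound[OF t(1)]])
  finally show ?thesis by (simp add: fam.q_def \<phi>_def)
qed

lemma \<Xi>_bound: "t < T \<Longrightarrow> \<omega> \<in> space M \<Longrightarrow> norm (tangential_proj C (\<Xi> t \<omega>)) \<le> 2 * (L * D)"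
proof (cases "t \<in> range s")
  case True
  then show "t < T \<Longrightarrow> \<omega> \<in> space M \<Longrightarrow> ?thesis" using exact fam.D_nonneg L_pos by simp
next
  case False
  assume t: "t < T" and \<omega>: "\<omega> \<in> space M"
  interpret us: uniform_sampling M "F t" m "b t" "ind t" by (rule sampling[OF t False])
  show ?thesis
    unfolding P_\<Xi>_sampled[OF t False \<omega>]
    by (rule us.err_bound[OF measurable_\<phi>[OF t] \<phi>_bound[OF t] \<omega>])
qed

lemma minimizer: "\<exists>xo\<in>C. (\<forall>u\<in>C. fam.F xo \<le> fam.F u) \<and> (INF z\<in>C. finite_sum m f z) = fam.F xo"
proof -
  obtain xo where xo: "xo \<in> C" "\<forall>u\<in>C. fam.F xo \<le> fam.F u"
    using continuous_attains_inf[OF compact _ fam.continuous_on_F] x0_in by auto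
  moreover have "(INF z\<in>C. finite_sum m f z) = fam.F xo"
    unfolding finite_sum_eq using xo by (intro cInf_eq_minimum) auto
  ultimately show ?thesis by blast
qed

theorem expected_gap:
  assumes t: "1 \<le> t" "t \<le> T"
  shows "expectation (\<lambda>\<omega>. finite_sum m f (x t \<omega>)) - (INF z\<in>C. finite_sum m f z)
    \<le> 2 * L * D\<^sup>2 * (real K + 1 + \<kappa>) / (real t + 2)"
proof -
  obtain xo where min: "xo \<in> C" "\<And>u. u \<in> C \<Longrightarrow> fam.F xo \<le> fam.F u" "(INF z\<in>C. finite_sum m f z) = fam.F xo"
    using minimizer by blast
  show ?thesis
  proof (cases "D = 0")
    \<comment> \<open>\<open>C\<close> is a single point. The normalization by L D^2 excludes this
      case from \<open>svrf_process\<close>.\<close>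
    case True
    have "x t \<omega> = xo" if "\<omega> \<in> space M" for \<omega>
      using C_diameter[OF x_in[OF t(2) that] min(1)] True by simp
    then have "expectation (\<lambda>\<omega>. fam.F (x t \<omega>)) = fam.F xo"
      by (subst Bochner_Integration.integral_cong[OF refl, where g="\<lambda>_. fam.F xo"]) (auto simp: prob_space)
    then show ?thesis using True by (simp add: finite_sum_eq min(3)[unfolded finite_sum_eq])
  next
    case False
    interpret svrf_process C m f "\<lambda>i. gradient (f i)" L D "tangential_proj C" M K T \<kappa> "\<lambda>t. real (b t)" \<sigma>
      "range s" x \<Xi> xo "\<lambda>_. 2 * (L * D)"
    proof
      show "0 < D" using False fam.D_nonneg by simp
      show "1 \<le> K" using K_pos by simp
      show "1 \<le> \<kappa>" by (rule \<kappa>_ge)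
      show "x t \<in> borel_measurable M" if "t \<le> T" for t
        by (rule measurable_F_M[OF measurable_x[OF that]])
      show "\<exists>g A y v. outer_step C m f (\<lambda>i. gradient (f i)) L D (tangential_proj C) (x t \<omega>) g A \<kappa>
          (2 / (real t + 2)) K y v \<and> g - fam.dF (x t \<omega>) = \<Xi> t \<omega> \<and> x (Suc t) \<omega> = y K"
        if "t < T" "\<omega> \<in> space M" for t \<omega>
        using outer_step_run[OF that x_in] outer_step[OF that(2,1)] that
        by (intro exI[of _ "g t \<omega>"] exI[of _ "scale t \<omega>"] exI[of _ "\<lambda>k. y t k \<omega>"] exI[of _ "\<lambda>k. v t k \<omega>"])
          (auto simp: \<Xi>_def)
      show "12 * (2 * (real K + 1 + \<kappa>)) * (real t + 2) \<le> real (b t)" for t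
        unfolding b_eq by (rule order_trans[OF _ real_nat_ceiling_ge]) simp
    qed (use min x_in measurable_\<Xi> \<Xi>_bound unbiased variance exact \<sigma>_recent \<sigma>_le zero_snapshot in auto)
    show ?thesis
      unfolding min(3) using expected_gap_le[OF t] by (simp add: finite_sum_eq)
  qed
qed

end

text \<open>The ratio \<kappa> need not be an integer, so the batch size is rounded up; the minimum
  over the compact set is written as an infimum.\<close>

theorem theorem3p5:
  fixes M :: "'w measure" and F :: "nat \<Rightarrow> 'w measure"
    and C :: "(real^'n) set" and f :: "nat \<Rightarrow> real^'n \<Rightarrow> real"
    and m K T t :: nat and lm lp \<eta> \<gamma> :: "nat \<Rightarrow> real"
    and x :: "nat \<Rightarrow> 'w \<Rightarrow> real^'n" and L D \<kappa> :: real
  assumes "compact C" and "convex C" and "1 \<le> m"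
    and "\<And>i. i \<in> {1..m} \<Longrightarrow> convex_on UNIV (f i)"
    and "\<And>i z. i \<in> {1..m} \<Longrightarrow> f i differentiable (at z)"
    and "\<And>i. i \<in> {1..m} \<Longrightarrow> \<exists>B. B-lipschitz_on C (gradient (f i))"
    and "L = smoothness_const C m f"
    and "D = diameter C"
    and "\<kappa> = lp 0 / lm 0"
    and "adasvrf M F C m f T x0 s b lm lp K \<eta> \<gamma> ind x xs g A H y v"
    and "\<And>k. s k = 2 ^ k - 1"
    and "\<And>\<tau>. b \<tau> = nat \<lceil>24 * (real K + 1 + \<kappa>) * (real \<tau> + 2)\<rceil>"
    and "\<And>\<tau>. \<eta> \<tau> = lm \<tau> / L"
    and "\<And>\<tau>. \<gamma> \<tau> = 2 / (real \<tau> + 2)"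
    and "t \<in> {1..T}"
  shows "prob_space.expectation M (\<lambda>\<omega>. finite_sum m f (x t \<omega>)) - (INF z\<in>C. finite_sum m f z)
           \<le> 2 * L * D\<^sup>2 * (real K + 1 + \<kappa>) / (real t + 2)"
proof -
  have bounded: "bounded C" using assms(1) by (rule compact_imp_bounded)
  interpret adasvrf_rates M F C m f T x0 s b lm lp K \<eta> \<gamma> ind x xs g A H y v L D \<kappa>
  proof (intro adasvrf_rates.intro adasvrf_rates_axioms.intro)
    show "norm (gradient (f i) u - gradient (f i) w) \<le> L * norm (u - w)"
      if "i \<in> {1..m}" "u \<in> C" "w \<in> C" for i u w
      using assms(6)[OF that(1)] lipschitz_smoothness_const[OF that(1) _ that(2,3)] by (auto simp: assms(7))
    show "norm (u - w) \<le> D" if "u \<in> C" "w \<in> C" for u w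
      using diameter_bounded_bound[OF bounded that] by (simp add: assms(8) dist_norm)
  qed (use assms in auto)
  show ?thesis using expected_gap[of t] assms(15) by simp
qed

end
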